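(* Let $\mathcal V$ be a descent category and let $f:X\to Y$ be a morphism of simplicial spaces. (a) If $n\ge0$ and $f$ is a fibration (respectively a hypercover), then the induced morphism of simplicial spaces $P_nX\to P_{\partial\Delta^n}X\times_{P_{\partial\Delta^n}Y}P_nY$ is a fibration (respectively a hypercover). (b) If $f$ is a fibration, $n>0$ and $0\le i\le n$, then the induced morphism $P_nX\to P_{\Lambda^n_i}X\times_{P_{\Lambda^n_i}Y}P_nY$ is a hypercover.
   Context: A descent category is a small category $\mathcal V$ with a subcategory of morphisms called covers such that: $\mathcal V$ has finite limits; pullbacks of covers are covers; if $f$ and $g\circ f$ are covers then $g$ is a cover. A simplicial space is a simplicial object in $\mathcal V$. For a simplicial space $X$ and a finite simplicial set $T$ (finitely many nondegenerate simplices), $\mathrm{Map}(T,X)$ is the finite limit representing simplicial maps $T\to X$; for $f:X\to Y$ and $S\subset T$, $\mathrm{Map}(S\hookrightarrow T,f)=\mathrm{Map}(S,X)\times_{\mathrm{Map}(S,Y)}\mathrm{Map}(T,Y)$. $\Lambda^n_i=\bigcup_{j\neq i}\partial_j\Delta^n$ is the horn, $\partial\Delta^n$ the boundary. For a finite simplicial set $T$, $P_TX$ is the simplicial space with $(P_TX)_m=\mathrm{Map}(T\times\Delta^m,X)$, and $P_nX=P_{\Delta^n}X$. A morphism $f:X\to Y$ is a fibration if $X_n\to\mathrm{Map}(\Lambda^n_i\hookrightarrow\Delta^n,f)$ is a cover for all $n>0$, $0\le i\le n$; a hypercover if $X_n\to\mathrm{Map}(\partial\Delta^n\hookrightarrow\Delta^n,f)$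 is a cover for all $n\ge0$. *)

theory Defs
  imports Main
begin

record ('o, 'a) cat =
  Obj  :: "'o set"
  Arr  :: "'a set"
  Dom  :: "'a \<Rightarrow> 'o"
  Cod  :: "'a \<Rightarrow> 'o"
  Ident :: "'o \<Rightarrow> 'a"
  Comp :: "'a \<Rightarrow> 'a \<Rightarrow> 'a"   (* Comp g f = g o f *)

definition hom :: "('o, 'a) cat \<Rightarrow> 'o \<Rightarrow> 'o \<Rightarrow> 'a set" where
  "hom C x y = {h \<in> Arr C. Dom C h = x \<and> Cod C h = y}"

definition is_cat :: "('o, 'a) cat \<Rightarrow> bool" where
  "is_cat C \<longleftrightarrow>
     (\<forall>h \<in> Arr C. Dom C h \<in> Obj C \<and> Cod C h \<in> Obj C) \<and>
     (\<forall>x \<in> Obj C. Ident C x \<in> hom C x x) \<and>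
     (\<forall>f \<in> Arr C. \<forall>g \<in> Arr C. Dom C g = Cod C f \<longrightarrow>
         Comp C g f \<in> hom C (Dom C f) (Cod C g)) \<and>
     (\<forall>f \<in> Arr C. Comp C (Ident C (Cod C f)) f = f \<and> Comp C f (Ident C (Dom C f)) = f) \<and>
     (\<forall>f \<in> Arr C. \<forall>g \<in> Arr C. \<forall>h \<in> Arr C.
         Dom C g = Cod C f \<longrightarrow> Dom C h = Cod C g \<longrightarrow>
         Comp C h (Comp C g f) = Comp C (Comp C h g) f)"

definition is_functor :: "(nat, nat) cat \<Rightarrow> ('o, 'a) cat \<Rightarrow> (nat \<Rightarrow> 'o) \<Rightarrow> (nat \<Rightarrow> 'a) \<Rightarrow> bool" where
  "is_functor J C Do Da \<longleftrightarrow>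
     (\<forall>j \<in> Obj J. Do j \<in> Obj C) \<and>
     (\<forall>e \<in> Arr J. Da e \<in> hom C (Do (Dom J e)) (Do (Cod J e))) \<and>
     (\<forall>j \<in> Obj J. Da (Ident J j) = Ident C (Do j)) \<and>
     (\<forall>e \<in> Arr J. \<forall>e' \<in> Arr J. Dom J e' = Cod J e \<longrightarrow> Da (Comp J e' e) = Comp C (Da e') (Da e))"

definition is_limit :: "(nat, nat) cat \<Rightarrow> ('o, 'a) cat \<Rightarrow> (nat \<Rightarrow> 'o) \<Rightarrow> (nat \<Rightarrow> 'a)
    \<Rightarrow> 'o \<Rightarrow> (nat \<Rightarrow> 'a) \<Rightarrow> bool" where
  "is_limit J C Do Da L p \<longleftrightarrow>
     L \<in> Obj C \<and>
     (\<forall>j \<in> Obj J. p j \<in> hom C L (Do j)) \<and>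
     (\<forall>e \<in> Arr J. Comp C (Da e) (p (Dom J e)) = p (Cod J e)) \<and>
     (\<forall>Z q. Z \<in> Obj C \<and> (\<forall>j \<in> Obj J. q j \<in> hom C Z (Do j)) \<and>
            (\<forall>e \<in> Arr J. Comp C (Da e) (q (Dom J e)) = q (Cod J e)) \<longrightarrow>
        (\<exists>!h. h \<in> hom C Z L \<and> (\<forall>j \<in> Obj J. Comp C (p j) h = q j)))"

definition has_finite_limits :: "('o, 'a) cat \<Rightarrow> bool" where
  "has_finite_limits C \<longleftrightarrow>
     (\<forall>J Do Da. is_cat J \<and> finite (Obj J) \<and> finite (Arr J) \<and> is_functor J C Do Da \<longrightarrow>
        (\<exists>L p. is_limit J C Do Da L p))"

definition is_pullback :: "('o, 'a) cat \<Rightarrow> 'a \<Rightarrow> 'a \<Rightarrow> 'a \<Rightarrow> 'a \<Rightarrow> bool" where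
  "is_pullback C f g p q \<longleftrightarrow>
     f \<in> Arr C \<and> g \<in> Arr C \<and> p \<in> Arr C \<and> q \<in> Arr C \<and>
     Cod C f = Cod C g \<and> Dom C p = Dom C q \<and> Cod C p = Dom C f \<and> Cod C q = Dom C g \<and>
     Comp C f p = Comp C g q \<and>
     (\<forall>p' q'. p' \<in> Arr C \<and> q' \<in> Arr C \<and> Dom C p' = Dom C q' \<and>
              Cod C p' = Dom C f \<and> Cod C q' = Dom C g \<and> Comp C f p' = Comp C g q' \<longrightarrow>
        (\<exists>!h. h \<in> hom C (Dom C p') (Dom C p) \<and> Comp C p h = p' \<and> Comp C q h = q'))"

definition descent_cat :: "('o, 'a) cat \<Rightarrow> ('a \<Rightarrow> bool) \<Rightarrow> bool" where
  "descent_cat C cov \<longleftrightarrow>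
     is_cat C \<and> has_finite_limits C \<and>
     (\<forall>h. cov h \<longrightarrow> h \<in> Arr C) \<and>
     (\<forall>x \<in> Obj C. cov (Ident C x)) \<and>
     (\<forall>f g. cov f \<and> cov g \<and> Dom C g = Cod C f \<longrightarrow> cov (Comp C g f)) \<and>
     (\<forall>f g p q. is_pullback C f g p q \<and> cov f \<longrightarrow> cov q) \<and>
     (\<forall>f g. f \<in> Arr C \<and> g \<in> Arr C \<and> Dom C g = Cod C f \<and> cov f \<and> cov (Comp C g f) \<longrightarrow> cov g)"

text \<open>Monotone maps \<open>[m] \<rightarrow> [n]\<close>, represented extensionally (value 0 outside \<open>{0..m}\<close>).\<close>

definition Dop :: "nat \<Rightarrow> nat \<Rightarrow> (nat \<Rightarrow> nat) set" where
  "Dop m n = {\<theta>. (\<forall>i j. i \<le> j \<and> j \<le> m \<longrightarrow> \<theta> i \<le> \<theta> j) \<and> (\<forall>i \<le> m. \<theta> i \<le> n) \<and> (\<forall>i. m < i \<longrightarrow> \<theta> i = 0)}"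

definition cmp :: "(nat \<Rightarrow> nat) \<Rightarrow> (nat \<Rightarrow> nat) \<Rightarrow> nat \<Rightarrow> (nat \<Rightarrow> nat)" where
  "cmp \<theta> \<phi> k = (\<lambda>i. if i \<le> k then \<theta> (\<phi> i) else 0)"   (* \<theta> o \<phi>, with \<phi> : [k] \<rightarrow> _ *)

definition idn :: "nat \<Rightarrow> (nat \<Rightarrow> nat)" where
  "idn n = (\<lambda>i. if i \<le> n then i else 0)"

text \<open>A simplicial set: carriers \<open>S k\<close> and action \<open>act m n \<theta> x\<close> for \<open>\<theta> : [m] \<rightarrow> [n]\<close>, \<open>x \<in> S n\<close>.\<close>

type_synonym 's sset = "(nat \<Rightarrow> 's set) \<times> (nat \<Rightarrow> nat \<Rightarrow> (nat \<Rightarrow> nat) \<Rightarrow> 's \<Rightarrow> 's)"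

definition Delta :: "nat \<Rightarrow> (nat \<Rightarrow> nat) sset" where
  "Delta n = ((\<lambda>k. Dop k n), (\<lambda>m k \<theta> \<psi>. cmp \<psi> \<theta> m))"

definition bdry :: "nat \<Rightarrow> (nat \<Rightarrow> nat) sset" where
  "bdry n = ((\<lambda>k. {\<psi> \<in> Dop k n. \<exists>j \<le> n. j \<notin> \<psi> ` {..k}}), (\<lambda>m k \<theta> \<psi>. cmp \<psi> \<theta> m))"

definition horn :: "nat \<Rightarrow> nat \<Rightarrow> (nat \<Rightarrow> nat) sset" where
  "horn n i = ((\<lambda>k. {\<psi> \<in> Dop k n. \<exists>j \<le> n. j \<noteq> i \<and> j \<notin> \<psi> ` {..k}}), (\<lambda>m k \<theta> \<psi>. cmp \<psi> \<theta> m))"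

definition prodD :: "'s sset \<Rightarrow> nat \<Rightarrow> ('s \<times> (nat \<Rightarrow> nat)) sset" where
  "prodD T m = ((\<lambda>k. fst T k \<times> Dop k m),
                (\<lambda>k' k \<theta> tp. (snd T k' k \<theta> (fst tp), cmp (snd tp) \<theta> k')))"

text \<open>A simplicial space: objects \<open>X n\<close>, and arrows \<open>X(\<theta>) : X n \<rightarrow> X m\<close> for \<open>\<theta> : [m] \<rightarrow> [n]\<close>.\<close>

type_synonym ('o, 'a) sspace = "(nat \<Rightarrow> 'o) \<times> (nat \<Rightarrow> nat \<Rightarrow> (nat \<Rightarrow> nat) \<Rightarrow> 'a)"

definition is_sspace :: "('o, 'a) cat \<Rightarrow> ('o, 'a) sspace \<Rightarrow> bool" where
  "is_sspace C X \<longleftrightarrow>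
     (\<forall>n. fst X n \<in> Obj C) \<and>
     (\<forall>m n \<theta>. \<theta> \<in> Dop m n \<longrightarrow> snd X m n \<theta> \<in> hom C (fst X n) (fst X m)) \<and>
     (\<forall>n. snd X n n (idn n) = Ident C (fst X n)) \<and>
     (\<forall>k m n \<phi> \<theta>. \<phi> \<in> Dop k m \<and> \<theta> \<in> Dop m n \<longrightarrow>
        snd X k n (cmp \<theta> \<phi> k) = Comp C (snd X k m \<phi>) (snd X m n \<theta>))"

definition is_smor :: "('o, 'a) cat \<Rightarrow> ('o, 'a) sspace \<Rightarrow> ('o, 'a) sspace \<Rightarrow> (nat \<Rightarrow> 'a) \<Rightarrow> bool" where
  "is_smor C X Y f \<longleftrightarrow>
     (\<forall>n. f n \<in> hom C (fst X n) (fst Y n)) \<and>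
     (\<forall>m n \<theta>. \<theta> \<in> Dop m n \<longrightarrow> Comp C (f m) (snd X m n \<theta>) = Comp C (snd Y m n \<theta>) (f n))"

text \<open>A \<open>T\<close>-point of \<open>X\<close> at \<open>Z\<close>: a simplicial map \<open>T \<rightarrow> Hom(Z, X_\<bullet>)\<close>.\<close>

definition spoint :: "('o, 'a) cat \<Rightarrow> 's sset \<Rightarrow> ('o, 'a) sspace \<Rightarrow> 'o \<Rightarrow> (nat \<Rightarrow> 's \<Rightarrow> 'a) \<Rightarrow> bool" where
  "spoint C T X Z u \<longleftrightarrow>
     (\<forall>k. \<forall>t \<in> fst T k. u k t \<in> hom C Z (fst X k)) \<and>
     (\<forall>m n \<theta> t. \<theta> \<in> Dop m n \<and> t \<in> fst T n \<longrightarrow>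
        Comp C (snd X m n \<theta>) (u n t) = u m (snd T m n \<theta> t))"

text \<open>\<open>Map(T,X)\<close>: an object \<open>M\<close> with universal \<open>T\<close>-point \<open>u\<close> (the limit representing
  simplicial maps \<open>T \<rightarrow> X\<close>).\<close>

definition is_Map :: "('o, 'a) cat \<Rightarrow> 's sset \<Rightarrow> ('o, 'a) sspace \<Rightarrow> 'o \<Rightarrow> (nat \<Rightarrow> 's \<Rightarrow> 'a) \<Rightarrow> bool" where
  "is_Map C T X M u \<longleftrightarrow>
     M \<in> Obj C \<and> spoint C T X M u \<and>
     (\<forall>Z v. Z \<in> Obj C \<and> spoint C T X Z v \<longrightarrow>
        (\<exists>!h. h \<in> hom C Z M \<and> (\<forall>k. \<forall>t \<in> fst T k. Comp C (u k t) h = v k t)))"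

text \<open>\<open>Map(S \<hookrightarrow> T, f) = Map(S,X) \<times>_{Map(S,Y)} Map(T,Y)\<close> for \<open>S \<subseteq> T\<close>: an object \<open>P\<close>
  with its two projections, recorded as the composite points \<open>a\<close> (an \<open>S\<close>-point of \<open>X\<close>)
  and \<open>b\<close> (a \<open>T\<close>-point of \<open>Y\<close>).\<close>

definition is_RelMap :: "('o, 'a) cat \<Rightarrow> 's sset \<Rightarrow> 's sset \<Rightarrow> ('o, 'a) sspace \<Rightarrow> ('o, 'a) sspace
    \<Rightarrow> (nat \<Rightarrow> 'a) \<Rightarrow> 'o \<Rightarrow> (nat \<Rightarrow> 's \<Rightarrow> 'a) \<Rightarrow> (nat \<Rightarrow> 's \<Rightarrow> 'a) \<Rightarrow> bool" where
  "is_RelMap C S T X Y f P a b \<longleftrightarrow>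
    (\<exists>MSX uX MSY uY MTY uT r s p1 p2.
       is_Map C S X MSX uX \<and> is_Map C S Y MSY uY \<and> is_Map C T Y MTY uT \<and>
       r \<in> hom C MSX MSY \<and>
       (\<forall>k. \<forall>t \<in> fst S k. Comp C (uY k t) r = Comp C (f k) (uX k t)) \<and>
       s \<in> hom C MTY MSY \<and>
       (\<forall>k. \<forall>t \<in> fst S k. Comp C (uY k t) s = uT k t) \<and>
       is_pullback C r s p1 p2 \<and> Dom C p1 = P \<and>
       (\<forall>k. \<forall>t \<in> fst S k. a k t = Comp C (uX k t) p1) \<and>
       (\<forall>k. \<forall>t \<in> fst T k. b k t = Comp C (uT k t) p2))"

text \<open>The canonical morphism \<open>X_n \<rightarrow> Map(S \<hookrightarrow> \<Delta>^n, f)\<close> (using \<open>X_n = Map(\<Delta>^n, X)\<close>)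
  is a cover, for every choice of the finite limit.\<close>

definition rel_cover :: "('o, 'a) cat \<Rightarrow> ('a \<Rightarrow> bool) \<Rightarrow> (nat \<Rightarrow> nat) sset \<Rightarrow> nat
    \<Rightarrow> ('o, 'a) sspace \<Rightarrow> ('o, 'a) sspace \<Rightarrow> (nat \<Rightarrow> 'a) \<Rightarrow> bool" where
  "rel_cover C cov S n X Y f \<longleftrightarrow>
     (\<forall>P a b h. is_RelMap C S (Delta n) X Y f P a b \<and> h \<in> hom C (fst X n) P \<and>
        (\<forall>k. \<forall>\<theta> \<in> fst S k. Comp C (a k \<theta>) h = snd X k n \<theta>) \<and>
        (\<forall>k. \<forall>\<theta> \<in> Dop k n. Comp C (b k \<theta>) h = Comp C (snd Y k n \<theta>) (f n))
        \<longrightarrow> cov h)"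

definition fibration :: "('o, 'a) cat \<Rightarrow> ('a \<Rightarrow> bool) \<Rightarrow> ('o, 'a) sspace \<Rightarrow> ('o, 'a) sspace
    \<Rightarrow> (nat \<Rightarrow> 'a) \<Rightarrow> bool" where
  "fibration C cov X Y f \<longleftrightarrow> (\<forall>n i. 0 < n \<and> i \<le> n \<longrightarrow> rel_cover C cov (horn n i) n X Y f)"

definition hypercover :: "('o, 'a) cat \<Rightarrow> ('a \<Rightarrow> bool) \<Rightarrow> ('o, 'a) sspace \<Rightarrow> ('o, 'a) sspace
    \<Rightarrow> (nat \<Rightarrow> 'a) \<Rightarrow> bool" where
  "hypercover C cov X Y f \<longleftrightarrow> (\<forall>n. rel_cover C cov (bdry n) n X Y f)"

text \<open>\<open>P\<close> is (a choice of) \<open>P_T X\<close>, with \<open>u m\<close> the universal \<open>T \<times> \<Delta>^m\<close>-point exhibiting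
  \<open>P_m = Map(T \<times> \<Delta>^m, X)\<close>; its structure maps are the induced ones.\<close>

definition is_PT :: "('o, 'a) cat \<Rightarrow> 's sset \<Rightarrow> ('o, 'a) sspace \<Rightarrow> ('o, 'a) sspace
    \<Rightarrow> (nat \<Rightarrow> nat \<Rightarrow> ('s \<times> (nat \<Rightarrow> nat)) \<Rightarrow> 'a) \<Rightarrow> bool" where
  "is_PT C T X P u \<longleftrightarrow>
     is_sspace C P \<and>
     (\<forall>m. is_Map C (prodD T m) X (fst P m) (u m)) \<and>
     (\<forall>m m' \<phi>. \<phi> \<in> Dop m' m \<longrightarrow>
        (\<forall>k. \<forall>t \<in> fst T k. \<forall>\<psi> \<in> Dop k m'.
           Comp C (u m' k (t, \<psi>)) (snd P m' m \<phi>) = u m k (t, cmp \<phi> \<psi> k)))"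

text \<open>For \<open>S \<subseteq> T\<close>: \<open>PT\<close> is \<open>P_T X\<close>, \<open>Q\<close> is \<open>P_S X \<times>_{P_S Y} P_T Y\<close> and \<open>g : P_T X \<rightarrow> Q\<close> is the
  induced morphism (all limits chosen arbitrarily).\<close>

definition rel_path :: "('o, 'a) cat \<Rightarrow> 's sset \<Rightarrow> 's sset \<Rightarrow> ('o, 'a) sspace \<Rightarrow> ('o, 'a) sspace
    \<Rightarrow> (nat \<Rightarrow> 'a) \<Rightarrow> ('o, 'a) sspace \<Rightarrow> ('o, 'a) sspace \<Rightarrow> (nat \<Rightarrow> 'a) \<Rightarrow> bool" where
  "rel_path C T S X Y f PT Q g \<longleftrightarrow>
    (\<exists>u1 PS u2 PSY u3 PTY u4 \<rho>X fS \<rho>Y fT q1 q2.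
       is_PT C T X PT u1 \<and> is_PT C S X PS u2 \<and> is_PT C S Y PSY u3 \<and> is_PT C T Y PTY u4 \<and>
       (\<forall>m. \<rho>X m \<in> hom C (fst PT m) (fst PS m) \<and>
            (\<forall>k. \<forall>p \<in> fst (prodD S m) k. Comp C (u2 m k p) (\<rho>X m) = u1 m k p)) \<and>
       (\<forall>m. fS m \<in> hom C (fst PS m) (fst PSY m) \<and>
            (\<forall>k. \<forall>p \<in> fst (prodD S m) k. Comp C (u3 m k p) (fS m) = Comp C (f k) (u2 m k p))) \<and>
       (\<forall>m. \<rho>Y m \<in> hom C (fst PTY m) (fst PSY m) \<and>
            (\<forall>k. \<forall>p \<in> fst (prodD S m) k. Comp C (u3 m k p) (\<rho>Y m) = u4 m k p)) \<and>
       (\<forall>m. fT m \<in> hom C (fst PT m) (fst PTY m) \<and>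
            (\<forall>k. \<forall>p \<in> fst (prodD T m) k. Comp C (u4 m k p) (fT m) = Comp C (f k) (u1 m k p))) \<and>
       is_sspace C Q \<and> is_smor C Q PS q1 \<and> is_smor C Q PTY q2 \<and>
       (\<forall>m. is_pullback C (fS m) (\<rho>Y m) (q1 m) (q2 m)) \<and>
       (\<forall>m. g m \<in> hom C (fst PT m) (fst Q m) \<and>
            Comp C (q1 m) (g m) = \<rho>X m \<and> Comp C (q2 m) (g m) = fT m))"

end

theory Submission
  imports Defs
begin

text \<open>
  By adjunction, a map from \<open>K \<hookrightarrow> \<Delta>\<^sup>m\<close> to the morphism of path spaces induced by \<open>S \<hookrightarrow> T\<close> and \<open>f\<close> is a map
  from the pushout product \<open>T \<times> K \<union> S \<times> \<Delta>\<^sup>m \<hookrightarrow> T \<times> \<Delta>\<^sup>m\<close> to \<open>f\<close>. For \<open>T = \<Delta>\<^sup>n\<close> this inclusion is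
  a composite of attachments of single simplices along their boundary, or along a horn if one of
  \<open>S\<close>, \<open>K\<close> is a horn and the other a boundary. Attaching one simplex changes the space of relative maps by a pullback of
  the cover that the assumption on \<open>f\<close> provides, and covers compose. The horn attachments come from
  an acyclic matching on the chains of \<open>[n] \<times> [m]\<close>.
\<close>

section \<open>Pullbacks and covers\<close>

text \<open>Two obstacles shape the proof. Mapping objects are known only through universal
  properties, with arbitrary choices, and a simplicial set has infinitely many simplices, so the
  stages of a filtration do not have mapping objects on the nose. Existence is obtained by gluing
  simplices, from a terminal object and pullbacks alone, and arrows are compared through the points
  they classify. The other obstacle is the horn case. A chain of [n] x [m] outside the starting
  complex meets every row and every column, except perhaps column i of the horn. A point of column i
  lying in the same row as a point of column i + 1 can be added or removed without changing this,
  which is the origin of the matching. For i = n there is no column i + 1; reversing both orders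
  then makes column i - 1 the next one. Exchanging rows and columns interchanges the horn used for
  path spaces with the horn used to test the fibration property, so (b) and the fibration half of
  (a) are one combinatorial statement.\<close>

lemma homD: "h \<in> hom C x y \<Longrightarrow> h \<in> Arr C \<and> Dom C h = x \<and> Cod C h = y"
  by (simp add: hom_def)

locale category =
  fixes C :: "('o, 'a) cat"
  assumes is_cat: "is_cat C"
begin

abbreviation comp :: "'a \<Rightarrow> 'a \<Rightarrow> 'a" (infixr "\<cdot>" 70) where
  "g \<cdot> f \<equiv> Comp C g f"

lemma comp_hom [intro]:
  assumes "f \<in> hom C x y" "g \<in> hom C y z"
  shows "g \<cdot> f \<in> hom C x z"
  using assms is_cat unfolding is_cat_def hom_def by auto

lemma assoc:
  assumes "f \<in> hom C x y" "g \<in> hom C y z" "h \<in> hom C z w"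
  shows "(h \<cdot> g) \<cdot> f = h \<cdot> g \<cdot> f"
  using assms is_cat unfolding is_cat_def hom_def by auto

lemma hom_objs:
  assumes "f \<in> hom C x y"
  shows "x \<in> Obj C" "y \<in> Obj C"
  using assms is_cat unfolding is_cat_def hom_def by auto

lemma ident_hom [intro]: "x \<in> Obj C \<Longrightarrow> Ident C x \<in> hom C x x"
  using is_cat unfolding is_cat_def by auto

lemma comp_ident:
  assumes "f \<in> hom C x y"
  shows "f \<cdot> Ident C x = f" "Ident C y \<cdot> f = f"
  using assms is_cat unfolding is_cat_def hom_def by auto

text \<open>Composites are kept right-nested. An equation between two-fold composites is used inside
  a longer composite by precomposing with \<open>h\<close> and reassociating both sides;
  \<open>comp_extend1\<close> is the variant with a single arrow on the right.\<close>

lemma comp_extend: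
  assumes "u \<cdot> p = u' \<cdot> p'"
    and "h \<in> hom C x y" "p \<in> hom C y z" "u \<in> hom C z w" "p' \<in> hom C y z'" "u' \<in> hom C z' w"
  shows "u \<cdot> p \<cdot> h = u' \<cdot> p' \<cdot> h"
  using assms(1) assoc[OF assms(2,3,4)] assoc[OF assms(2,5,6)] by simp

lemma comp_extend1:
  assumes "u \<cdot> p = q"
    and "h \<in> hom C x y" "p \<in> hom C y z" "u \<in> hom C z w"
  shows "u \<cdot> p \<cdot> h = q \<cdot> h"
  using assms(1) assoc[OF assms(2,3,4)] by simp

lemma is_pullback_homs:
  assumes "is_pullback C f g p q"
  shows "f \<in> hom C (Dom C f) (Cod C f)" "g \<in> hom C (Dom C g) (Cod C f)"
    "p \<in> hom C (Dom C p) (Dom C f)" "q \<in> hom C (Dom C p) (Dom C g)" "f \<cdot> p = g \<cdot> q"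
  using assms unfolding is_pullback_def hom_def by auto

lemma is_pullback_lift:
  assumes "is_pullback C f g p q" "p' \<in> hom C z (Dom C f)" "q' \<in> hom C z (Dom C g)"
    and "f \<cdot> p' = g \<cdot> q'"
  shows "\<exists>!h. h \<in> hom C z (Dom C p) \<and> p \<cdot> h = p' \<and> q \<cdot> h = q'"
proof -
  have "Dom C p' = z" "p' \<in> Arr C" "q' \<in> Arr C" "Dom C p' = Dom C q'"
    "Cod C p' = Dom C f" "Cod C q' = Dom C g"
    using assms(2,3) by (auto simp: hom_def)
  with assms(1,4) show ?thesis unfolding is_pullback_def by metis
qed

lemma is_pullback_joint_mono:
  assumes pb: "is_pullback C f g p q" and h: "h \<in> hom C z (Dom C p)" "h' \<in> hom C z (Dom C p)"
    and "p \<cdot> h = p \<cdot> h'" "q \<cdot> h = q \<cdot> h'"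
  shows "h = h'"
proof -
  note H = is_pullback_homs[OF pb]
  have "\<exists>!k. k \<in> hom C z (Dom C p) \<and> p \<cdot> k = p \<cdot> h \<and> q \<cdot> k = q \<cdot> h"
    by (rule is_pullback_lift[OF pb]) (use H h comp_extend[OF H(5) h(1)] in auto)
  with assms show ?thesis by metis
qed

text \<open>Existence of a lift and joint monicity of the projections are separated, because they
  are proved by different means in every application.\<close>

lemma is_pullbackI:
  assumes "f \<in> hom C x b" "g \<in> hom C y b" "p \<in> hom C w x" "q \<in> hom C w y" "f \<cdot> p = g \<cdot> q"
    and "\<And>z p' q'. \<lbrakk>p' \<in> hom C z x; q' \<in> hom C z y; f \<cdot> p' = g \<cdot> q'\<rbrakk>
           \<Longrightarrow> \<exists>h. h \<in> hom C z w \<and> p \<cdot> h = p' \<and> q \<cdot> h = q'"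
    and "\<And>z h h'. \<lbrakk>h \<in> hom C z w; h' \<in> hom C z w; p \<cdot> h = p \<cdot> h'; q \<cdot> h = q \<cdot> h'\<rbrakk> \<Longrightarrow> h = h'"
  shows "is_pullback C f g p q"
proof -
  have "\<exists>!h. h \<in> hom C (Dom C p') (Dom C p) \<and> p \<cdot> h = p' \<and> q \<cdot> h = q'"
    if A: "p' \<in> Arr C" "q' \<in> Arr C" "Dom C p' = Dom C q'" "Cod C p' = Dom C f"
      "Cod C q' = Dom C g" "f \<cdot> p' = g \<cdot> q'" for p' q'
  proof -
    have w: "Dom C p = w" using assms(3) by (simp add: hom_def)
    have "p' \<in> hom C (Dom C p') x" "q' \<in> hom C (Dom C p') y"
      using A assms(1,2) by (auto simp: hom_def)
    with assms(6)[OF this A(6)] assms(7) show ?thesis unfolding w by metis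
  qed
  then show ?thesis
    using assms(1-5) unfolding is_pullback_def hom_def by auto
qed

end

section \<open>Covers, terminal objects and pullbacks in a descent category\<close>

locale descent = category C for C :: "('o, 'a) cat" +
  fixes cov :: "'a \<Rightarrow> bool"
  assumes descent_cat: "descent_cat C cov"
begin

lemma cov_comp: "\<lbrakk>cov f; cov g; f \<in> hom C x y; g \<in> hom C y z\<rbrakk> \<Longrightarrow> cov (g \<cdot> f)"
  using descent_cat unfolding descent_cat_def hom_def by blast

lemma cov_pullback: "\<lbrakk>is_pullback C f g p q; cov f\<rbrakk> \<Longrightarrow> cov q"
  using descent_cat unfolding descent_cat_def by blast

text \<open>Among isomorphisms the axioms name only the identities. For invertible \<open>f\<close>
  the square with \<open>f\<close> as both projections over two identities of \<open>y\<close> is a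
  pullback, so \<open>f\<close> is a pullback of an identity.\<close>

lemma cov_iso:
  assumes f: "f \<in> hom C x y" and g: "g \<in> hom C y x"
    and gf: "g \<cdot> f = Ident C x" and fg: "f \<cdot> g = Ident C y"
  shows "cov f"
proof -
  have y: "Ident C y \<in> hom C y y" using f hom_objs by blast
  have "is_pullback C (Ident C y) (Ident C y) f f"
  proof (rule is_pullbackI[OF y y f f])
    fix z p' q' assume A: "p' \<in> hom C z y" "q' \<in> hom C z y" "Ident C y \<cdot> p' = Ident C y \<cdot> q'"
    then have "p' = q'" using comp_ident by metis
    moreover have "f \<cdot> g \<cdot> p' = p'" using comp_extend1[OF fg A(1) g f] A comp_ident by metis
    ultimately show "\<exists>h. h \<in> hom C z x \<and> f \<cdot> h = p' \<and> f \<cdot> h = q'" using A g by blast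
  next
    fix z h h' assume A: "h \<in> hom C z x" "h' \<in> hom C z x" "f \<cdot> h = f \<cdot> h'"
    then show "h = h'"
      using comp_extend1[OF gf A(1) f g] comp_extend1[OF gf A(2) f g] comp_ident by metis
  qed simp
  moreover have "cov (Ident C y)"
    using descent_cat hom_objs[OF f] unfolding descent_cat_def by blast
  ultimately show ?thesis by (rule cov_pullback)
qed

lemma finite_limitE:
  assumes "is_cat J" "finite (Obj J)" "finite (Arr J)" "is_functor J C Do Da"
  obtains L p where "is_limit J C Do Da L p"
  using assms descent_cat unfolding descent_cat_def has_finite_limits_def by meson

text \<open>This is the limit of the empty diagram; it serves as the mapping object of the empty
  simplicial set.\<close>

lemma terminal_exists: "\<exists>L. L \<in> Obj C \<and> (\<forall>z \<in> Obj C. \<exists>!h. h \<in> hom C z L)"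
proof -
  define J :: "(nat, nat) cat" where "J = \<lparr>Obj = {}, Arr = {}, Dom = id, Cod = id, Ident = id, Comp = (\<lambda>_ _. 0)\<rparr>"
  have "is_cat J" "finite (Obj J)" "finite (Arr J)" "is_functor J C (\<lambda>_. undefined) (\<lambda>_. undefined)"
    unfolding is_cat_def is_functor_def J_def by auto
  then obtain L p where "is_limit J C (\<lambda>_. undefined) (\<lambda>_. undefined) L p"
    by (rule finite_limitE)
  then have "L \<in> Obj C" "\<forall>z \<in> Obj C. \<exists>!h. h \<in> hom C z L"
    unfolding is_limit_def J_def by simp_all
  then show ?thesis by (intro exI conjI)
qed

text \<open>The cospan \<open>0 \<rightarrow> 2 \<leftarrow> 1\<close> has the identities \<open>0, 1, 2\<close> and the arrows \<open>3, 4\<close>.\<close>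

lemma pullback_exists:
  assumes f: "f \<in> hom C x b" and g: "g \<in> hom C y b"
  shows "\<exists>w p q. is_pullback C f g p q \<and> p \<in> hom C w x \<and> q \<in> hom C w y"
proof -
  define J :: "(nat, nat) cat" where "J = \<lparr>Obj = {0,1,2}, Arr = {0,1,2,3,4},
    Dom = (\<lambda>e. if e = 3 then 0 else if e = 4 then 1 else e),
    Cod = (\<lambda>e. if e \<ge> 2 then 2 else e), Ident = id, Comp = (\<lambda>e' e. if e' \<le> 2 then e else e')\<rparr>"
  define Do where "Do j = (if j = 0 then x else if j = 1 then y else b)" for j :: nat
  define Da where "Da e = (if e = 3 then f else if e = 4 then g else Ident C (Do e))" for e :: nat
  have objs: "x \<in> Obj C" "y \<in> Obj C" "b \<in> Obj C" using hom_objs f g by blast+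
  have J: "is_cat J" unfolding is_cat_def J_def hom_def by auto
  have finJ: "finite (Obj J)" "finite (Arr J)" by (simp_all add: J_def)
  have Da: "Da e \<in> hom C (Do (Dom J e)) (Do (Cod J e))" if "e \<in> Arr J" for e
    using that f g ident_hom[OF objs(1)] ident_hom[OF objs(2)] ident_hom[OF objs(3)]
    unfolding J_def Da_def Do_def by force
  have "is_functor J C Do Da"
    unfolding is_functor_def
  proof (intro conjI ballI impI)
    \<comment> \<open>Of two composable arrows of the cospan at least one is an identity, so
      functoriality reduces to the identity laws.\<close>
    fix e e' assume A: "e \<in> Arr J" "e' \<in> Arr J" "Dom J e' = Cod J e"
    then have "e \<le> 2 \<and> Da e = Ident C (Do (Dom J e')) \<and> Comp J e' e = e' \<or>
        e' \<le> 2 \<and> Da e' = Ident C (Do (Cod J e)) \<and> Comp J e' e = e"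
      unfolding J_def Da_def Do_def by force
    then show "Da (Comp J e' e) = Da e' \<cdot> Da e"
      using comp_ident[OF Da[OF A(1)]] comp_ident[OF Da[OF A(2)]] by fastforce
  next
    show "Do j \<in> Obj C" for j using objs unfolding Do_def by simp
    show "Da (Ident J j) = Ident C (Do j)" if "j \<in> Obj J" for j
      using that unfolding J_def Da_def by auto
  qed (rule Da)
  then obtain L p where L: "is_limit J C Do Da L p"
    using finite_limitE J by (metis finJ)
  have ph: "p 0 \<in> hom C L x" "p 1 \<in> hom C L y" "p 2 \<in> hom C L b"
    using L unfolding is_limit_def J_def Do_def by auto
  have pe: "f \<cdot> p 0 = p 2" "g \<cdot> p 1 = p 2"
    using L unfolding is_limit_def J_def Do_def Da_def by auto
  have univ: "\<exists>!h. h \<in> hom C z L \<and> p 0 \<cdot> h = p' \<and> p 1 \<cdot> h = q' \<and> p 2 \<cdot> h = f \<cdot> p'"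
    if A: "p' \<in> hom C z x" "q' \<in> hom C z y" "f \<cdot> p' = g \<cdot> q'" for z p' q'
  proof -
    define q where "q j = (if j = 0 then p' else if j = 1 then q' else f \<cdot> p')" for j :: nat
    have "z \<in> Obj C" using A hom_objs by blast
    moreover have "\<forall>j \<in> Obj J. q j \<in> hom C z (Do j)"
      using A(1,2) comp_hom[OF A(1) f] by (auto simp: J_def q_def Do_def)
    moreover have "\<forall>e \<in> Arr J. Da e \<cdot> q (Dom J e) = q (Cod J e)"
      using A(3) comp_ident(2)[OF A(1)] comp_ident(2)[OF A(2)] comp_ident(2)[OF comp_hom[OF A(1) f]]
      by (auto simp: J_def q_def Da_def Do_def)
    ultimately have "\<exists>!h. h \<in> hom C z L \<and> (\<forall>j \<in> Obj J. p j \<cdot> h = q j)"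
      using L unfolding is_limit_def by blast
    then show ?thesis by (simp add: J_def q_def)
  qed
  have "is_pullback C f g (p 0) (p 1)"
  proof (rule is_pullbackI[OF f g ph(1,2)])
    show "f \<cdot> p 0 = g \<cdot> p 1" using pe by simp
  next
    fix z p' q' assume "p' \<in> hom C z x" "q' \<in> hom C z y" "f \<cdot> p' = g \<cdot> q'"
    from univ[OF this] show "\<exists>h. h \<in> hom C z L \<and> p 0 \<cdot> h = p' \<and> p 1 \<cdot> h = q'" by blast
  next
    fix z h h' assume A: "h \<in> hom C z L" "h' \<in> hom C z L" "p 0 \<cdot> h = p 0 \<cdot> h'" "p 1 \<cdot> h = p 1 \<cdot> h'"
    \<comment> \<open>A cone over the cospan also has a leg at the corner \<open>b\<close>. It is
      determined by the leg at \<open>x\<close>, so agreement of \<open>h\<close> and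
      \<open>h'\<close> on two legs gives agreement on all three.\<close>
    have "f \<cdot> p 0 \<cdot> h = p 2 \<cdot> h" "f \<cdot> p 0 \<cdot> h' = p 2 \<cdot> h'" "g \<cdot> p 1 \<cdot> h = p 2 \<cdot> h"
      using comp_extend1[OF pe(1) A(1) ph(1) f] comp_extend1[OF pe(1) A(2) ph(1) f]
        comp_extend1[OF pe(2) A(1) ph(2) g] by auto
    then have "\<exists>!k. k \<in> hom C z L \<and> p 0 \<cdot> k = p 0 \<cdot> h \<and> p 1 \<cdot> k = p 1 \<cdot> h \<and> p 2 \<cdot> k = f \<cdot> p 0 \<cdot> h"
      using A ph by (intro univ) auto
    with A show "h = h'"
      using \<open>f \<cdot> p 0 \<cdot> h = p 2 \<cdot> h\<close> \<open>f \<cdot> p 0 \<cdot> h' = p 2 \<cdot> h'\<close> by metis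
  qed
  with ph show ?thesis by blast
qed

end

section \<open>Points of simplicial spaces\<close>

lemma Dop_cmp: "\<lbrakk>\<theta> \<in> Dop m n; \<phi> \<in> Dop k m\<rbrakk> \<Longrightarrow> cmp \<theta> \<phi> k \<in> Dop k n"
  unfolding Dop_def cmp_def by auto

lemma Dop_idn: "idn n \<in> Dop n n"
  unfolding Dop_def idn_def by auto

lemma cmp_idn: "\<theta> \<in> Dop m n \<Longrightarrow> cmp \<theta> (idn m) m = \<theta>" "\<theta> \<in> Dop m n \<Longrightarrow> cmp (idn n) \<theta> m = \<theta>"
  unfolding Dop_def cmp_def idn_def by auto

lemma cmp_assoc: "\<phi> \<in> Dop k m \<Longrightarrow> cmp (cmp \<chi> \<theta> m) \<phi> k = cmp \<chi> (cmp \<theta> \<phi> k) k"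
  unfolding Dop_def cmp_def by auto

text \<open>A value of type \<open>sset\<close> is raw data without axioms, so stability of the
  carriers under the operators has to be recorded separately.\<close>

definition closed_sset :: "'s sset \<Rightarrow> bool" where
  "closed_sset T \<longleftrightarrow> (\<forall>m n \<theta> t. \<theta> \<in> Dop m n \<longrightarrow> t \<in> fst T n \<longrightarrow> snd T m n \<theta> t \<in> fst T m)"

lemma spointD:
  assumes "spoint C T X Z u"
  shows "t \<in> fst T k \<Longrightarrow> u k t \<in> hom C Z (fst X k)"
    "\<theta> \<in> Dop m k \<Longrightarrow> t \<in> fst T k \<Longrightarrow> Comp C (snd X m k \<theta>) (u k t) = u m (snd T m k \<theta> t)"
  using assms unfolding spoint_def by auto

lemma spointI:
  assumes "\<And>k t. t \<in> fst T k \<Longrightarrow> u k t \<in> hom C Z (fst X k)"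
    and "\<And>m k \<theta> t. \<lbrakk>\<theta> \<in> Dop m k; t \<in> fst T k\<rbrakk>
           \<Longrightarrow> Comp C (snd X m k \<theta>) (u k t) = u m (snd T m k \<theta> t)"
  shows "spoint C T X Z u"
  using assms unfolding spoint_def by auto

lemma is_sspaceD:
  assumes "is_sspace C X"
  shows "fst X n \<in> Obj C" "\<theta> \<in> Dop m n \<Longrightarrow> snd X m n \<theta> \<in> hom C (fst X n) (fst X m)"
    "snd X n n (idn n) = Ident C (fst X n)"
    "\<lbrakk>\<phi> \<in> Dop k m; \<theta> \<in> Dop m n\<rbrakk> \<Longrightarrow> Comp C (snd X k m \<phi>) (snd X m n \<theta>) = snd X k n (cmp \<theta> \<phi> k)"
  using assms unfolding is_sspace_def by auto

lemma is_smorD: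
  assumes "is_smor C X Y f"
  shows "f n \<in> hom C (fst X n) (fst Y n)"
    "\<theta> \<in> Dop m n \<Longrightarrow> Comp C (f m) (snd X m n \<theta>) = Comp C (snd Y m n \<theta>) (f n)"
  using assms unfolding is_smor_def by auto

lemma spoint_cong:
  assumes "spoint C T X Z u" "closed_sset T" "\<And>k t. t \<in> fst T k \<Longrightarrow> u k t = v k t"
  shows "spoint C T X Z v"
  using assms unfolding spoint_def closed_sset_def by metis

lemma spoint_subset:
  assumes "spoint C T X Z u" "\<And>k. fst S k \<subseteq> fst T k" "snd S = snd T"
  shows "spoint C S X Z u"
  using spointD[OF assms(1)] subsetD[OF assms(2)] assms(3) by (auto intro!: spointI)

text \<open>A commutative square from the inclusion of \<open>S\<close> in \<open>T\<close> to the
  map of simplicial sets that \<open>f\<close> induces on arrows out of \<open>Z\<close>: the datum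
  classified by an arrow from \<open>Z\<close> to Map(S \<hookrightarrow> T, f).\<close>

definition rel_point :: "('o, 'a) cat \<Rightarrow> 's sset \<Rightarrow> 's sset \<Rightarrow> ('o, 'a) sspace \<Rightarrow> ('o, 'a) sspace
    \<Rightarrow> (nat \<Rightarrow> 'a) \<Rightarrow> 'o \<Rightarrow> (nat \<Rightarrow> 's \<Rightarrow> 'a) \<Rightarrow> (nat \<Rightarrow> 's \<Rightarrow> 'a) \<Rightarrow> bool" where
  "rel_point C S T X Y f Z a b \<longleftrightarrow>
     spoint C S X Z a \<and> spoint C T Y Z b \<and> (\<forall>k. \<forall>t \<in> fst S k. Comp C (f k) (a k t) = b k t)"

text \<open>The universal property of \<open>Map(S \<hookrightarrow> T, f)\<close>, without reference to \<open>Map(S, Y)\<close>.\<close>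

definition represents_rel :: "('o, 'a) cat \<Rightarrow> 's sset \<Rightarrow> 's sset \<Rightarrow> ('o, 'a) sspace \<Rightarrow> ('o, 'a) sspace
    \<Rightarrow> (nat \<Rightarrow> 'a) \<Rightarrow> 'o \<Rightarrow> (nat \<Rightarrow> 's \<Rightarrow> 'a) \<Rightarrow> (nat \<Rightarrow> 's \<Rightarrow> 'a) \<Rightarrow> bool" where
  "represents_rel C S T X Y f P a b \<longleftrightarrow>
     P \<in> Obj C \<and> rel_point C S T X Y f P a b \<and>
     (\<forall>Z a' b'. Z \<in> Obj C \<and> rel_point C S T X Y f Z a' b' \<longrightarrow>
        (\<exists>!h. h \<in> hom C Z P \<and> (\<forall>k. \<forall>t \<in> fst S k. Comp C (a k t) h = a' k t) \<and>
              (\<forall>k. \<forall>t \<in> fst T k. Comp C (b k t) h = b' k t)))"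

section \<open>Universal properties of mapping objects and relative mapping objects\<close>

context category
begin

lemma spoint_precomp:
  assumes X: "is_sspace C X" and T: "closed_sset T" and u: "spoint C T X Z u" and h: "h \<in> hom C W Z"
  shows "spoint C T X W (\<lambda>k t. u k t \<cdot> h)"
proof (rule spointI)
  fix m k \<theta> t assume A: "\<theta> \<in> Dop m k" "t \<in> fst T k"
  show "snd X m k \<theta> \<cdot> u k t \<cdot> h = u m (snd T m k \<theta> t) \<cdot> h"
    by (rule comp_extend1[OF spointD(2)[OF u A] h spointD(1)[OF u A(2)] is_sspaceD(2)[OF X A(1)]])
qed (use h spointD(1)[OF u] in auto)

lemma spoint_postcomp:
  assumes X: "is_sspace C X" and Y: "is_sspace C Y" and f: "is_smor C X Y f"
    and u: "spoint C T X Z u"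
  shows "spoint C T Y Z (\<lambda>k t. f k \<cdot> u k t)"
proof (rule spointI)
  fix m k \<theta> t assume A: "\<theta> \<in> Dop m k" "t \<in> fst T k"
  have "snd Y m k \<theta> \<cdot> f k \<cdot> u k t = f m \<cdot> snd X m k \<theta> \<cdot> u k t"
    by (rule comp_extend[OF is_smorD(2)[OF f A(1), symmetric] spointD(1)[OF u A(2)] is_smorD(1)[OF f]
        is_sspaceD(2)[OF Y A(1)] is_sspaceD(2)[OF X A(1)] is_smorD(1)[OF f]])
  then show "snd Y m k \<theta> \<cdot> f k \<cdot> u k t = f m \<cdot> u m (snd T m k \<theta> t)"
    by (simp add: spointD(2)[OF u A])
qed (rule comp_hom[OF spointD(1)[OF u] is_smorD(1)[OF f]])

lemma is_MapD:
  assumes "is_Map C T X M u"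
  shows "M \<in> Obj C" "spoint C T X M u" "t \<in> fst T k \<Longrightarrow> u k t \<in> hom C M (fst X k)"
  using assms unfolding is_Map_def spoint_def by auto

lemma is_Map_lift:
  assumes "is_Map C T X M u" "Z \<in> Obj C" "spoint C T X Z v"
  obtains h where "h \<in> hom C Z M" "\<And>k t. t \<in> fst T k \<Longrightarrow> u k t \<cdot> h = v k t"
  using assms unfolding is_Map_def by metis

lemma is_Map_eqI:
  assumes X: "is_sspace C X" and T: "closed_sset T" and M: "is_Map C T X M u"
    and h: "h \<in> hom C Z M" "h' \<in> hom C Z M"
    and eq: "\<And>k t. t \<in> fst T k \<Longrightarrow> u k t \<cdot> h = u k t \<cdot> h'"
  shows "h = h'"
proof -
  have "spoint C T X Z (\<lambda>k t. u k t \<cdot> h)"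
    using spoint_precomp[OF X T _ h(1)] is_MapD[OF M] by blast
  then have "\<exists>!k. k \<in> hom C Z M \<and> (\<forall>j. \<forall>t \<in> fst T j. u j t \<cdot> k = u j t \<cdot> h)"
    using M hom_objs[OF h(1)] unfolding is_Map_def by blast
  with h eq show ?thesis by metis
qed

lemma rel_pointD:
  assumes "rel_point C S T X Y f Z a b"
  shows "spoint C S X Z a" "spoint C T Y Z b" "t \<in> fst S k \<Longrightarrow> f k \<cdot> a k t = b k t"
    "t \<in> fst S k \<Longrightarrow> a k t \<in> hom C Z (fst X k)" "t \<in> fst T k \<Longrightarrow> b k t \<in> hom C Z (fst Y k)"
  using assms spointD(1) unfolding rel_point_def by fast+

lemma represents_relD:
  assumes "represents_rel C S T X Y f P a b"
  shows "P \<in> Obj C" "rel_point C S T X Y f P a b"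
  using assms unfolding represents_rel_def by auto

lemma represents_rel_lift:
  assumes "represents_rel C S T X Y f P a b" "Z \<in> Obj C" "rel_point C S T X Y f Z a' b'"
  obtains h where "h \<in> hom C Z P" "\<And>k t. t \<in> fst S k \<Longrightarrow> a k t \<cdot> h = a' k t"
    "\<And>k t. t \<in> fst T k \<Longrightarrow> b k t \<cdot> h = b' k t"
  using assms unfolding represents_rel_def by metis

lemma rel_point_precomp:
  assumes X: "is_sspace C X" and Y: "is_sspace C Y" and S: "closed_sset S" and T: "closed_sset T"
    and f: "\<And>k. f k \<in> hom C (fst X k) (fst Y k)"
    and ab: "rel_point C S T X Y f Z a b" and h: "h \<in> hom C W Z"
  shows "rel_point C S T X Y f W (\<lambda>k t. a k t \<cdot> h) (\<lambda>k t. b k t \<cdot> h)"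
  unfolding rel_point_def
proof (intro conjI allI ballI)
  fix k t assume t: "t \<in> fst S k"
  show "f k \<cdot> a k t \<cdot> h = b k t \<cdot> h"
    by (rule comp_extend1[OF rel_pointD(3)[OF ab t] h rel_pointD(4)[OF ab t] f])
qed (use spoint_precomp rel_pointD[OF ab] X Y S T h in blast)+

lemma represents_rel_eqI:
  assumes X: "is_sspace C X" and Y: "is_sspace C Y" and S: "closed_sset S" and T: "closed_sset T"
    and f: "\<And>k. f k \<in> hom C (fst X k) (fst Y k)"
    and P: "represents_rel C S T X Y f P a b"
    and h: "h \<in> hom C Z P" "h' \<in> hom C Z P"
    and eq: "\<And>k t. t \<in> fst S k \<Longrightarrow> a k t \<cdot> h = a k t \<cdot> h'"
      "\<And>k t. t \<in> fst T k \<Longrightarrow> b k t \<cdot> h = b k t \<cdot> h'"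
  shows "h = h'"
proof -
  have "rel_point C S T X Y f Z (\<lambda>k t. a k t \<cdot> h) (\<lambda>k t. b k t \<cdot> h)"
    using rel_point_precomp[OF X Y S T f _ h(1)] represents_relD[OF P] by blast
  then have "\<exists>!k. k \<in> hom C Z P \<and> (\<forall>j. \<forall>t \<in> fst S j. a j t \<cdot> k = a j t \<cdot> h) \<and>
      (\<forall>j. \<forall>t \<in> fst T j. b j t \<cdot> k = b j t \<cdot> h)"
    using P hom_objs[OF h(1)] unfolding represents_rel_def by blast
  with h eq show ?thesis by metis
qed

lemma represents_relI:
  assumes P: "P \<in> Obj C" "rel_point C S T X Y f P a b"
    and ex: "\<And>Z a' b'. \<lbrakk>Z \<in> Obj C; rel_point C S T X Y f Z a' b'\<rbrakk> \<Longrightarrow>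
       \<exists>h. h \<in> hom C Z P \<and> (\<forall>k. \<forall>t \<in> fst S k. a k t \<cdot> h = a' k t) \<and>
              (\<forall>k. \<forall>t \<in> fst T k. b k t \<cdot> h = b' k t)"
    and uniq: "\<And>Z h h'. \<lbrakk>h \<in> hom C Z P; h' \<in> hom C Z P;
        \<And>k t. t \<in> fst S k \<Longrightarrow> a k t \<cdot> h = a k t \<cdot> h';
        \<And>k t. t \<in> fst T k \<Longrightarrow> b k t \<cdot> h = b k t \<cdot> h'\<rbrakk> \<Longrightarrow> h = h'"
  shows "represents_rel C S T X Y f P a b"
  unfolding represents_rel_def
proof (intro conjI allI impI)
  fix Z a' b' assume A: "Z \<in> Obj C \<and> rel_point C S T X Y f Z a' b'"
  obtain h where h: "h \<in> hom C Z P" "\<forall>k. \<forall>t \<in> fst S k. a k t \<cdot> h = a' k t"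
    "\<forall>k. \<forall>t \<in> fst T k. b k t \<cdot> h = b' k t" using ex[OF conjunct1[OF A] conjunct2[OF A]] by auto
  show "\<exists>!h. h \<in> hom C Z P \<and> (\<forall>k. \<forall>t \<in> fst S k. a k t \<cdot> h = a' k t) \<and>
              (\<forall>k. \<forall>t \<in> fst T k. b k t \<cdot> h = b' k t)"
  proof (rule ex1I[of _ h])
    fix h' assume "h' \<in> hom C Z P \<and> (\<forall>k. \<forall>t \<in> fst S k. a k t \<cdot> h' = a' k t) \<and>
              (\<forall>k. \<forall>t \<in> fst T k. b k t \<cdot> h' = b' k t)"
    then show "h' = h" using h by (intro uniq[of h' Z h]) auto
  qed (use h in blast)
qed (use P in auto)

text \<open>An arrow into the pullback is a pair of arrows into Map(S, X) and Map(T, Y), that is, a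
  pair of points. The two arrows agree in Map(S, Y) exactly when the points form a commutative
  square, because arrows into Map(S, Y) are determined by their values on the simplices of
  \<open>S\<close>.\<close>

lemma is_RelMap_represents:
  assumes X: "is_sspace C X" and Y: "is_sspace C Y" and S: "closed_sset S" and T: "closed_sset T"
    and ST: "\<And>k. fst S k \<subseteq> fst T k" "snd S = snd T"
    and f: "\<And>k. f k \<in> hom C (fst X k) (fst Y k)"
    and R: "is_RelMap C S T X Y f P a b"
  shows "represents_rel C S T X Y f P a b"
proof -
  obtain MSX uX MSY uY MTY uT r s p1 p2 where
    MX: "is_Map C S X MSX uX" and MY: "is_Map C S Y MSY uY" and MT: "is_Map C T Y MTY uT"
    and r: "r \<in> hom C MSX MSY" "\<forall>k. \<forall>t \<in> fst S k. uY k t \<cdot> r = f k \<cdot> uX k t"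
    and s: "s \<in> hom C MTY MSY" "\<forall>k. \<forall>t \<in> fst S k. uY k t \<cdot> s = uT k t"
    and pb: "is_pullback C r s p1 p2" and P: "Dom C p1 = P"
    and a: "\<forall>k. \<forall>t \<in> fst S k. a k t = uX k t \<cdot> p1"
    and b: "\<forall>k. \<forall>t \<in> fst T k. b k t = uT k t \<cdot> p2"
    using R unfolding is_RelMap_def by blast
  have p: "p1 \<in> hom C P MSX" "p2 \<in> hom C P MTY" "r \<cdot> p1 = s \<cdot> p2"
    using is_pullback_homs[OF pb] homD[OF r(1)] homD[OF s(1)] P by auto
  note uX = is_MapD(3)[OF MX] and uY = is_MapD(3)[OF MY] and uT = is_MapD(3)[OF MT]
  have rp: "rel_point C S T X Y f P a b"
    unfolding rel_point_def
  proof (intro conjI allI ballI)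
    show "spoint C S X P a"
      by (rule spoint_cong[OF spoint_precomp[OF X S is_MapD(2)[OF MX] p(1)] S]) (use a in auto)
    show "spoint C T Y P b"
      by (rule spoint_cong[OF spoint_precomp[OF Y T is_MapD(2)[OF MT] p(2)] T]) (use b in auto)
    fix k t assume t: "t \<in> fst S k"
    with ST have t': "t \<in> fst T k" by blast
    have "f k \<cdot> uX k t \<cdot> p1 = uY k t \<cdot> r \<cdot> p1"
      by (rule comp_extend[OF _ p(1) uX[OF t] f r(1) uY[OF t]]) (use r(2) t in auto)
    also have "\<dots> = uT k t \<cdot> p2"
      unfolding p(3) by (rule comp_extend1[OF _ p(2) s(1) uY[OF t]]) (use s(2) t in auto)
    finally show "f k \<cdot> a k t = b k t" using a b t t' by auto
  qed
  show ?thesis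
  proof (rule represents_relI)
    show "P \<in> Obj C" using p(1) hom_objs by blast
    show "rel_point C S T X Y f P a b" by (rule rp)
  next
    fix Z a' b' assume Z: "Z \<in> Obj C" and R: "rel_point C S T X Y f Z a' b'"
    note R' = rel_pointD[OF R]
    obtain x where x: "x \<in> hom C Z MSX" "\<And>k t. t \<in> fst S k \<Longrightarrow> uX k t \<cdot> x = a' k t"
      using is_Map_lift[OF MX Z R'(1)] by blast
    obtain y where y: "y \<in> hom C Z MTY" "\<And>k t. t \<in> fst T k \<Longrightarrow> uT k t \<cdot> y = b' k t"
      using is_Map_lift[OF MT Z R'(2)] by blast
    have "r \<cdot> x = s \<cdot> y"
    proof (rule is_Map_eqI[OF Y S MY])
      fix k t assume t: "t \<in> fst S k"
      have "uY k t \<cdot> r \<cdot> x = f k \<cdot> uX k t \<cdot> x"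
        by (rule comp_extend[OF _ x(1) r(1) uY[OF t] uX[OF t] f]) (use r(2) t in auto)
      also have "\<dots> = b' k t" using x(2) R'(3) t by simp
      also have "\<dots> = uT k t \<cdot> y" using y(2)[OF subsetD[OF ST(1) t]] by simp
      also have "\<dots> = uY k t \<cdot> s \<cdot> y"
        by (rule comp_extend1[symmetric, OF _ y(1) s(1) uY[OF t]]) (use s(2) t in auto)
      finally show "uY k t \<cdot> r \<cdot> x = uY k t \<cdot> s \<cdot> y" .
    qed (use r s x y in auto)
    then obtain h where h: "h \<in> hom C Z P" "p1 \<cdot> h = x" "p2 \<cdot> h = y"
      using is_pullback_lift[OF pb, of x Z y] x(1) y(1) homD[OF r(1)] homD[OF s(1)] P by auto
    have "a k t \<cdot> h = a' k t" if "t \<in> fst S k" for k t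
      using assoc[OF h(1) p(1) uX[OF that]] h a x that by simp
    moreover have "b k t \<cdot> h = b' k t" if "t \<in> fst T k" for k t
      using assoc[OF h(1) p(2) uT[OF that]] h b y that by simp
    ultimately show "\<exists>h. h \<in> hom C Z P \<and> (\<forall>k. \<forall>t \<in> fst S k. a k t \<cdot> h = a' k t) \<and>
              (\<forall>k. \<forall>t \<in> fst T k. b k t \<cdot> h = b' k t)" using h(1) by blast
  next
    fix Z h h' assume h: "h \<in> hom C Z P" "h' \<in> hom C Z P"
      and eq: "\<And>k t. t \<in> fst S k \<Longrightarrow> a k t \<cdot> h = a k t \<cdot> h'"
        "\<And>k t. t \<in> fst T k \<Longrightarrow> b k t \<cdot> h = b k t \<cdot> h'"
    have "p1 \<cdot> h = p1 \<cdot> h'"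
    proof (rule is_Map_eqI[OF X S MX])
      fix k t assume t: "t \<in> fst S k"
      show "uX k t \<cdot> p1 \<cdot> h = uX k t \<cdot> p1 \<cdot> h'"
        using eq(1)[OF t] a t assoc[OF h(1) p(1) uX[OF t]] assoc[OF h(2) p(1) uX[OF t]] by simp
    qed (use h p in auto)
    moreover have "p2 \<cdot> h = p2 \<cdot> h'"
    proof (rule is_Map_eqI[OF Y T MT])
      fix k t assume t: "t \<in> fst T k"
      show "uT k t \<cdot> p2 \<cdot> h = uT k t \<cdot> p2 \<cdot> h'"
        using eq(2)[OF t] b t assoc[OF h(1) p(2) uT[OF t]] assoc[OF h(2) p(2) uT[OF t]] by simp
    qed (use h p in auto)
    ultimately show "h = h'" using is_pullback_joint_mono[OF pb] h P by blast
  qed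
qed

end

context descent
begin

text \<open>Only the three absolute mapping objects have to be supplied: the universal property of
  Map(S, Y) produces both legs of the cospan, by composing with \<open>f\<close> and by restricting
  from \<open>T\<close> to \<open>S\<close>.\<close>

lemma is_RelMap_exists:
  assumes X: "is_sspace C X" and Y: "is_sspace C Y" and S: "closed_sset S"
    and ST: "\<And>k. fst S k \<subseteq> fst T k" "snd S = snd T"
    and f: "is_smor C X Y f"
    and MX: "is_Map C S X MSX uX" and MY: "is_Map C S Y MSY uY" and MT: "is_Map C T Y MTY uT"
  shows "\<exists>P a b. is_RelMap C S T X Y f P a b"
proof -
  obtain r where r: "r \<in> hom C MSX MSY" "\<And>k t. t \<in> fst S k \<Longrightarrow> uY k t \<cdot> r = f k \<cdot> uX k t"
    using is_Map_lift[OF MY is_MapD(1)[OF MX] spoint_postcomp[OF X Y f is_MapD(2)[OF MX]]] by blast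
  obtain s where s: "s \<in> hom C MTY MSY" "\<And>k t. t \<in> fst S k \<Longrightarrow> uY k t \<cdot> s = uT k t"
    using is_Map_lift[OF MY is_MapD(1)[OF MT] spoint_subset[OF is_MapD(2)[OF MT] ST]] by blast
  obtain P p1 p2 where p: "is_pullback C r s p1 p2" "p1 \<in> hom C P MSX" "p2 \<in> hom C P MTY"
    using pullback_exists[OF r(1) s(1)] by blast
  have "is_RelMap C S T X Y f P (\<lambda>k t. uX k t \<cdot> p1) (\<lambda>k t. uT k t \<cdot> p2)"
    unfolding is_RelMap_def
    by (rule exI[of _ MSX], rule exI[of _ uX], rule exI[of _ MSY], rule exI[of _ uY],
        rule exI[of _ MTY], rule exI[of _ uT], rule exI[of _ r], rule exI[of _ s],
        rule exI[of _ p1], rule exI[of _ p2]) (use MX MY MT r s p homD[OF p(2)] in auto)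
  then show ?thesis by blast
qed

end

section \<open>Gluing and cell attachment\<close>

text \<open>The operators are taken from \<open>A\<close>. The intended arguments are subcomplexes
  of one simplicial set, whose operators coincide.\<close>

definition sset_union :: "'s sset \<Rightarrow> 's sset \<Rightarrow> 's sset" where
  "sset_union A B = ((\<lambda>k. fst A k \<union> fst B k), snd A)"

definition sset_inter :: "'s sset \<Rightarrow> 's sset \<Rightarrow> 's sset" where
  "sset_inter A B = ((\<lambda>k. fst A k \<inter> fst B k), snd A)"

definition sset_map :: "(nat \<Rightarrow> 's \<Rightarrow> 't) \<Rightarrow> 's sset \<Rightarrow> 't sset \<Rightarrow> bool" where
  "sset_map \<phi> A B \<longleftrightarrow> (\<forall>k. \<forall>t \<in> fst A k. \<phi> k t \<in> fst B k) \<and>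
     (\<forall>m k \<theta>. \<forall>t \<in> fst A k. \<theta> \<in> Dop m k \<longrightarrow> \<phi> m (snd A m k \<theta> t) = snd B m k \<theta> (\<phi> k t))"

lemma closed_sset_union: "\<lbrakk>closed_sset A; closed_sset B; snd A = snd B\<rbrakk> \<Longrightarrow> closed_sset (sset_union A B)"
  unfolding closed_sset_def sset_union_def by auto

lemma closed_sset_inter: "\<lbrakk>closed_sset A; closed_sset B; snd A = snd B\<rbrakk> \<Longrightarrow> closed_sset (sset_inter A B)"
  unfolding closed_sset_def sset_inter_def by auto

lemma closed_ssetD: "\<lbrakk>closed_sset T; \<theta> \<in> Dop m n; t \<in> fst T n\<rbrakk> \<Longrightarrow> snd T m n \<theta> t \<in> fst T m"
  unfolding closed_sset_def by blast

text \<open>The union is the pushout of \<open>A\<close> and \<open>B\<close> over their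
  intersection. Agreement on the intersection is used when a simplex of \<open>B\<close> outside
  \<open>A\<close> has a face in \<open>A\<close>, where the conditional switches from
  \<open>b\<close> to \<open>a\<close>.\<close>

lemma spoint_union:
  assumes A: "closed_sset A" and B: "closed_sset B" and AB: "snd A = snd B"
    and a: "spoint C A X Z a" and b: "spoint C B X Z b"
    and eq: "\<And>k t. \<lbrakk>t \<in> fst A k; t \<in> fst B k\<rbrakk> \<Longrightarrow> a k t = b k t"
  shows "spoint C (sset_union A B) X Z (\<lambda>k t. if t \<in> fst A k then a k t else b k t)"
proof (rule spointI)
  fix k t assume "t \<in> fst (sset_union A B) k"
  then show "(if t \<in> fst A k then a k t else b k t) \<in> hom C Z (fst X k)"
    using spointD(1)[OF a] spointD(1)[OF b] by (auto simp: sset_union_def)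
next
  fix m k \<theta> t assume \<theta>: "\<theta> \<in> Dop m k" and t: "t \<in> fst (sset_union A B) k"
  have sn: "snd (sset_union A B) = snd A" by (simp add: sset_union_def)
  show "Comp C (snd X m k \<theta>) (if t \<in> fst A k then a k t else b k t) =
      (if snd (sset_union A B) m k \<theta> t \<in> fst A m then a m (snd (sset_union A B) m k \<theta> t)
       else b m (snd (sset_union A B) m k \<theta> t))"
  proof (cases "t \<in> fst A k")
    case True
    then show ?thesis using closed_ssetD[OF A \<theta>] spointD(2)[OF a \<theta>] sn by auto
  next
    case False
    then have t: "t \<in> fst B k" using t by (auto simp: sset_union_def)
    show ?thesis
      using False eq closed_ssetD[OF B \<theta> t] spointD(2)[OF b \<theta> t] sn AB by auto
  qed
qed

lemma spoint_reindex:
  assumes "sset_map \<phi> A B" "spoint C B X Z u"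
  shows "spoint C A X Z (\<lambda>k t. u k (\<phi> k t))"
  using assms(1) spointD[OF assms(2)] unfolding sset_map_def by (auto intro!: spointI)

lemma closed_Delta: "closed_sset (Delta n)"
  unfolding closed_sset_def Delta_def by (auto intro: Dop_cmp)

section \<open>Standard simplices, and transport along isomorphisms of simplicial sets\<close>

context category
begin

lemma is_MapI:
  assumes "M \<in> Obj C" "spoint C T X M u"
    and ex: "\<And>Z v. \<lbrakk>Z \<in> Obj C; spoint C T X Z v\<rbrakk> \<Longrightarrow>
       \<exists>h. h \<in> hom C Z M \<and> (\<forall>k. \<forall>t \<in> fst T k. u k t \<cdot> h = v k t)"
    and uniq: "\<And>Z h h'. \<lbrakk>h \<in> hom C Z M; h' \<in> hom C Z M;
        \<And>k t. t \<in> fst T k \<Longrightarrow> u k t \<cdot> h = u k t \<cdot> h'\<rbrakk> \<Longrightarrow> h = h'"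
  shows "is_Map C T X M u"
  unfolding is_Map_def
proof (intro conjI allI impI)
  fix Z v assume A: "Z \<in> Obj C \<and> spoint C T X Z v"
  obtain h where h: "h \<in> hom C Z M" "\<forall>k. \<forall>t \<in> fst T k. u k t \<cdot> h = v k t"
    using ex[OF conjunct1[OF A] conjunct2[OF A]] by auto
  show "\<exists>!h. h \<in> hom C Z M \<and> (\<forall>k. \<forall>t \<in> fst T k. u k t \<cdot> h = v k t)"
  proof (rule ex1I[of _ h])
    fix h' assume "h' \<in> hom C Z M \<and> (\<forall>k. \<forall>t \<in> fst T k. u k t \<cdot> h' = v k t)"
    then show "h' = h" using h by (intro uniq[of h' Z h]) auto
  qed (use h in blast)
qed (use assms in auto)

text \<open>This is the Yoneda lemma: a point on the standard simplex is determined by its value on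
  the top simplex \<open>idn n\<close>, and that value is the classifying arrow.\<close>

lemma is_Map_Delta:
  assumes X: "is_sspace C X"
  shows "is_Map C (Delta n) X (fst X n) (\<lambda>k \<theta>. snd X k n \<theta>)"
proof (rule is_MapI)
  show "spoint C (Delta n) X (fst X n) (\<lambda>k \<theta>. snd X k n \<theta>)"
    using is_sspaceD[OF X] by (intro spointI) (auto simp: Delta_def)
next
  fix Z v assume v: "spoint C (Delta n) X Z v"
  have i: "idn n \<in> fst (Delta n) n" by (simp add: Delta_def Dop_idn)
  have "snd X k n \<theta> \<cdot> v n (idn n) = v k \<theta>" if "\<theta> \<in> fst (Delta n) k" for k \<theta>
    using spointD(2)[OF v _ i, of \<theta> k] that by (simp add: Delta_def cmp_idn)
  then show "\<exists>h. h \<in> hom C Z (fst X n) \<and> (\<forall>k. \<forall>\<theta> \<in> fst (Delta n) k. snd X k n \<theta> \<cdot> h = v k \<theta>)"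
    using spointD(1)[OF v i] by blast
next
  fix Z h h' assume h: "h \<in> hom C Z (fst X n)" "h' \<in> hom C Z (fst X n)"
    and eq: "\<And>k \<theta>. \<theta> \<in> fst (Delta n) k \<Longrightarrow> snd X k n \<theta> \<cdot> h = snd X k n \<theta> \<cdot> h'"
  have "snd X n n (idn n) \<cdot> h = snd X n n (idn n) \<cdot> h'"
    by (rule eq) (simp add: Delta_def Dop_idn)
  then show "h = h'" using h comp_ident(2) is_sspaceD(3)[OF X] by metis
qed (rule is_sspaceD(1)[OF X])

text \<open>The cells of a product of simplices are only isomorphic to standard simplices, whereas
  the cover conditions on \<open>f\<close> refer to \<open>Delta n\<close> itself. This lemma and
  \<open>represents_rel_transfer\<close> bridge the difference.\<close>

lemma is_Map_transfer:
  assumes M: "is_Map C D X M u" and \<phi>: "sset_map \<phi> B D" and \<psi>: "sset_map \<psi> D B"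
    and inv: "\<And>k t. t \<in> fst B k \<Longrightarrow> \<psi> k (\<phi> k t) = t" "\<And>k t. t \<in> fst D k \<Longrightarrow> \<phi> k (\<psi> k t) = t"
    and X: "is_sspace C X" and D: "closed_sset D"
  shows "is_Map C B X M (\<lambda>k t. u k (\<phi> k t))"
proof (rule is_MapI)
  show "M \<in> Obj C" "spoint C B X M (\<lambda>k t. u k (\<phi> k t))"
    using is_MapD(1)[OF M] spoint_reindex[OF \<phi> is_MapD(2)[OF M]] by simp_all
next
  fix Z v assume Z: "Z \<in> Obj C" and v: "spoint C B X Z v"
  obtain h where h: "h \<in> hom C Z M" "\<And>k t. t \<in> fst D k \<Longrightarrow> u k t \<cdot> h = v k (\<psi> k t)"
    using is_Map_lift[OF M Z spoint_reindex[OF \<psi> v]] by blast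
  then show "\<exists>h. h \<in> hom C Z M \<and> (\<forall>k. \<forall>t \<in> fst B k. u k (\<phi> k t) \<cdot> h = v k t)"
    using \<phi> inv(1) unfolding sset_map_def by auto
next
  fix Z h h' assume h: "h \<in> hom C Z M" "h' \<in> hom C Z M"
    and eq: "\<And>k t. t \<in> fst B k \<Longrightarrow> u k (\<phi> k t) \<cdot> h = u k (\<phi> k t) \<cdot> h'"
  show "h = h'"
  proof (rule is_Map_eqI[OF X D M h])
    fix k t assume t: "t \<in> fst D k"
    then show "u k t \<cdot> h = u k t \<cdot> h'"
      using eq[of "\<psi> k t" k] \<psi> inv(2)[OF t] unfolding sset_map_def by auto
  qed
qed

lemma represents_rel_transfer:
  assumes P: "represents_rel C L D X Y f P a b"
    and \<phi>: "sset_map \<phi> B D" "sset_map \<phi> S L" and \<psi>: "sset_map \<psi> D B" "sset_map \<psi> L S"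
    and inv: "\<And>k t. t \<in> fst B k \<Longrightarrow> \<psi> k (\<phi> k t) = t" "\<And>k t. t \<in> fst D k \<Longrightarrow> \<phi> k (\<psi> k t) = t"
    and SB: "\<And>k. fst S k \<subseteq> fst B k" and LD: "\<And>k. fst L k \<subseteq> fst D k"
    and X: "is_sspace C X" and Y: "is_sspace C Y" and L: "closed_sset L" and D: "closed_sset D"
    and f: "\<And>k. f k \<in> hom C (fst X k) (fst Y k)"
  shows "represents_rel C S B X Y f P (\<lambda>k t. a k (\<phi> k t)) (\<lambda>k t. b k (\<phi> k t))"
proof (rule represents_relI)
  note R = rel_pointD[OF represents_relD(2)[OF P]]
  show "P \<in> Obj C" by (rule represents_relD(1)[OF P])
  show "rel_point C S B X Y f P (\<lambda>k t. a k (\<phi> k t)) (\<lambda>k t. b k (\<phi> k t))"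
    unfolding rel_point_def
    using spoint_reindex[OF \<phi>(2) R(1)] spoint_reindex[OF \<phi>(1) R(2)] R(3) \<phi>(2)
    unfolding sset_map_def by auto
next
  fix Z a' b' assume Z: "Z \<in> Obj C" and R: "rel_point C S B X Y f Z a' b'"
  have "rel_point C L D X Y f Z (\<lambda>k t. a' k (\<psi> k t)) (\<lambda>k t. b' k (\<psi> k t))"
    unfolding rel_point_def
    using spoint_reindex[OF \<psi>(2) rel_pointD(1)[OF R]] spoint_reindex[OF \<psi>(1) rel_pointD(2)[OF R]]
      rel_pointD(3)[OF R] \<psi>(2) unfolding sset_map_def by auto
  then obtain h where h: "h \<in> hom C Z P" "\<And>k t. t \<in> fst L k \<Longrightarrow> a k t \<cdot> h = a' k (\<psi> k t)"
    "\<And>k t. t \<in> fst D k \<Longrightarrow> b k t \<cdot> h = b' k (\<psi> k t)"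
    using represents_rel_lift[OF P Z] by blast
  have "a k (\<phi> k t) \<cdot> h = a' k t" if "t \<in> fst S k" for k t
    using that h(2) \<phi>(2) inv(1) SB unfolding sset_map_def by (metis subsetD)
  moreover have "b k (\<phi> k t) \<cdot> h = b' k t" if "t \<in> fst B k" for k t
    using that h(3) \<phi>(1) inv(1) unfolding sset_map_def by metis
  ultimately show "\<exists>h. h \<in> hom C Z P \<and> (\<forall>k. \<forall>t \<in> fst S k. a k (\<phi> k t) \<cdot> h = a' k t) \<and>
      (\<forall>k. \<forall>t \<in> fst B k. b k (\<phi> k t) \<cdot> h = b' k t)" using h(1) by blast
next
  fix Z h h' assume h: "h \<in> hom C Z P" "h' \<in> hom C Z P"
    and eq: "\<And>k t. t \<in> fst S k \<Longrightarrow> a k (\<phi> k t) \<cdot> h = a k (\<phi> k t) \<cdot> h'"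
      "\<And>k t. t \<in> fst B k \<Longrightarrow> b k (\<phi> k t) \<cdot> h = b k (\<phi> k t) \<cdot> h'"
  show "h = h'"
  proof (rule represents_rel_eqI[OF X Y L D f P h])
    fix k t assume t: "t \<in> fst L k"
    then have "\<psi> k t \<in> fst S k" "\<phi> k (\<psi> k t) = t" using \<psi>(2) inv(2) LD unfolding sset_map_def by auto
    then show "a k t \<cdot> h = a k t \<cdot> h'" using eq(1)[of "\<psi> k t" k] by simp
  next
    fix k t assume t: "t \<in> fst D k"
    then have "\<psi> k t \<in> fst B k" "\<phi> k (\<psi> k t) = t" using \<psi>(1) inv(2) unfolding sset_map_def by auto
    then show "b k t \<cdot> h = b k t \<cdot> h'" using eq(2)[of "\<psi> k t" k] by simp
  qed
qed

end

section \<open>Mapping objects of unions, and attaching one cell\<close>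

context descent
begin

text \<open>The functor Map(-, X) turns the pushout square of a union into a pullback square, so the
  object sought is the pullback of the two restrictions to Map(A \<inter> B, X).\<close>

lemma is_Map_union:
  assumes X: "is_sspace C X" and A: "closed_sset A" and B: "closed_sset B" and AB: "snd A = snd B"
    and MA: "is_Map C A X MA uA" and MB: "is_Map C B X MB uB"
    and MI: "is_Map C (sset_inter A B) X MI uI"
  shows "\<exists>M u. is_Map C (sset_union A B) X M u"
proof -
  have IA: "fst (sset_inter A B) k \<subseteq> fst A k" "snd (sset_inter A B) = snd A"
    and IB: "fst (sset_inter A B) k \<subseteq> fst B k" "snd (sset_inter A B) = snd B" for k
    using AB by (auto simp: sset_inter_def)
  note I = closed_sset_inter[OF A B AB] and U = closed_sset_union[OF A B AB]
  obtain r where r: "r \<in> hom C MA MI" "\<And>k t. t \<in> fst (sset_inter A B) k \<Longrightarrow> uI k t \<cdot> r = uA k t"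
    using is_Map_lift[OF MI is_MapD(1)[OF MA] spoint_subset[OF is_MapD(2)[OF MA] IA]] by blast
  obtain s where s: "s \<in> hom C MB MI" "\<And>k t. t \<in> fst (sset_inter A B) k \<Longrightarrow> uI k t \<cdot> s = uB k t"
    using is_Map_lift[OF MI is_MapD(1)[OF MB] spoint_subset[OF is_MapD(2)[OF MB] IB]] by blast
  obtain M p q where pb: "is_pullback C r s p q" and p: "p \<in> hom C M MA" and q: "q \<in> hom C M MB"
    using pullback_exists[OF r(1) s(1)] by blast
  note uA = is_MapD(3)[OF MA] and uB = is_MapD(3)[OF MB] and uI = is_MapD(3)[OF MI]
  have ag: "uA k t \<cdot> p = uB k t \<cdot> q" if "t \<in> fst A k" "t \<in> fst B k" for k t
  proof -
    have t: "t \<in> fst (sset_inter A B) k" using that by (simp add: sset_inter_def)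
    have "uI k t \<cdot> r \<cdot> p = uA k t \<cdot> p" by (rule comp_extend1[OF r(2)[OF t] p r(1) uI[OF t]])
    moreover have "uI k t \<cdot> s \<cdot> q = uB k t \<cdot> q" by (rule comp_extend1[OF s(2)[OF t] q s(1) uI[OF t]])
    ultimately show ?thesis using is_pullback_homs(5)[OF pb] by simp
  qed
  define u where "u k t = (if t \<in> fst A k then uA k t \<cdot> p else uB k t \<cdot> q)" for k t
  have uu: "t \<in> fst A k \<Longrightarrow> u k t = uA k t \<cdot> p" "t \<in> fst B k \<Longrightarrow> u k t = uB k t \<cdot> q" for k t
    using ag by (auto simp: u_def)
  have "is_Map C (sset_union A B) X M u"
  proof (rule is_MapI)
    show "M \<in> Obj C" using p hom_objs by blast
    have "spoint C (sset_union A B) X M (\<lambda>k t. if t \<in> fst A k then uA k t \<cdot> p else uB k t \<cdot> q)"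
      by (rule spoint_union[OF A B AB spoint_precomp[OF X A is_MapD(2)[OF MA] p]
            spoint_precomp[OF X B is_MapD(2)[OF MB] q] ag])
    then show "spoint C (sset_union A B) X M u" by (simp add: u_def[abs_def])
  next
    fix Z v assume Z: "Z \<in> Obj C" and v: "spoint C (sset_union A B) X Z v"
    have vA: "spoint C A X Z v" by (rule spoint_subset[OF v]) (auto simp: sset_union_def)
    have vB: "spoint C B X Z v" by (rule spoint_subset[OF v]) (auto simp: sset_union_def AB)
    obtain x where x: "x \<in> hom C Z MA" "\<And>k t. t \<in> fst A k \<Longrightarrow> uA k t \<cdot> x = v k t"
      using is_Map_lift[OF MA Z vA] by blast
    obtain y where y: "y \<in> hom C Z MB" "\<And>k t. t \<in> fst B k \<Longrightarrow> uB k t \<cdot> y = v k t"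
      using is_Map_lift[OF MB Z vB] by blast
    have "r \<cdot> x = s \<cdot> y"
    proof (rule is_Map_eqI[OF X I MI comp_hom[OF x(1) r(1)] comp_hom[OF y(1) s(1)]])
      fix k t assume t: "t \<in> fst (sset_inter A B) k"
      then have "t \<in> fst A k" "t \<in> fst B k" using IA IB by blast+
      then show "uI k t \<cdot> r \<cdot> x = uI k t \<cdot> s \<cdot> y"
        using comp_extend1[OF r(2)[OF t] x(1) r(1) uI[OF t]]
          comp_extend1[OF s(2)[OF t] y(1) s(1) uI[OF t]] x(2) y(2) by simp
    qed
    then obtain h where h: "h \<in> hom C Z M" "p \<cdot> h = x" "q \<cdot> h = y"
      using is_pullback_lift[OF pb, of x Z y] x(1) y(1) homD[OF r(1)] homD[OF s(1)] homD[OF p] by auto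
    have "u k t \<cdot> h = v k t" if "t \<in> fst (sset_union A B) k" for k t
    proof (cases "t \<in> fst A k")
      case True
      then show ?thesis using assoc[OF h(1) p uA] h(2) x(2) by (simp add: uu)
    next
      case False
      then have "t \<in> fst B k" using that by (simp add: sset_union_def)
      then show ?thesis using assoc[OF h(1) q uB] h(3) y(2) by (simp add: uu)
    qed
    then show "\<exists>h. h \<in> hom C Z M \<and> (\<forall>k. \<forall>t \<in> fst (sset_union A B) k. u k t \<cdot> h = v k t)"
      using h(1) by blast
  next
    fix Z h h' assume h: "h \<in> hom C Z M" "h' \<in> hom C Z M"
      and eq: "\<And>k t. t \<in> fst (sset_union A B) k \<Longrightarrow> u k t \<cdot> h = u k t \<cdot> h'"
    have "p \<cdot> h = p \<cdot> h'"
    proof (rule is_Map_eqI[OF X A MA comp_hom[OF h(1) p] comp_hom[OF h(2) p]])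
      fix k t assume t: "t \<in> fst A k"
      then show "uA k t \<cdot> p \<cdot> h = uA k t \<cdot> p \<cdot> h'"
        using eq[of t k] assoc[OF h(1) p uA[OF t]] assoc[OF h(2) p uA[OF t]]
        by (simp add: uu sset_union_def)
    qed
    moreover have "q \<cdot> h = q \<cdot> h'"
    proof (rule is_Map_eqI[OF X B MB comp_hom[OF h(1) q] comp_hom[OF h(2) q]])
      fix k t assume t: "t \<in> fst B k"
      then show "uB k t \<cdot> q \<cdot> h = uB k t \<cdot> q \<cdot> h'"
        using eq[of t k] assoc[OF h(1) q uB[OF t]] assoc[OF h(2) q uB[OF t]]
        by (simp add: uu sset_union_def)
    qed
    ultimately show "h = h'" using is_pullback_joint_mono[OF pb] h homD[OF p] by blast
  qed
  then show ?thesis by blast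
qed

text \<open>\<open>Map(S \<union> B \<hookrightarrow> T, f) \<rightarrow> Map(S \<hookrightarrow> T, f)\<close> is a pullback of
  \<open>Map(B, X) \<rightarrow> Map(S \<inter> B \<hookrightarrow> B, f)\<close>.\<close>

lemma cov_represents_rel_union:
  assumes X: "is_sspace C X" and Y: "is_sspace C Y"
    and f: "\<And>k. f k \<in> hom C (fst X k) (fst Y k)"
    and S: "closed_sset S" and B: "closed_sset B" and T: "closed_sset T"
    and sn: "snd S = snd T" "snd B = snd T"
    and ST: "\<And>k. fst S k \<subseteq> fst T k" and BT: "\<And>k. fst B k \<subseteq> fst T k"
    and P: "represents_rel C S T X Y f P a b"
    and P': "represents_rel C (sset_union S B) T X Y f P' a' b'"
    and M: "is_Map C B X M u"
    and H: "represents_rel C (sset_inter S B) B X Y f H c d"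
    and e: "e \<in> hom C M H" "\<And>k t. t \<in> fst (sset_inter S B) k \<Longrightarrow> c k t \<cdot> e = u k t"
      "\<And>k t. t \<in> fst B k \<Longrightarrow> d k t \<cdot> e = f k \<cdot> u k t"
    and h: "h \<in> hom C P' P" "\<And>k t. t \<in> fst S k \<Longrightarrow> a k t \<cdot> h = a' k t"
      "\<And>k t. t \<in> fst T k \<Longrightarrow> b k t \<cdot> h = b' k t"
    and cov: "cov e"
  shows "cov h"
proof -
  have sn': "snd S = snd B" using sn by simp
  note I = closed_sset_inter[OF S B sn'] and U = closed_sset_union[OF S B sn']
  have US: "t \<in> fst S k \<Longrightarrow> t \<in> fst (sset_union S B) k"
    and UB: "t \<in> fst B k \<Longrightarrow> t \<in> fst (sset_union S B) k" for k t
    by (auto simp: sset_union_def)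
  have IS: "t \<in> fst (sset_inter S B) k \<longleftrightarrow> t \<in> fst S k \<and> t \<in> fst B k" for k t
    by (auto simp: sset_inter_def)
  note RP = rel_pointD[OF represents_relD(2)[OF P]]
    and RP' = rel_pointD[OF represents_relD(2)[OF P']]
    and RH = rel_pointD[OF represents_relD(2)[OF H]]
    and uh = is_MapD(3)[OF M]
  have "rel_point C (sset_inter S B) B X Y f P a b"
    unfolding rel_point_def
  proof (intro conjI allI ballI)
    show "spoint C (sset_inter S B) X P a"
      by (rule spoint_subset[OF RP(1)]) (auto simp: sset_inter_def)
    show "spoint C B Y P b" by (rule spoint_subset[OF RP(2) BT sn(2)])
  qed (use IS RP(3) in blast)
  \<comment> \<open>\<open>w\<close> restricts a square on \<open>S\<close> and \<open>T\<close> to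
    one on \<open>S \<inter> B\<close> and \<open>B\<close>; \<open>v\<close> below restricts the
    \<open>X\<close>-component on the union to \<open>B\<close>. With \<open>e\<close> and
    \<open>h\<close> they form the square to be shown a pullback.\<close>
  then obtain w where w: "w \<in> hom C P H" "\<And>k t. t \<in> fst (sset_inter S B) k \<Longrightarrow> c k t \<cdot> w = a k t"
    "\<And>k t. t \<in> fst B k \<Longrightarrow> d k t \<cdot> w = b k t"
    using represents_rel_lift[OF H represents_relD(1)[OF P]] by blast
  have "spoint C B X P' a'"
    by (rule spoint_subset[OF RP'(1)]) (auto simp: sset_union_def sn')
  then obtain v where v: "v \<in> hom C P' M" "\<And>k t. t \<in> fst B k \<Longrightarrow> u k t \<cdot> v = a' k t"
    using is_Map_lift[OF M represents_relD(1)[OF P']] by blast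
  have "is_pullback C e w v h"
  proof (rule is_pullbackI[OF e(1) w(1) v(1) h(1)])
    show "e \<cdot> v = w \<cdot> h"
    proof (rule represents_rel_eqI[OF X Y I B f H comp_hom[OF v(1) e(1)] comp_hom[OF h(1) w(1)]])
      fix k t assume t: "t \<in> fst (sset_inter S B) k"
      with IS have t': "t \<in> fst S k" "t \<in> fst B k" by auto
      show "c k t \<cdot> e \<cdot> v = c k t \<cdot> w \<cdot> h"
        using comp_extend1[OF e(2)[OF t] v(1) e(1) RH(4)[OF t]]
          comp_extend1[OF w(2)[OF t] h(1) w(1) RH(4)[OF t]] v(2) h(2) t' by simp
    next
      fix k t assume t: "t \<in> fst B k"
      have "f k \<cdot> u k t \<cdot> v = b' k t" using v(2)[OF t] RP'(3)[OF UB[OF t]] by simp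
      then show "d k t \<cdot> e \<cdot> v = d k t \<cdot> w \<cdot> h"
        using comp_extend[OF e(3)[OF t] v(1) e(1) RH(5)[OF t] uh[OF t] f]
          comp_extend1[OF w(3)[OF t] h(1) w(1) RH(5)[OF t]] h(3) subsetD[OF BT t] by simp
    qed
  next
    fix z p q assume p: "p \<in> hom C z M" and q: "q \<in> hom C z P" and eq: "e \<cdot> p = w \<cdot> q"
    \<comment> \<open>The \<open>X\<close>-component on the union is glued from \<open>q\<close> on
      \<open>S\<close> and \<open>p\<close> on \<open>B\<close>. The two agree on the intersection
      because \<open>e \<cdot> p = w \<cdot> q\<close> is read off there through
      \<open>c\<close>.\<close>
    define a2 where "a2 k t = (if t \<in> fst S k then a k t \<cdot> q else u k t \<cdot> p)" for k t
    have ag: "a k t \<cdot> q = u k t \<cdot> p" if "t \<in> fst S k" "t \<in> fst B k" for k t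
    proof -
      have t: "t \<in> fst (sset_inter S B) k" using that IS by blast
      show ?thesis
        using comp_extend1[OF e(2)[OF t] p e(1) RH(4)[OF t]]
          comp_extend1[OF w(2)[OF t] q w(1) RH(4)[OF t]] eq by simp
    qed
    have a2: "t \<in> fst S k \<Longrightarrow> a2 k t = a k t \<cdot> q" "t \<in> fst B k \<Longrightarrow> a2 k t = u k t \<cdot> p" for k t
      using ag by (auto simp: a2_def)
    have "rel_point C (sset_union S B) T X Y f z a2 (\<lambda>k t. b k t \<cdot> q)"
      unfolding rel_point_def
    proof (intro conjI allI ballI)
      show "spoint C (sset_union S B) X z a2" unfolding a2_def
        by (rule spoint_union[OF S B sn' spoint_precomp[OF X S RP(1) q]
              spoint_precomp[OF X B is_MapD(2)[OF M] p] ag])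
      show "spoint C T Y z (\<lambda>k t. b k t \<cdot> q)" by (rule spoint_precomp[OF Y T RP(2) q])
      fix k t assume "t \<in> fst (sset_union S B) k"
      then consider "t \<in> fst S k" | "t \<in> fst B k" by (auto simp: sset_union_def)
      then show "f k \<cdot> a2 k t = b k t \<cdot> q"
      proof cases
        case 1
        then show ?thesis using comp_extend1[OF RP(3)[OF 1] q RP(4)[OF 1] f] by (simp add: a2)
      next
        case 2
        then show ?thesis
          using comp_extend[OF e(3)[OF 2] p e(1) RH(5)[OF 2] uh[OF 2] f]
            comp_extend1[OF w(3)[OF 2] q w(1) RH(5)[OF 2]] eq by (simp add: a2)
      qed
    qed
    then obtain l where l: "l \<in> hom C z P'"
      "\<And>k t. t \<in> fst (sset_union S B) k \<Longrightarrow> a' k t \<cdot> l = a2 k t"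
      "\<And>k t. t \<in> fst T k \<Longrightarrow> b' k t \<cdot> l = b k t \<cdot> q"
      using represents_rel_lift[OF P'] hom_objs[OF p] by blast
    have "v \<cdot> l = p"
    proof (rule is_Map_eqI[OF X B M comp_hom[OF l(1) v(1)] p])
      fix k t assume t: "t \<in> fst B k"
      show "u k t \<cdot> v \<cdot> l = u k t \<cdot> p"
        using comp_extend1[OF v(2)[OF t] l(1) v(1) uh[OF t]] l(2)[OF UB[OF t]] a2(2)[OF t] by simp
    qed
    moreover have "h \<cdot> l = q"
    proof (rule represents_rel_eqI[OF X Y S T f P comp_hom[OF l(1) h(1)] q])
      fix k t assume t: "t \<in> fst S k"
      show "a k t \<cdot> h \<cdot> l = a k t \<cdot> q"
        using comp_extend1[OF h(2)[OF t] l(1) h(1) RP(4)[OF t]] l(2)[OF US[OF t]] a2(1)[OF t] by simp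
    next
      fix k t assume t: "t \<in> fst T k"
      show "b k t \<cdot> h \<cdot> l = b k t \<cdot> q"
        using comp_extend1[OF h(3)[OF t] l(1) h(1) RP(5)[OF t]] l(3)[OF t] by simp
    qed
    ultimately show "\<exists>l. l \<in> hom C z P' \<and> v \<cdot> l = p \<and> h \<cdot> l = q" using l(1) by blast
  next
    \<comment> \<open>The universal point on the union is recovered from \<open>h\<close> on
      simplices of \<open>S\<close> and from \<open>v\<close> on simplices of \<open>B\<close>, so
      the two projections jointly determine an arrow.\<close>
    fix z l l' assume l: "l \<in> hom C z P'" "l' \<in> hom C z P'" and eq: "v \<cdot> l = v \<cdot> l'" "h \<cdot> l = h \<cdot> l'"
    show "l = l'"
    proof (rule represents_rel_eqI[OF X Y U T f P' l])
      fix k t assume "t \<in> fst (sset_union S B) k"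
      then consider "t \<in> fst S k" | "t \<in> fst B k" by (auto simp: sset_union_def)
      then show "a' k t \<cdot> l = a' k t \<cdot> l'"
      proof cases
        case 1
        show ?thesis using comp_extend1[OF h(2)[OF 1] l(1) h(1) RP(4)[OF 1]]
            comp_extend1[OF h(2)[OF 1] l(2) h(1) RP(4)[OF 1]] eq by simp
      next
        case 2
        show ?thesis using comp_extend1[OF v(2)[OF 2] l(1) v(1) uh[OF 2]]
            comp_extend1[OF v(2)[OF 2] l(2) v(1) uh[OF 2]] eq by simp
      qed
    next
      fix k t assume t: "t \<in> fst T k"
      show "b' k t \<cdot> l = b' k t \<cdot> l'" using comp_extend1[OF h(3)[OF t] l(1) h(1) RP(5)[OF t]]
            comp_extend1[OF h(3)[OF t] l(2) h(1) RP(5)[OF t]] eq by simp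
    qed
  qed
  then show ?thesis using cov by (rule cov_pullback)
qed

text \<open>When the pair of \<open>B\<close> and \<open>S \<inter> B\<close> is isomorphic to that
  of \<open>Delta n\<close> and \<open>L\<close>, the restriction from Map(B, X) to the relative
  mapping object is the canonical arrow out of X_n, a cover by assumption. As
  \<open>rel_cover\<close> quantifies over all choices of that object, one choice must be exhibited;
  \<open>MX\<close> and \<open>MY\<close> make this possible.\<close>

lemma cov_attach_cell:
  assumes X: "is_sspace C X" and Y: "is_sspace C Y" and f: "is_smor C X Y f"
    and S: "closed_sset S" and B: "closed_sset B" and T: "closed_sset T"
    and sn: "snd S = snd T" "snd B = snd T"
    and ST: "\<And>k. fst S k \<subseteq> fst T k" and BT: "\<And>k. fst B k \<subseteq> fst T k"
    and P: "represents_rel C S T X Y f P a b"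
    and P': "represents_rel C (sset_union S B) T X Y f P' a' b'"
    and h: "h \<in> hom C P' P" "\<And>k t. t \<in> fst S k \<Longrightarrow> a k t \<cdot> h = a' k t"
      "\<And>k t. t \<in> fst T k \<Longrightarrow> b k t \<cdot> h = b' k t"
    and L: "closed_sset L" "snd L = snd (Delta n)" "\<And>k. fst L k \<subseteq> fst (Delta n) k"
    and \<phi>: "sset_map \<phi> B (Delta n)" "sset_map \<phi> (sset_inter S B) L"
    and \<psi>: "sset_map \<psi> (Delta n) B" "sset_map \<psi> L (sset_inter S B)"
    and inv: "\<And>k t. t \<in> fst B k \<Longrightarrow> \<psi> k (\<phi> k t) = t"
      "\<And>k t. t \<in> fst (Delta n) k \<Longrightarrow> \<phi> k (\<psi> k t) = t"
    and MX: "is_Map C (sset_inter S B) X MX uX" and MY: "is_Map C (sset_inter S B) Y MY uY"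
    and cov: "rel_cover C cov L n X Y f"
  shows "cov h"
proof -
  have sn': "snd S = snd B" using sn by simp
  have IB: "\<And>k. fst (sset_inter S B) k \<subseteq> fst B k" by (auto simp: sset_inter_def)
  note I = closed_sset_inter[OF S B sn'] and fh = is_smorD(1)[OF f]
  have inv': "\<psi> k (\<phi> k t) = t" if "t \<in> fst (sset_inter S B) k" for k t using that IB inv by blast
  have inv'': "\<phi> k (\<psi> k t) = t" if "t \<in> fst L k" for k t using that L inv by blast
  have LX: "is_Map C L X MX (\<lambda>k t. uX k (\<psi> k t))"
    by (rule is_Map_transfer[where \<phi>=\<psi> and \<psi>=\<phi>, OF MX \<psi>(2) \<phi>(2) inv'' inv' X I])
  have LY: "is_Map C L Y MY (\<lambda>k t. uY k (\<psi> k t))"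
    by (rule is_Map_transfer[where \<phi>=\<psi> and \<psi>=\<phi>, OF MY \<psi>(2) \<phi>(2) inv'' inv' Y I])
  obtain H c d where RM: "is_RelMap C L (Delta n) X Y f H c d"
    using is_RelMap_exists[OF X Y L(1) L(3) L(2) f LX LY is_Map_Delta[OF Y]] by blast
  note H = is_RelMap_represents[OF X Y L(1) closed_Delta L(3) L(2) fh RM]
  have "rel_point C L (Delta n) X Y f (fst X n) (\<lambda>k \<theta>. snd X k n \<theta>) (\<lambda>k \<theta>. f k \<cdot> snd X k n \<theta>)"
    unfolding rel_point_def
    using spoint_subset[OF is_MapD(2)[OF is_Map_Delta[OF X]] L(3) L(2)]
      spoint_postcomp[OF X Y f is_MapD(2)[OF is_Map_Delta[OF X]]] by blast
  then obtain e where e: "e \<in> hom C (fst X n) H" "\<And>k \<theta>. \<theta> \<in> fst L k \<Longrightarrow> c k \<theta> \<cdot> e = snd X k n \<theta>"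
    "\<And>k \<theta>. \<theta> \<in> fst (Delta n) k \<Longrightarrow> d k \<theta> \<cdot> e = f k \<cdot> snd X k n \<theta>"
    using represents_rel_lift[OF H is_sspaceD(1)[OF X]] by blast
  \<comment> \<open>\<open>e\<close> was built with \<open>f\<close> applied after the operator of
    \<open>X\<close>; naturality of \<open>f\<close> gives the form with the operator of
    \<open>Y\<close> that \<open>rel_cover\<close> expects.\<close>
  have "is_RelMap C L (Delta n) X Y f H c d \<and> e \<in> hom C (fst X n) H \<and>
      (\<forall>k. \<forall>\<theta> \<in> fst L k. c k \<theta> \<cdot> e = snd X k n \<theta>) \<and>
      (\<forall>k. \<forall>\<theta> \<in> Dop k n. d k \<theta> \<cdot> e = snd Y k n \<theta> \<cdot> f n)"
    using RM e is_smorD(2)[OF f] by (simp add: Delta_def)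
  then have "cov e" using cov unfolding rel_cover_def by blast
  moreover note H' = represents_rel_transfer[where \<phi>=\<phi> and \<psi>=\<psi>,
      OF H \<phi> \<psi> inv IB L(3) X Y L(1) closed_Delta fh]
    and M' = is_Map_transfer[where \<phi>=\<phi> and \<psi>=\<psi>,
      OF is_Map_Delta[OF X] \<phi>(1) \<psi>(1) inv X closed_Delta]
  have "\<phi> k t \<in> fst L k" if "t \<in> fst (sset_inter S B) k" for k t
    using that \<phi>(2) unfolding sset_map_def by blast
  moreover have "\<phi> k t \<in> fst (Delta n) k" if "t \<in> fst B k" for k t
    using that \<phi>(1) unfolding sset_map_def by blast
  ultimately show ?thesis
    using e by (intro cov_represents_rel_union[OF X Y fh S B T sn ST BT P P' M' H' e(1) _ _ h]) simp_all
qed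

end

section \<open>Path spaces\<close>

text \<open>This generalises \<open>prodD\<close> to an arbitrary second factor, as products with a
  boundary or a horn of a simplex occur.\<close>

definition sset_prod :: "'s sset \<Rightarrow> 't sset \<Rightarrow> ('s \<times> 't) sset" where
  "sset_prod A B = ((\<lambda>k. fst A k \<times> fst B k),
     (\<lambda>k' k \<theta> tp. (snd A k' k \<theta> (fst tp), snd B k' k \<theta> (snd tp))))"

lemma prodD_eq: "prodD A m = sset_prod A (Delta m)"
  by (simp add: prodD_def sset_prod_def Delta_def)

lemma closed_sset_prod: "\<lbrakk>closed_sset A; closed_sset B\<rbrakk> \<Longrightarrow> closed_sset (sset_prod A B)"
  unfolding closed_sset_def sset_prod_def by auto

lemma is_PTD:
  assumes "is_PT C T X P u"
  shows "is_sspace C P" "is_Map C (sset_prod T (Delta m)) X (fst P m) (u m)"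
    "\<lbrakk>\<phi> \<in> Dop m' m; t \<in> fst T k; \<psi> \<in> Dop k m'\<rbrakk>
      \<Longrightarrow> Comp C (u m' k (t, \<psi>)) (snd P m' m \<phi>) = u m k (t, cmp \<phi> \<psi> k)"
  using assms unfolding is_PT_def prodD_eq by auto

lemma is_PT_hom:
  assumes "is_PT C T X P u" "t \<in> fst T k" "\<psi> \<in> Dop k m"
  shows "u m k (t, \<psi>) \<in> hom C (fst P m) (fst X k)"
  using is_PTD(2)[OF assms(1), of m] assms(2,3)
  unfolding is_Map_def spoint_def sset_prod_def Delta_def by auto

context category
begin

lemma is_PT_eqI:
  assumes PT: "is_PT C D X P u" and X: "is_sspace C X" and D: "closed_sset D"
    and h: "h \<in> hom C Z (fst P m)" "h' \<in> hom C Z (fst P m)"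
    and eq: "\<And>k t \<psi>. \<lbrakk>t \<in> fst D k; \<psi> \<in> Dop k m\<rbrakk> \<Longrightarrow> u m k (t, \<psi>) \<cdot> h = u m k (t, \<psi>) \<cdot> h'"
  shows "h = h'"
  by (rule is_Map_eqI[OF X closed_sset_prod[OF D closed_Delta] is_PTD(2)[OF PT] h])
    (use eq in \<open>auto simp: sset_prod_def Delta_def\<close>)

text \<open>\<open>K\<close>-points of \<open>P_D X\<close> correspond to \<open>D \<times> K\<close>-points of \<open>X\<close>.\<close>

lemma is_PT_point_shift:
  assumes PT: "is_PT C D X P u" and K: "snd K = snd (Delta m)" "\<And>k. fst K k \<subseteq> Dop k m"
    and v: "spoint C K P Z v"
    and t: "t \<in> fst D j" and \<theta>: "\<theta> \<in> fst K k" and \<psi>: "\<psi> \<in> Dop j k"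
  shows "u k j (t, \<psi>) \<cdot> v k \<theta> = u j j (t, idn j) \<cdot> v j (cmp \<theta> \<psi> j)"
proof -
  have "u j j (t, idn j) \<cdot> snd P j k \<psi> = u k j (t, \<psi>)"
    using is_PTD(3)[OF PT \<psi> t Dop_idn] cmp_idn(1)[OF \<psi>] by simp
  from comp_extend1[OF this spointD(1)[OF v \<theta>] is_sspaceD(2)[OF is_PTD(1)[OF PT] \<psi>] is_PT_hom[OF PT t Dop_idn]]
  show ?thesis using spointD(2)[OF v \<psi> \<theta>] K by (simp add: Delta_def)
qed

text \<open>A j-simplex of \<open>K\<close> gives an arrow into the degree j part of the path space,
  whose universal point is then evaluated at the j-simplex with second component the identity.
  Compatibility with operators holds because the shift lemma moves an operator from the second
  component into \<open>v\<close>.\<close>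

lemma is_PT_uncurry:
  assumes PT: "is_PT C D X P u" and K: "snd K = snd (Delta m)" "\<And>k. fst K k \<subseteq> Dop k m"
    and X: "is_sspace C X" and D: "closed_sset D"
    and v: "spoint C K P Z v"
  shows "spoint C (sset_prod D K) X Z (\<lambda>j tp. u j j (fst tp, idn j) \<cdot> v j (snd tp))"
proof (rule spointI)
  fix k tp assume "tp \<in> fst (sset_prod D K) k"
  then show "u k k (fst tp, idn k) \<cdot> v k (snd tp) \<in> hom C Z (fst X k)"
    using comp_hom[OF spointD(1)[OF v] is_PT_hom[OF PT _ Dop_idn]] by (auto simp: sset_prod_def)
next
  fix j k \<theta> tp assume \<theta>: "\<theta> \<in> Dop j k" and "tp \<in> fst (sset_prod D K) k"
  then obtain t \<kappa> where tp: "tp = (t, \<kappa>)" "t \<in> fst D k" "\<kappa> \<in> fst K k"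
    by (auto simp: sset_prod_def)
  have "(t, idn k) \<in> fst (sset_prod D (Delta k)) k"
    using tp by (simp add: sset_prod_def Delta_def Dop_idn)
  from spointD(2)[OF is_MapD(2)[OF is_PTD(2)[OF PT]] \<theta> this]
  have "snd X j k \<theta> \<cdot> u k k (t, idn k) = u k j (snd D j k \<theta> t, \<theta>)"
    using cmp_idn(2)[OF \<theta>] by (simp add: sset_prod_def Delta_def)
  from comp_extend1[OF this spointD(1)[OF v tp(3)] is_PT_hom[OF PT tp(2) Dop_idn] is_sspaceD(2)[OF X \<theta>]]
    is_PT_point_shift[OF PT K v closed_ssetD[OF D \<theta> tp(2)] tp(3) \<theta>]
  show "snd X j k \<theta> \<cdot> u k k (fst tp, idn k) \<cdot> v k (snd tp) =
      u j j (fst (snd (sset_prod D K) j k \<theta> tp), idn j) \<cdot> v j (snd (snd (sset_prod D K) j k \<theta> tp))"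
    unfolding tp(1) by (simp add: sset_prod_def K Delta_def)
qed

text \<open>A k-simplex \<theta> of \<open>K\<close> induces a map from the product of
  \<open>D\<close> with the k-simplex to \<open>D \<times> K\<close>; pulling \<open>w\<close> back
  along it gives a point that the path space classifies. The values at all \<open>\<psi>\<close> are
  recorded, not only at the identity, since \<open>is_PT_eqI\<close> tests equality on all of
  them.\<close>

lemma is_PT_curry:
  assumes PT: "is_PT C D X P u" and K: "snd K = snd (Delta m)" "\<And>k. fst K k \<subseteq> Dop k m"
    and X: "is_sspace C X" and D: "closed_sset D" and Kf: "closed_sset K"
    and Z: "Z \<in> Obj C" and w: "spoint C (sset_prod D K) X Z w"
  obtains v where "spoint C K P Z v"
    "\<And>k \<theta> j t \<psi>. \<lbrakk>\<theta> \<in> fst K k; t \<in> fst D j; \<psi> \<in> Dop j k\<rbrakk>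
       \<Longrightarrow> u k j (t, \<psi>) \<cdot> v k \<theta> = w j (t, cmp \<theta> \<psi> j)"
proof -
  have Kcl: "cmp \<theta> \<psi> j \<in> fst K j" if "\<theta> \<in> fst K k" "\<psi> \<in> Dop j k" for \<theta> k \<psi> j
    using closed_ssetD[OF Kf that(2,1)] by (simp add: K Delta_def)
  have ex: "\<exists>h. h \<in> hom C Z (fst P k) \<and>
      (\<forall>j t \<psi>. t \<in> fst D j \<longrightarrow> \<psi> \<in> Dop j k \<longrightarrow> u k j (t, \<psi>) \<cdot> h = w j (t, cmp \<theta> \<psi> j))"
    if \<theta>: "\<theta> \<in> fst K k" for k \<theta>
  proof -
    have "spoint C (sset_prod D (Delta k)) X Z (\<lambda>j tp. w j (fst tp, cmp \<theta> (snd tp) j))"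
    proof (rule spointI)
      fix j tp assume "tp \<in> fst (sset_prod D (Delta k)) j"
      then show "w j (fst tp, cmp \<theta> (snd tp) j) \<in> hom C Z (fst X j)"
        using Kcl[OF \<theta>] by (intro spointD(1)[OF w]) (auto simp: sset_prod_def Delta_def)
    next
      fix i j \<phi> tp assume \<phi>: "\<phi> \<in> Dop i j" and tp: "tp \<in> fst (sset_prod D (Delta k)) j"
      then have "(fst tp, cmp \<theta> (snd tp) j) \<in> fst (sset_prod D K) j"
        using Kcl[OF \<theta>] by (auto simp: sset_prod_def Delta_def)
      from spointD(2)[OF w \<phi> this]
      show "snd X i j \<phi> \<cdot> w j (fst tp, cmp \<theta> (snd tp) j) = w i (fst (snd (sset_prod D (Delta k)) i j \<phi> tp),
           cmp \<theta> (snd (snd (sset_prod D (Delta k)) i j \<phi> tp)) i)"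
        using cmp_assoc[OF \<phi>] by (simp add: sset_prod_def Delta_def K)
    qed
    from is_Map_lift[OF is_PTD(2)[OF PT] Z this]
    obtain h where h: "h \<in> hom C Z (fst P k)"
      "\<And>j tp. tp \<in> fst (sset_prod D (Delta k)) j \<Longrightarrow> u k j tp \<cdot> h = w j (fst tp, cmp \<theta> (snd tp) j)"
      by blast
    have "u k j (t, \<psi>) \<cdot> h = w j (t, cmp \<theta> \<psi> j)" if "t \<in> fst D j" "\<psi> \<in> Dop j k" for j t \<psi>
      using h(2)[of "(t, \<psi>)" j] that by (simp add: sset_prod_def Delta_def)
    with h(1) show ?thesis by blast
  qed
  \<comment> \<open>The classifying arrows are chosen separately for each simplex. That they form a
    simplicial map follows afterwards from the joint monicity of the universal point.\<close>
  define v where "v k \<theta> = (SOME h. h \<in> hom C Z (fst P k) \<and>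
      (\<forall>j t \<psi>. t \<in> fst D j \<longrightarrow> \<psi> \<in> Dop j k \<longrightarrow> u k j (t, \<psi>) \<cdot> h = w j (t, cmp \<theta> \<psi> j)))" for k \<theta>
  have v: "v k \<theta> \<in> hom C Z (fst P k)"
    "\<lbrakk>t \<in> fst D j; \<psi> \<in> Dop j k\<rbrakk> \<Longrightarrow> u k j (t, \<psi>) \<cdot> v k \<theta> = w j (t, cmp \<theta> \<psi> j)"
    if "\<theta> \<in> fst K k" for k \<theta> j t \<psi>
    using someI_ex[OF ex[OF that]] unfolding v_def by blast+
  have "spoint C K P Z v"
  proof (rule spointI)
    fix k' k \<phi> \<theta> assume \<phi>: "\<phi> \<in> Dop k' k" and \<theta>: "\<theta> \<in> fst K k"
    have \<theta>\<phi>: "snd K k' k \<phi> \<theta> = cmp \<theta> \<phi> k'" by (simp add: K Delta_def)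
    note Ph = is_sspaceD(2)[OF is_PTD(1)[OF PT] \<phi>]
    show "snd P k' k \<phi> \<cdot> v k \<theta> = v k' (snd K k' k \<phi> \<theta>)" unfolding \<theta>\<phi>
    proof (rule is_PT_eqI[OF PT X D])
      fix j t \<psi> assume t: "t \<in> fst D j" and \<psi>: "\<psi> \<in> Dop j k'"
      show "u k' j (t, \<psi>) \<cdot> snd P k' k \<phi> \<cdot> v k \<theta> = u k' j (t, \<psi>) \<cdot> v k' (cmp \<theta> \<phi> k')"
        using comp_extend1[OF is_PTD(3)[OF PT \<phi> t \<psi>] v(1)[OF \<theta>] Ph is_PT_hom[OF PT t \<psi>]]
          v(2)[OF \<theta> t Dop_cmp[OF \<phi> \<psi>]] v(2)[OF Kcl[OF \<theta> \<phi>] t \<psi>] cmp_assoc[OF \<psi>] by simp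
    qed (use v(1)[OF \<theta>] v(1)[OF Kcl[OF \<theta> \<phi>]] Ph in auto)
  qed (rule v(1))
  then show ?thesis using v(2) that by blast
qed

text \<open>A point of \<open>PT\<close> over \<open>K\<close> is a point of \<open>X\<close> on
  \<open>D \<times> K\<close>. A point of \<open>Q\<close> on the m-simplex is a point of
  \<open>X\<close> on \<open>S \<times> Delta m\<close> and one of \<open>Y\<close> on
  \<open>D \<times> Delta m\<close>, compatible over \<open>S\<close>. Compatibility through
  \<open>g\<close> says that the two points of \<open>X\<close> agree on
  \<open>S \<times> K\<close>, so they glue on the union, and that \<open>f\<close> carries the
  first one to the point of \<open>Y\<close>. The last two conclusions identify \<open>h\<close>
  with restriction of the universal point.\<close>

lemma rel_path_represents:
  assumes X: "is_sspace C X" and Y: "is_sspace C Y" and f: "is_smor C X Y f"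
    and D: "closed_sset D" and S: "closed_sset S" and SD: "snd S = snd D" "\<And>k. fst S k \<subseteq> fst D k"
    and Kf: "closed_sset K" and K: "snd K = snd (Delta m)" "\<And>k. fst K k \<subseteq> Dop k m"
    and path: "rel_path C D S X Y f PT Q g"
    and R: "is_RelMap C K (Delta m) PT Q g P a b"
    and h: "h \<in> hom C (fst PT m) P"
      "\<And>k \<theta>. \<theta> \<in> fst K k \<Longrightarrow> a k \<theta> \<cdot> h = snd PT k m \<theta>"
      "\<And>k \<theta>. \<theta> \<in> Dop k m \<Longrightarrow> b k \<theta> \<cdot> h = snd Q k m \<theta> \<cdot> g m"
  obtains A B u where
    "represents_rel C (sset_union (sset_prod D K) (sset_prod S (Delta m))) (sset_prod D (Delta m)) X Y f P A B"
    "is_Map C (sset_prod D (Delta m)) X (fst PT m) u"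
    "\<And>k t. t \<in> fst (sset_union (sset_prod D K) (sset_prod S (Delta m))) k \<Longrightarrow> A k t \<cdot> h = u k t"
    "\<And>k t. t \<in> fst (sset_prod D (Delta m)) k \<Longrightarrow> B k t \<cdot> h = f k \<cdot> u k t"
proof -
  obtain u1 PS u2 PSY u3 PTY u4 \<rho>X fS \<rho>Y fT q1 q2 where
    u1: "is_PT C D X PT u1" and u2: "is_PT C S X PS u2"
    and u3: "is_PT C S Y PSY u3" and u4: "is_PT C D Y PTY u4"
    and \<rho>X: "\<forall>m. \<rho>X m \<in> hom C (fst PT m) (fst PS m) \<and>
            (\<forall>k. \<forall>p \<in> fst (prodD S m) k. u2 m k p \<cdot> \<rho>X m = u1 m k p)"
    and fS: "\<forall>m. fS m \<in> hom C (fst PS m) (fst PSY m) \<and>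
            (\<forall>k. \<forall>p \<in> fst (prodD S m) k. u3 m k p \<cdot> fS m = f k \<cdot> u2 m k p)"
    and \<rho>Y: "\<forall>m. \<rho>Y m \<in> hom C (fst PTY m) (fst PSY m) \<and>
            (\<forall>k. \<forall>p \<in> fst (prodD S m) k. u3 m k p \<cdot> \<rho>Y m = u4 m k p)"
    and fT: "\<forall>m. fT m \<in> hom C (fst PT m) (fst PTY m) \<and>
            (\<forall>k. \<forall>p \<in> fst (prodD D m) k. u4 m k p \<cdot> fT m = f k \<cdot> u1 m k p)"
    and Q: "is_sspace C Q" and q1: "is_smor C Q PS q1" and q2: "is_smor C Q PTY q2"
    and pb: "\<forall>m. is_pullback C (fS m) (\<rho>Y m) (q1 m) (q2 m)"
    and g: "\<forall>m. g m \<in> hom C (fst PT m) (fst Q m) \<and> q1 m \<cdot> g m = \<rho>X m \<and> q2 m \<cdot> g m = fT m"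
    using path unfolding rel_path_def by (elim exE conjE) (rule that)
  have pS: "(t, \<psi>) \<in> fst (prodD S n) k" if "t \<in> fst S k" "\<psi> \<in> Dop k n" for t \<psi> n k
    using that by (simp add: prodD_def)
  have pD: "(t, \<psi>) \<in> fst (prodD D n) k" if "t \<in> fst D k" "\<psi> \<in> Dop k n" for t \<psi> n k
    using that by (simp add: prodD_def)
  have \<rho>Xh: "\<rho>X n \<in> hom C (fst PT n) (fst PS n)"
    and \<rho>Yh: "\<rho>Y n \<in> hom C (fst PTY n) (fst PSY n)"
    and fSh: "fS n \<in> hom C (fst PS n) (fst PSY n)"
    and fTh: "fT n \<in> hom C (fst PT n) (fst PTY n)"
    and gh: "g n \<in> hom C (fst PT n) (fst Q n)"
    and q1h: "q1 n \<in> hom C (fst Q n) (fst PS n)"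
    and q2h: "q2 n \<in> hom C (fst Q n) (fst PTY n)" for n
    using \<rho>X \<rho>Y fS fT g is_smorD(1)[OF q1] is_smorD(1)[OF q2] by auto
  have \<rho>X': "u2 n k (t, \<psi>) \<cdot> \<rho>X n = u1 n k (t, \<psi>)"
    and fS': "u3 n k (t, \<psi>) \<cdot> fS n = f k \<cdot> u2 n k (t, \<psi>)"
    and \<rho>Y': "u3 n k (t, \<psi>) \<cdot> \<rho>Y n = u4 n k (t, \<psi>)" if "t \<in> fst S k" "\<psi> \<in> Dop k n" for n k t \<psi>
    using \<rho>X fS \<rho>Y pS[OF that] by auto
  have fT': "u4 n k (t, \<psi>) \<cdot> fT n = f k \<cdot> u1 n k (t, \<psi>)" if "t \<in> fst D k" "\<psi> \<in> Dop k n" for n k t \<psi>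
    using fT pD[OF that] by auto
  have q1g: "q1 n \<cdot> g n = \<rho>X n" and q2g: "q2 n \<cdot> g n = fT n" for n using g by auto
  have sq: "fS n \<cdot> q1 n = \<rho>Y n \<cdot> q2 n" for n using is_pullback_homs(5) pb by auto
  note u1h = is_PT_hom[OF u1] and u2h = is_PT_hom[OF u2] and u3h = is_PT_hom[OF u3] and u4h = is_PT_hom[OF u4]
  note fh = is_smorD(1)[OF f] and PT = is_PTD(1)[OF u1]
  note \<Delta> = closed_Delta[of m] and i = Dop_idn
  have \<Delta>': "snd (Delta m) = snd (Delta m)" "\<And>k. fst (Delta m) k \<subseteq> Dop k m" by (simp_all add: Delta_def)
  have K': "\<And>k. fst K k \<subseteq> fst (Delta m) k" using K by (simp add: Delta_def)
  note Pr = is_RelMap_represents[OF PT Q Kf \<Delta> K' K(1) gh R]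
  note ab = rel_pointD[OF represents_relD(2)[OF Pr]]
  have bh: "\<theta> \<in> Dop k m \<Longrightarrow> b k \<theta> \<in> hom C P (fst Q k)" for k \<theta> using ab(5) by (simp add: Delta_def)
  note SDs = subsetD[OF SD(2)] and KD = subsetD[OF K(2)]
  let ?DK = "sset_prod D K" and ?SD = "sset_prod S (Delta m)" and ?T = "sset_prod D (Delta m)"
  note DKf = closed_sset_prod[OF D Kf] and SDf = closed_sset_prod[OF S \<Delta>] and Tf = closed_sset_prod[OF D \<Delta>]
  have sn: "snd ?DK = snd ?SD" "snd ?DK = snd ?T" "snd ?SD = snd ?T" using K SD by (simp_all add: sset_prod_def)
  note q1b = spoint_postcomp[OF Q is_PTD(1)[OF u2] q1 ab(2)]
    and q2b = spoint_postcomp[OF Q is_PTD(1)[OF u4] q2 ab(2)]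

  \<comment> \<open>These are the uncurried forms of the universal point \<open>a\<close> and of the
    two projections of the universal point \<open>b\<close>; \<open>A\<close> glues the two
    \<open>X\<close>-valued ones.\<close>
  define A1 where "A1 j tp = u1 j j (fst tp, idn j) \<cdot> a j (snd tp)" for j tp
  define A2 where "A2 j tp = u2 j j (fst tp, idn j) \<cdot> q1 j \<cdot> b j (snd tp)" for j tp
  define B where "B j tp = u4 j j (fst tp, idn j) \<cdot> q2 j \<cdot> b j (snd tp)" for j tp
  define A where "A j tp = (if tp \<in> fst ?DK j then A1 j tp else A2 j tp)" for j tp
  have sA1: "spoint C ?DK X P A1"
    using is_PT_uncurry[OF u1 K X D ab(1)] by (simp add: A1_def[abs_def])
  have sA2: "spoint C ?SD X P A2"
    using is_PT_uncurry[OF u2 \<Delta>' X S q1b] by (simp add: A2_def[abs_def])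
  have sB: "spoint C ?T Y P B"
    using is_PT_uncurry[OF u4 \<Delta>' Y D q2b] by (simp add: B_def[abs_def])
  have shA1: "u1 k j (t, \<psi>) \<cdot> a k \<theta> = A1 j (t, cmp \<theta> \<psi> j)"
    if "t \<in> fst D j" "\<theta> \<in> fst K k" "\<psi> \<in> Dop j k" for t \<psi> \<theta> j k
    using is_PT_point_shift[OF u1 K ab(1) that] by (simp add: A1_def)
  have shA2: "u2 k j (t, \<psi>) \<cdot> q1 k \<cdot> b k \<theta> = A2 j (t, cmp \<theta> \<psi> j)"
    if "t \<in> fst S j" "\<theta> \<in> Dop k m" "\<psi> \<in> Dop j k" for t \<psi> \<theta> j k
    using is_PT_point_shift[OF u2 \<Delta>' q1b that(1) _ that(3), of \<theta>] that(2) by (simp add: A2_def Delta_def)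
  have shB: "u4 k j (t, \<psi>) \<cdot> q2 k \<cdot> b k \<theta> = B j (t, cmp \<theta> \<psi> j)"
    if "t \<in> fst D j" "\<theta> \<in> Dop k m" "\<psi> \<in> Dop j k" for t \<psi> \<theta> j k
    using is_PT_point_shift[OF u4 \<Delta>' q2b that(1) _ that(3), of \<theta>] that(2) by (simp add: B_def Delta_def)
  have ga: "g k \<cdot> a k \<theta> = b k \<theta>" "a k \<theta> \<in> hom C P (fst PT k)" if "\<theta> \<in> fst K k" for k \<theta>
    using ab(3,4) that by auto
  have q1ga: "\<rho>X k \<cdot> a k \<theta> = q1 k \<cdot> b k \<theta>" and q2ga: "fT k \<cdot> a k \<theta> = q2 k \<cdot> b k \<theta>" if "\<theta> \<in> fst K k" for k \<theta>
    using comp_extend1[OF q1g ga(2)[OF that] gh q1h] comp_extend1[OF q2g ga(2)[OF that] gh q2h] ga(1)[OF that] by auto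
  have joint: "z = z'" if "z \<in> hom C W (fst Q k)" "z' \<in> hom C W (fst Q k)"
    "q1 k \<cdot> z = q1 k \<cdot> z'" "q2 k \<cdot> z = q2 k \<cdot> z'" for W k z z'
    using is_pullback_joint_mono[OF pb[rule_format], of z W k z'] homD[OF q1h[of k]] that by simp
  \<comment> \<open>On \<open>S \<times> K\<close> the equation
    \<open>g k \<cdot> a k \<theta> = b k \<theta>\<close>, projected by \<open>q1\<close>, says
    that \<open>A1\<close> and \<open>A2\<close> coincide.\<close>
  have A12: "A1 k tp = A2 k tp" if tp: "tp \<in> fst ?DK k" "tp \<in> fst ?SD k" for k tp
  proof -
    obtain t \<theta> where t: "tp = (t, \<theta>)" "t \<in> fst S k" "\<theta> \<in> fst K k" using tp by (auto simp: sset_prod_def)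
    show ?thesis
      using comp_extend1[OF \<rho>X'[OF t(2) i] ga(2)[OF t(3)] \<rho>Xh u2h[OF t(2) i]] q1ga[OF t(3)]
      by (simp add: t A1_def A2_def)
  qed
  have AA: "tp \<in> fst ?DK k \<Longrightarrow> A k tp = A1 k tp" "tp \<in> fst ?SD k \<Longrightarrow> A k tp = A2 k tp" for k tp
    using A12 by (auto simp: A_def)
  have fA1: "f k \<cdot> A1 k tp = B k tp" if tp: "tp \<in> fst ?DK k" for k tp
  proof -
    obtain t \<theta> where t: "tp = (t, \<theta>)" "t \<in> fst D k" "\<theta> \<in> fst K k" using tp by (auto simp: sset_prod_def)
    show ?thesis
      using comp_extend[OF fT'[OF t(2) i] ga(2)[OF t(3)] fTh u4h[OF t(2) i] u1h[OF t(2) i] fh] q2ga[OF t(3)]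
      by (simp add: t A1_def B_def)
  qed
  \<comment> \<open>Outside \<open>D \<times> K\<close> the relation to \<open>B\<close> does not
    come from \<open>g\<close> but from the pullback square defining \<open>Q\<close>.\<close>
  have fA2: "f k \<cdot> A2 k tp = B k tp" if tp: "tp \<in> fst ?SD k" for k tp
  proof -
    obtain t \<theta> where t: "tp = (t, \<theta>)" "t \<in> fst S k" "\<theta> \<in> Dop k m"
      using tp by (auto simp: sset_prod_def Delta_def)
    have "f k \<cdot> u2 k k (t, idn k) \<cdot> q1 k \<cdot> b k \<theta> = u3 k k (t, idn k) \<cdot> fS k \<cdot> q1 k \<cdot> b k \<theta>"
      by (rule comp_extend[OF fS'[OF t(2) i, symmetric] comp_hom[OF bh[OF t(3)] q1h] u2h[OF t(2) i] fh fSh u3h[OF t(2) i]])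
    also have "\<dots> = u3 k k (t, idn k) \<cdot> \<rho>Y k \<cdot> q2 k \<cdot> b k \<theta>"
      using comp_extend[OF sq bh[OF t(3)] q1h fSh q2h \<rho>Yh] by simp
    also have "\<dots> = u4 k k (t, idn k) \<cdot> q2 k \<cdot> b k \<theta>"
      by (rule comp_extend1[OF \<rho>Y'[OF t(2) i] comp_hom[OF bh[OF t(3)] q2h] \<rho>Yh u3h[OF t(2) i]])
    finally show ?thesis by (simp add: t A2_def B_def)
  qed
  have rep: "represents_rel C (sset_union ?DK ?SD) ?T X Y f P A B"
  proof (rule represents_relI)
    show "P \<in> Obj C" by (rule represents_relD(1)[OF Pr])
    show "rel_point C (sset_union ?DK ?SD) ?T X Y f P A B"
      unfolding rel_point_def
    proof (intro conjI allI ballI)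
      show "spoint C (sset_union ?DK ?SD) X P A"
        unfolding A_def by (rule spoint_union[OF DKf SDf sn(1) sA1 sA2 A12])
      show "spoint C ?T Y P B" by (rule sB)
      fix k t assume "t \<in> fst (sset_union ?DK ?SD) k"
      then have "t \<in> fst ?DK k \<or> t \<in> fst ?SD k" by (simp add: sset_union_def)
      then show "f k \<cdot> A k t = B k t" using AA[of t k] fA1[of t k] fA2[of t k] by auto
    qed
  next
    fix Z a' b' assume Z: "Z \<in> Obj C" and ab'': "rel_point C (sset_union ?DK ?SD) ?T X Y f Z a' b'"
    note ab' = rel_pointD[OF ab'']
    \<comment> \<open>The given square is cut into three pieces, each curried by itself:
      \<open>v\<close> from \<open>D \<times> K\<close>, \<open>x\<close> from
      \<open>S \<times> Delta m\<close> and \<open>y\<close> from the \<open>Y\<close>-component.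
      The last two then combine to a point \<open>z\<close> of \<open>Q\<close>.\<close>
    have "spoint C ?DK X Z a'" by (rule spoint_subset[OF ab'(1)]) (auto simp: sset_union_def)
    from is_PT_curry[OF u1 K X D Kf Z this]
    obtain v where v: "spoint C K PT Z v" "\<And>k \<theta> j t \<psi>. \<lbrakk>\<theta> \<in> fst K k; t \<in> fst D j; \<psi> \<in> Dop j k\<rbrakk>
       \<Longrightarrow> u1 k j (t, \<psi>) \<cdot> v k \<theta> = a' j (t, cmp \<theta> \<psi> j)" by blast
    have "spoint C ?SD X Z a'" by (rule spoint_subset[OF ab'(1)]) (auto simp: sset_union_def sn)
    from is_PT_curry[OF u2 \<Delta>' X S \<Delta> Z this]
    obtain x where x: "spoint C (Delta m) PS Z x"
      "\<And>k \<theta> j t \<psi>. \<lbrakk>\<theta> \<in> fst (Delta m) k; t \<in> fst S j; \<psi> \<in> Dop j k\<rbrakk>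
       \<Longrightarrow> u2 k j (t, \<psi>) \<cdot> x k \<theta> = a' j (t, cmp \<theta> \<psi> j)" by blast
    from is_PT_curry[OF u4 \<Delta>' Y D \<Delta> Z ab'(2)]
    obtain y where y: "spoint C (Delta m) PTY Z y"
      "\<And>k \<theta> j t \<psi>. \<lbrakk>\<theta> \<in> fst (Delta m) k; t \<in> fst D j; \<psi> \<in> Dop j k\<rbrakk>
       \<Longrightarrow> u4 k j (t, \<psi>) \<cdot> y k \<theta> = b' j (t, cmp \<theta> \<psi> j)" by blast
    note vh = spointD(1)[OF v(1)] and xh = spointD(1)[OF x(1)] and yh = spointD(1)[OF y(1)]
    have fa': "f j \<cdot> a' j (t, cmp \<theta> \<psi> j) = b' j (t, cmp \<theta> \<psi> j)"
      if "\<theta> \<in> fst (Delta m) k" "t \<in> fst D j" "\<psi> \<in> Dop j k" "t \<in> fst S j \<or> \<theta> \<in> fst K k" for k \<theta> j t \<psi>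
    proof (rule ab'(3))
      have "cmp \<theta> \<psi> j \<in> fst (Delta m) j" using closed_ssetD[OF \<Delta> that(3,1)] by (simp add: Delta_def)
      moreover have "cmp \<theta> \<psi> j \<in> fst K j" if "\<theta> \<in> fst K k"
        using closed_ssetD[OF Kf \<open>\<psi> \<in> Dop j k\<close> that] by (simp add: Delta_def K)
      ultimately show "(t, cmp \<theta> \<psi> j) \<in> fst (sset_union ?DK ?SD) j"
        using that by (auto simp: sset_union_def sset_prod_def)
    qed
    have fx: "fS k \<cdot> x k \<theta> = \<rho>Y k \<cdot> y k \<theta>" if \<theta>: "\<theta> \<in> fst (Delta m) k" for k \<theta>
    proof (rule is_PT_eqI[OF u3 Y S comp_hom[OF xh[OF \<theta>] fSh] comp_hom[OF yh[OF \<theta>] \<rho>Yh]])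
      fix j t \<psi> assume t: "t \<in> fst S j" and \<psi>: "\<psi> \<in> Dop j k"
      show "u3 k j (t, \<psi>) \<cdot> fS k \<cdot> x k \<theta> = u3 k j (t, \<psi>) \<cdot> \<rho>Y k \<cdot> y k \<theta>"
        using comp_extend[OF fS'[OF t \<psi>] xh[OF \<theta>] fSh u3h[OF t \<psi>] u2h[OF t \<psi>] fh]
          comp_extend1[OF \<rho>Y'[OF t \<psi>] yh[OF \<theta>] \<rho>Yh u3h[OF t \<psi>]]
          x(2)[OF \<theta> t \<psi>] y(2)[OF \<theta> SDs[OF t] \<psi>] fa'[OF \<theta> SDs[OF t] \<psi>] t by simp
    qed
    have "\<exists>z. z \<in> hom C Z (fst Q k) \<and> q1 k \<cdot> z = x k \<theta> \<and> q2 k \<cdot> z = y k \<theta>"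
      if \<theta>: "\<theta> \<in> fst (Delta m) k" for k \<theta>
      using is_pullback_lift[OF pb[rule_format], of "x k \<theta>" Z k "y k \<theta>"] xh[OF \<theta>] yh[OF \<theta>] fx[OF \<theta>]
        homD[OF fSh] homD[OF \<rho>Yh] homD[OF q1h] by auto
    note ex = this
    \<comment> \<open>The lift to \<open>Q\<close> is chosen in each degree; it is simplicial
      because \<open>q1\<close> and \<open>q2\<close> are jointly monic and are themselves
      simplicial.\<close>
    define z where "z k \<theta> = (SOME z. z \<in> hom C Z (fst Q k) \<and> q1 k \<cdot> z = x k \<theta> \<and> q2 k \<cdot> z = y k \<theta>)" for k \<theta>
    have z: "z k \<theta> \<in> hom C Z (fst Q k)" "q1 k \<cdot> z k \<theta> = x k \<theta>" "q2 k \<cdot> z k \<theta> = y k \<theta>"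
      if "\<theta> \<in> fst (Delta m) k" for k \<theta>
      using someI_ex[OF ex[OF that]] unfolding z_def by auto
    have zs: "spoint C (Delta m) Q Z z"
    proof (rule spointI)
      fix k' k \<phi> \<theta> assume \<phi>: "\<phi> \<in> Dop k' k" and \<theta>: "\<theta> \<in> fst (Delta m) k"
      note \<theta>' = closed_ssetD[OF \<Delta> \<phi> \<theta>] and Qh = is_sspaceD(2)[OF Q \<phi>]
      note PSh = is_sspaceD(2)[OF is_PTD(1)[OF u2] \<phi>] and PTYh = is_sspaceD(2)[OF is_PTD(1)[OF u4] \<phi>]
      show "snd Q k' k \<phi> \<cdot> z k \<theta> = z k' (snd (Delta m) k' k \<phi> \<theta>)"
      proof (rule joint[OF comp_hom[OF z(1)[OF \<theta>] Qh] z(1)[OF \<theta>']])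
        show "q1 k' \<cdot> snd Q k' k \<phi> \<cdot> z k \<theta> = q1 k' \<cdot> z k' (snd (Delta m) k' k \<phi> \<theta>)"
          using comp_extend[OF is_smorD(2)[OF q1 \<phi>] z(1)[OF \<theta>] Qh q1h q1h PSh] z(2)[OF \<theta>] z(2)[OF \<theta>']
            spointD(2)[OF x(1) \<phi> \<theta>] by simp
        show "q2 k' \<cdot> snd Q k' k \<phi> \<cdot> z k \<theta> = q2 k' \<cdot> z k' (snd (Delta m) k' k \<phi> \<theta>)"
          using comp_extend[OF is_smorD(2)[OF q2 \<phi>] z(1)[OF \<theta>] Qh q2h q2h PTYh] z(3)[OF \<theta>] z(3)[OF \<theta>']
            spointD(2)[OF y(1) \<phi> \<theta>] by simp
      qed
    qed (rule z(1))
    have gv: "g k \<cdot> v k \<theta> = z k \<theta>" if \<theta>: "\<theta> \<in> fst K k" for k \<theta>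
    proof (rule joint[OF comp_hom[OF vh[OF \<theta>] gh]])
      from \<theta> K' have \<theta>': "\<theta> \<in> fst (Delta m) k" by blast
      show "z k \<theta> \<in> hom C Z (fst Q k)" by (rule z(1)[OF \<theta>'])
      have "\<rho>X k \<cdot> v k \<theta> = x k \<theta>"
      proof (rule is_PT_eqI[OF u2 X S comp_hom[OF vh[OF \<theta>] \<rho>Xh] xh[OF \<theta>']])
        fix j t \<psi> assume t: "t \<in> fst S j" and \<psi>: "\<psi> \<in> Dop j k"
        show "u2 k j (t, \<psi>) \<cdot> \<rho>X k \<cdot> v k \<theta> = u2 k j (t, \<psi>) \<cdot> x k \<theta>"
          using comp_extend1[OF \<rho>X'[OF t \<psi>] vh[OF \<theta>] \<rho>Xh u2h[OF t \<psi>]]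
            v(2)[OF \<theta> SDs[OF t] \<psi>] x(2)[OF \<theta>' t \<psi>] by simp
      qed
      then show "q1 k \<cdot> g k \<cdot> v k \<theta> = q1 k \<cdot> z k \<theta>"
        using comp_extend1[OF q1g vh[OF \<theta>] gh q1h] z(2)[OF \<theta>'] by simp
      have "fT k \<cdot> v k \<theta> = y k \<theta>"
      proof (rule is_PT_eqI[OF u4 Y D comp_hom[OF vh[OF \<theta>] fTh] yh[OF \<theta>']])
        fix j t \<psi> assume t: "t \<in> fst D j" and \<psi>: "\<psi> \<in> Dop j k"
        show "u4 k j (t, \<psi>) \<cdot> fT k \<cdot> v k \<theta> = u4 k j (t, \<psi>) \<cdot> y k \<theta>"
          using comp_extend[OF fT'[OF t \<psi>] vh[OF \<theta>] fTh u4h[OF t \<psi>] u1h[OF t \<psi>] fh]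
            v(2)[OF \<theta> t \<psi>] y(2)[OF \<theta>' t \<psi>] fa'[OF \<theta>' t \<psi>] \<theta> by simp
      qed
      then show "q2 k \<cdot> g k \<cdot> v k \<theta> = q2 k \<cdot> z k \<theta>"
        using comp_extend1[OF q2g vh[OF \<theta>] gh q2h] z(3)[OF \<theta>'] by simp
    qed
    have "rel_point C K (Delta m) PT Q g Z v z"
      unfolding rel_point_def using v(1) zs gv by blast
    then obtain l where l: "l \<in> hom C Z P" "\<And>k t. t \<in> fst K k \<Longrightarrow> a k t \<cdot> l = v k t"
      "\<And>k t. t \<in> fst (Delta m) k \<Longrightarrow> b k t \<cdot> l = z k t"
      using represents_rel_lift[OF Pr Z] by blast
    have A1l: "A1 k (t, \<theta>) \<cdot> l = a' k (t, \<theta>)" if t: "t \<in> fst D k" "\<theta> \<in> fst K k" for k t \<theta>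
      using assoc[OF l(1) ga(2)[OF t(2)] u1h[OF t(1) i]] l(2)[OF t(2)] v(2)[OF t(2,1) i]
        cmp_idn(1)[OF KD[OF t(2)]] by (simp add: A1_def)
    have A2l: "A2 k (t, \<theta>) \<cdot> l = a' k (t, \<theta>)" if t: "t \<in> fst S k" "\<theta> \<in> fst (Delta m) k" for k t \<theta>
      using assoc[OF l(1) comp_hom[OF ab(5)[OF t(2)] q1h] u2h[OF t(1) i]] assoc[OF l(1) ab(5)[OF t(2)] q1h]
        l(3)[OF t(2)] x(2)[OF t(2,1) i] z(2)[OF t(2)] cmp_idn(1)[of \<theta> k m] t(2) by (simp add: A2_def Delta_def)
    have Bl: "B k (t, \<theta>) \<cdot> l = b' k (t, \<theta>)" if t: "t \<in> fst D k" "\<theta> \<in> fst (Delta m) k" for k t \<theta>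
      using assoc[OF l(1) comp_hom[OF ab(5)[OF t(2)] q2h] u4h[OF t(1) i]] assoc[OF l(1) ab(5)[OF t(2)] q2h]
        l(3)[OF t(2)] y(2)[OF t(2,1) i] z(3)[OF t(2)] cmp_idn(1)[of \<theta> k m] t(2) by (simp add: B_def Delta_def)
    have "A k tp \<cdot> l = a' k tp" if "tp \<in> fst (sset_union ?DK ?SD) k" for k tp
    proof -
      consider "tp \<in> fst ?DK k" | "tp \<in> fst ?SD k" using \<open>tp \<in> fst (sset_union ?DK ?SD) k\<close> by (auto simp: sset_union_def)
      then show ?thesis
      proof cases
        case 1
        then show ?thesis using AA(1)[OF 1] A1l by (cases tp) (auto simp: sset_prod_def)
      next
        case 2
        then show ?thesis using AA(2)[OF 2] A2l by (cases tp) (auto simp: sset_prod_def)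
      qed
    qed
    moreover have "B k tp \<cdot> l = b' k tp" if "tp \<in> fst ?T k" for k tp
      using that Bl by (cases tp) (auto simp: sset_prod_def)
    ultimately
    show "\<exists>h. h \<in> hom C Z P \<and> (\<forall>k. \<forall>t \<in> fst (sset_union ?DK ?SD) k. A k t \<cdot> h = a' k t) \<and>
          (\<forall>k. \<forall>t \<in> fst ?T k. B k t \<cdot> h = b' k t)" using l(1) by blast
  next
    fix Z l l' assume l: "l \<in> hom C Z P" "l' \<in> hom C Z P"
      and eq: "\<And>k t. t \<in> fst (sset_union ?DK ?SD) k \<Longrightarrow> A k t \<cdot> l = A k t \<cdot> l'"
        "\<And>k t. t \<in> fst ?T k \<Longrightarrow> B k t \<cdot> l = B k t \<cdot> l'"
    have cl: "cmp \<theta> \<psi> j \<in> Dop j m" "\<theta> \<in> fst K k \<Longrightarrow> cmp \<theta> \<psi> j \<in> fst K j"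
      if "\<theta> \<in> Dop k m" "\<psi> \<in> Dop j k" for \<theta> \<psi> j k
      using Dop_cmp[OF that] closed_ssetD[OF Kf that(2)] by (auto simp: K Delta_def)
    \<comment> \<open>Equality of arrows into a path space is tested at pairs of \<open>t\<close>
      and \<open>\<psi>\<close>, which the shift equations turn into values of \<open>A2\<close> and
      \<open>B\<close> at \<open>t\<close> and \<open>cmp \<theta> \<psi> j\<close>. The hypothesis
      on \<open>l\<close> and \<open>l'\<close> applies to these.\<close>
    have bl: "b k \<theta> \<cdot> l = b k \<theta> \<cdot> l'" if \<theta>: "\<theta> \<in> Dop k m" for k \<theta>
    proof (rule joint[OF comp_hom[OF l(1) bh[OF \<theta>]] comp_hom[OF l(2) bh[OF \<theta>]]])
      note b1 = comp_hom[OF bh[OF \<theta>] q1h] and b2 = comp_hom[OF bh[OF \<theta>] q2h]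
      have "(q1 k \<cdot> b k \<theta>) \<cdot> l = (q1 k \<cdot> b k \<theta>) \<cdot> l'"
      proof (rule is_PT_eqI[OF u2 X S comp_hom[OF l(1) b1] comp_hom[OF l(2) b1]])
        fix j t \<psi> assume t: "t \<in> fst S j" and \<psi>: "\<psi> \<in> Dop j k"
        have "(t, cmp \<theta> \<psi> j) \<in> fst ?SD j" using t cl(1)[OF \<theta> \<psi>] by (simp add: sset_prod_def Delta_def)
        then have "A2 j (t, cmp \<theta> \<psi> j) \<cdot> l = A2 j (t, cmp \<theta> \<psi> j) \<cdot> l'"
          using eq(1)[of "(t, cmp \<theta> \<psi> j)" j] AA(2) by (simp add: sset_union_def)
        then show "u2 k j (t, \<psi>) \<cdot> (q1 k \<cdot> b k \<theta>) \<cdot> l = u2 k j (t, \<psi>) \<cdot> (q1 k \<cdot> b k \<theta>) \<cdot> l'"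
          using comp_extend1[OF shA2[OF t \<theta> \<psi>] l(1) b1 u2h[OF t \<psi>]]
            comp_extend1[OF shA2[OF t \<theta> \<psi>] l(2) b1 u2h[OF t \<psi>]] by simp
      qed
      then show "q1 k \<cdot> b k \<theta> \<cdot> l = q1 k \<cdot> b k \<theta> \<cdot> l'"
        using assoc[OF l(1) bh[OF \<theta>] q1h] assoc[OF l(2) bh[OF \<theta>] q1h] by simp
      have "(q2 k \<cdot> b k \<theta>) \<cdot> l = (q2 k \<cdot> b k \<theta>) \<cdot> l'"
      proof (rule is_PT_eqI[OF u4 Y D comp_hom[OF l(1) b2] comp_hom[OF l(2) b2]])
        fix j t \<psi> assume t: "t \<in> fst D j" and \<psi>: "\<psi> \<in> Dop j k"
        have "B j (t, cmp \<theta> \<psi> j) \<cdot> l = B j (t, cmp \<theta> \<psi> j) \<cdot> l'"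
          using t cl(1)[OF \<theta> \<psi>] by (intro eq(2)) (simp add: sset_prod_def Delta_def)
        then show "u4 k j (t, \<psi>) \<cdot> (q2 k \<cdot> b k \<theta>) \<cdot> l = u4 k j (t, \<psi>) \<cdot> (q2 k \<cdot> b k \<theta>) \<cdot> l'"
          using comp_extend1[OF shB[OF t \<theta> \<psi>] l(1) b2 u4h[OF t \<psi>]]
            comp_extend1[OF shB[OF t \<theta> \<psi>] l(2) b2 u4h[OF t \<psi>]] by simp
      qed
      then show "q2 k \<cdot> b k \<theta> \<cdot> l = q2 k \<cdot> b k \<theta> \<cdot> l'"
        using assoc[OF l(1) bh[OF \<theta>] q2h] assoc[OF l(2) bh[OF \<theta>] q2h] by simp
    qed
    have al: "a k \<theta> \<cdot> l = a k \<theta> \<cdot> l'" if \<theta>: "\<theta> \<in> fst K k" for k \<theta>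
    proof (rule is_PT_eqI[OF u1 X D comp_hom[OF l(1) ga(2)[OF \<theta>]] comp_hom[OF l(2) ga(2)[OF \<theta>]]])
      fix j t \<psi> assume t: "t \<in> fst D j" and \<psi>: "\<psi> \<in> Dop j k"
      have "(t, cmp \<theta> \<psi> j) \<in> fst ?DK j" using t cl(2)[OF KD[OF \<theta>] \<psi> \<theta>] by (simp add: sset_prod_def)
      then have "A1 j (t, cmp \<theta> \<psi> j) \<cdot> l = A1 j (t, cmp \<theta> \<psi> j) \<cdot> l'"
        using eq(1)[of "(t, cmp \<theta> \<psi> j)" j] AA(1) by (simp add: sset_union_def)
      then show "u1 k j (t, \<psi>) \<cdot> a k \<theta> \<cdot> l = u1 k j (t, \<psi>) \<cdot> a k \<theta> \<cdot> l'"
        using comp_extend1[OF shA1[OF t \<theta> \<psi>] l(1) ga(2)[OF \<theta>] u1h[OF t \<psi>]]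
          comp_extend1[OF shA1[OF t \<theta> \<psi>] l(2) ga(2)[OF \<theta>] u1h[OF t \<psi>]] by simp
    qed
    show "l = l'"
      by (rule represents_rel_eqI[OF PT Q Kf \<Delta> gh Pr l]) (use al bl in \<open>auto simp: Delta_def\<close>)
  qed
  \<comment> \<open>\<open>A1\<close> evaluates a universal point at an identity. The structure map
    produced by \<open>h\<close> turns this identity into \<open>\<theta>\<close>, which leaves the
    universal point in degree \<open>m\<close>.\<close>
  have A1h: "A1 k (t, \<theta>) \<cdot> h = u1 m k (t, \<theta>)" if t: "t \<in> fst D k" "\<theta> \<in> fst K k" for k t \<theta>
    using assoc[OF h(1) ga(2)[OF t(2)] u1h[OF t(1) i]] h(2)[OF t(2)] is_PTD(3)[OF u1 KD[OF t(2)] t(1) i]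
      cmp_idn(1)[OF KD[OF t(2)]] by (simp add: A1_def)
  have A2h: "A2 k (t, \<theta>) \<cdot> h = u1 m k (t, \<theta>)" if t: "t \<in> fst S k" "\<theta> \<in> Dop k m" for k t \<theta>
  proof -
    note \<theta> = t(2)
    have "q1 k \<cdot> b k \<theta> \<cdot> h = snd PS k m \<theta> \<cdot> \<rho>X m"
      using comp_extend[OF is_smorD(2)[OF q1 \<theta>] gh is_sspaceD(2)[OF Q \<theta>] q1h q1h
          is_sspaceD(2)[OF is_PTD(1)[OF u2] \<theta>]] h(3)[OF \<theta>] q1g by simp
    moreover have "u2 k k (t, idn k) \<cdot> snd PS k m \<theta> \<cdot> \<rho>X m = u1 m k (t, \<theta>)"
      using comp_extend1[OF is_PTD(3)[OF u2 \<theta> t(1) i] \<rho>Xh is_sspaceD(2)[OF is_PTD(1)[OF u2] \<theta>] u2h[OF t(1) i]]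
        \<rho>X'[OF t] cmp_idn(1)[OF \<theta>] by simp
    ultimately show ?thesis
      using assoc[OF h(1) comp_hom[OF bh[OF \<theta>] q1h] u2h[OF t(1) i]] assoc[OF h(1) bh[OF \<theta>] q1h]
      by (simp add: A2_def)
  qed
  have Bh: "B k (t, \<theta>) \<cdot> h = f k \<cdot> u1 m k (t, \<theta>)" if t: "t \<in> fst D k" "\<theta> \<in> Dop k m" for k t \<theta>
  proof -
    note \<theta> = t(2)
    have "q2 k \<cdot> b k \<theta> \<cdot> h = snd PTY k m \<theta> \<cdot> fT m"
      using comp_extend[OF is_smorD(2)[OF q2 \<theta>] gh is_sspaceD(2)[OF Q \<theta>] q2h q2h
          is_sspaceD(2)[OF is_PTD(1)[OF u4] \<theta>]] h(3)[OF \<theta>] q2g by simp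
    moreover have "u4 k k (t, idn k) \<cdot> snd PTY k m \<theta> \<cdot> fT m = f k \<cdot> u1 m k (t, \<theta>)"
      using comp_extend1[OF is_PTD(3)[OF u4 \<theta> t(1) i] fTh is_sspaceD(2)[OF is_PTD(1)[OF u4] \<theta>] u4h[OF t(1) i]]
        fT'[OF t] cmp_idn(1)[OF \<theta>] by simp
    ultimately show ?thesis
      using assoc[OF h(1) comp_hom[OF bh[OF \<theta>] q2h] u4h[OF t(1) i]] assoc[OF h(1) bh[OF \<theta>] q2h]
      by (simp add: B_def)
  qed
  have "A k tp \<cdot> h = u1 m k tp" if tp: "tp \<in> fst (sset_union ?DK ?SD) k" for k tp
  proof -
    consider "tp \<in> fst ?DK k" | "tp \<in> fst ?SD k" using tp by (auto simp: sset_union_def)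
    then show ?thesis
    proof cases
      case 1
      then show ?thesis using AA(1)[OF 1] A1h by (cases tp) (auto simp: sset_prod_def)
    next
      case 2
      then show ?thesis using AA(2)[OF 2] A2h by (cases tp) (auto simp: sset_prod_def Delta_def)
    qed
  qed
  moreover have "B k tp \<cdot> h = f k \<cdot> u1 m k tp" if tp: "tp \<in> fst ?T k" for k tp
    using tp Bh by (cases tp) (auto simp: sset_prod_def Delta_def)
  ultimately show ?thesis using that[OF rep is_PTD(2)[OF u1]] by blast
qed

end

section \<open>Filtrations of families of chains\<close>

text \<open>\<open>\<S>\<close> grows to \<open>\<T>\<close> by adding simplices \<open>\<tau>\<close> one at a time, where the faces of \<open>\<tau>\<close> that are
  already present are exactly those not containing some \<open>F\<close> with \<open>Adm \<tau> F\<close>: the whole boundary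
  for \<open>F = \<tau>\<close>, a horn for \<open>F = \<tau> - {v}\<close>.\<close>

inductive built :: "('p set \<Rightarrow> 'p set \<Rightarrow> bool) \<Rightarrow> 'p set set \<Rightarrow> 'p set set \<Rightarrow> bool" for Adm \<T> where
  refl: "built Adm \<T> \<T>"
| attach: "\<lbrakk>\<tau> \<in> \<T>; F \<subseteq> \<tau>; Adm \<tau> F; {\<rho> \<in> \<S>. \<rho> \<subseteq> \<tau>} = {\<rho>. \<rho> \<subseteq> \<tau> \<and> \<rho> \<noteq> {} \<and> \<not> F \<subseteq> \<rho>};
    built Adm \<T> (\<S> \<union> {\<rho>. \<rho> \<subseteq> \<tau> \<and> \<rho> \<noteq> {}})\<rbrakk> \<Longrightarrow> built Adm \<T> \<S>"

definition adm_bdry :: "'p set \<Rightarrow> 'p set \<Rightarrow> bool" where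
  "adm_bdry \<tau> F \<longleftrightarrow> F = \<tau>"

text \<open>The condition that \<open>F\<close> be nonempty rules out attaching a single vertex
  along the empty set: the horn conditions of a fibration begin in dimension one.\<close>

definition adm_horn :: "'p set \<Rightarrow> 'p set \<Rightarrow> bool" where
  "adm_horn \<tau> F \<longleftrightarrow> F \<noteq> {} \<and> (\<exists>v \<in> \<tau>. F = \<tau> - {v})"

definition down_closed :: "'p set set \<Rightarrow> bool" where
  "down_closed \<S> \<longleftrightarrow> {} \<notin> \<S> \<and> (\<forall>\<sigma> \<in> \<S>. \<forall>\<rho>. \<rho> \<subseteq> \<sigma> \<longrightarrow> \<rho> \<noteq> {} \<longrightarrow> \<rho> \<in> \<S>)"

lemma down_closedD: "\<lbrakk>down_closed \<S>; \<sigma> \<in> \<S>; \<rho> \<subseteq> \<sigma>; \<rho> \<noteq> {}\<rbrakk> \<Longrightarrow> \<rho> \<in> \<S>"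
  unfolding down_closed_def by blast

lemma down_closed_attach:
  "down_closed \<S> \<Longrightarrow> down_closed (\<S> \<union> {\<rho>. \<rho> \<subseteq> \<tau> \<and> \<rho> \<noteq> {}})"
  unfolding down_closed_def by blast

text \<open>A missing simplex of least cardinality has all its proper nonempty faces present, so it
  is attached along its whole boundary.\<close>

lemma built_bdry:
  assumes fin: "finite \<T>" "\<And>\<sigma>. \<sigma> \<in> \<T> \<Longrightarrow> finite \<sigma>" and T: "down_closed \<T>"
    and S: "down_closed \<S>" "\<S> \<subseteq> \<T>"
  shows "built adm_bdry \<T> \<S>"
  using S
proof (induction "card (\<T> - \<S>)" arbitrary: \<S> rule: less_induct)
  case less
  show ?case
  proof (cases "\<T> - \<S> = {}")
    case True
    with less.prems(2) have "\<S> = \<T>" by (intro equalityI) auto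
    then show ?thesis using built.refl[of adm_bdry \<T>] by simp
  next
    case False
    then obtain \<tau> where \<tau>: "\<tau> \<in> \<T> - \<S>" "\<And>\<sigma>. \<sigma> \<in> \<T> - \<S> \<Longrightarrow> card \<tau> \<le> card \<sigma>"
      using ex_has_least_nat[of "\<lambda>\<sigma>. \<sigma> \<in> \<T> - \<S>" _ card] by blast
    have faces: "\<rho> \<in> \<S>" if "\<rho> \<subset> \<tau>" "\<rho> \<noteq> {}" for \<rho>
    proof (rule ccontr)
      assume "\<rho> \<notin> \<S>"
      then have "card \<tau> \<le> card \<rho>" using down_closedD[OF T, of \<tau> \<rho>] \<tau> that by blast
      then show False using psubset_card_mono[OF fin(2) that(1)] \<tau> by force
    qed
    have eq: "\<S> \<union> {\<rho>. \<rho> \<subseteq> \<tau> \<and> \<rho> \<noteq> {}} = insert \<tau> \<S>" using faces \<tau>(1) T unfolding down_closed_def by blast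
    have "card (\<T> - insert \<tau> \<S>) < card (\<T> - \<S>)"
      by (rule psubset_card_mono) (use fin \<tau> in auto)
    then have b: "built adm_bdry \<T> (\<S> \<union> {\<rho>. \<rho> \<subseteq> \<tau> \<and> \<rho> \<noteq> {}})"
      using less.hyps[of "insert \<tau> \<S>"] down_closed_attach[OF less.prems(1), of \<tau>] \<tau> less.prems(2)
      unfolding eq by blast
    have f: "{\<rho> \<in> \<S>. \<rho> \<subseteq> \<tau>} = {\<rho>. \<rho> \<subseteq> \<tau> \<and> \<rho> \<noteq> {} \<and> \<not> \<tau> \<subseteq> \<rho>}"
    proof (intro equalityI subsetI CollectI; elim CollectE conjE)
      fix \<rho> assume "\<rho> \<in> \<S>" "\<rho> \<subseteq> \<tau>"
      then show "\<rho> \<subseteq> \<tau> \<and> \<rho> \<noteq> {} \<and> \<not> \<tau> \<subseteq> \<rho>"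
        using \<tau>(1) less.prems(1) unfolding down_closed_def by (metis DiffE subset_antisym)
    next
      fix \<rho> assume "\<rho> \<subseteq> \<tau>" "\<rho> \<noteq> {}" "\<not> \<tau> \<subseteq> \<rho>"
      then show "\<rho> \<in> \<S> \<and> \<rho> \<subseteq> \<tau>" using faces by blast
    qed
    have "\<tau> \<in> \<T>" "adm_bdry \<tau> \<tau>" using \<tau>(1) by (auto simp: adm_bdry_def)
    then show ?thesis by (rule built.attach[OF _ subset_refl _ f b])
  qed
qed

text \<open>The coordinates are arbitrary integer-valued functions, so that one filtration result
  covers both projections in either role and both directions of the order.\<close>

definition chain_family :: "('p \<Rightarrow> int) \<Rightarrow> ('p \<Rightarrow> int) \<Rightarrow> 'p set \<Rightarrow> 'p set set" where
  "chain_family x y G = {\<sigma>. \<sigma> \<subseteq> G \<and> \<sigma> \<noteq> {} \<and>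
     (\<forall>c \<in> \<sigma>. \<forall>d \<in> \<sigma>. x c \<le> x d \<and> y c \<le> y d \<or> x d \<le> x c \<and> y d \<le> y c)}"

lemma down_closed_chain_family: "down_closed (chain_family x y G)"
  unfolding down_closed_def chain_family_def by auto

text \<open>Chains covering every column but possibly \<open>i\<close> and every row are matched by toggling the
  point of column \<open>i\<close> lying next to the lowest point of column \<open>i + 1\<close>. Attaching the matched pairs in the
  order of increasing size and, for equal size, of decreasing height of that point fills horns only.\<close>

lemma built_horn:
  fixes x y :: "'p \<Rightarrow> int"
  assumes fin: "finite G"
    and box: "\<And>c d. \<lbrakk>c \<in> G; d \<in> G\<rbrakk> \<Longrightarrow> \<exists>e \<in> G. x e = x c \<and> y e = y d"
    and i: "i \<in> x ` G" "i + 1 \<in> x ` G"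
  defines "\<T> \<equiv> chain_family x y G"
  defines "\<S>\<^sub>0 \<equiv> {\<sigma> \<in> \<T>. \<not> (x ` G - {i} \<subseteq> x ` \<sigma> \<and> y ` G \<subseteq> y ` \<sigma>)}"
  shows "built adm_horn \<T> \<S>\<^sub>0"
proof -
  have T: "down_closed \<T>" unfolding \<T>_def by (rule down_closed_chain_family)
  have TG: "\<sigma> \<subseteq> G" if "\<sigma> \<in> \<T>" for \<sigma> using that unfolding \<T>_def chain_family_def by auto
  have finT: "finite \<T>" by (rule finite_subset[of _ "Pow G"]) (use TG fin in auto)
  have fins: "finite \<sigma>" if "\<sigma> \<in> \<T>" for \<sigma> using TG[OF that] fin finite_subset by blast
  have Sd: "down_closed \<S>\<^sub>0" unfolding down_closed_def
  proof (intro conjI ballI allI impI)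
    show "{} \<notin> \<S>\<^sub>0" using T unfolding \<S>\<^sub>0_def down_closed_def by blast
    fix \<sigma> \<rho> assume A: "\<sigma> \<in> \<S>\<^sub>0" "\<rho> \<subseteq> \<sigma>" "\<rho> \<noteq> {}"
    then have "\<rho> \<in> \<T>" using down_closedD[OF T] unfolding \<S>\<^sub>0_def by blast
    moreover have "x ` \<rho> \<subseteq> x ` \<sigma>" "y ` \<rho> \<subseteq> y ` \<sigma>" using A by auto
    ultimately show "\<rho> \<in> \<S>\<^sub>0" using A unfolding \<S>\<^sub>0_def by blast
  qed
  \<comment> \<open>\<open>v \<sigma>\<close> stands in column \<open>i\<close>, in the row of the
    lowest point of column \<open>i + 1\<close>. Points are not assumed to be determined by their
    coordinates, so it is chosen; the choice depends on \<open>\<sigma>\<close> only through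
    \<open>q \<sigma>\<close>.\<close>
  define q where "q \<sigma> = Min (y ` {c \<in> \<sigma>. x c = i + 1})" for \<sigma>
  define v where "v \<sigma> = (SOME e. e \<in> G \<and> x e = i \<and> y e = q \<sigma>)" for \<sigma>
  have q: "\<exists>r \<in> \<sigma>. x r = i + 1 \<and> y r = q \<sigma>" "\<And>c. \<lbrakk>c \<in> \<sigma>; x c = i + 1\<rbrakk> \<Longrightarrow> q \<sigma> \<le> y c"
    if "\<sigma> \<in> \<T>" "\<sigma> \<notin> \<S>\<^sub>0" for \<sigma>
  proof -
    have "x ` G - {i} \<subseteq> x ` \<sigma>" using that unfolding \<S>\<^sub>0_def by blast
    with i have ne: "{c \<in> \<sigma>. x c = i + 1} \<noteq> {}" by force
    have f: "finite (y ` {c \<in> \<sigma>. x c = i + 1})" using fins[OF that(1)] by simp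
    have "q \<sigma> \<in> y ` {c \<in> \<sigma>. x c = i + 1}" unfolding q_def using Min_in[OF f] ne by blast
    then show "\<exists>r \<in> \<sigma>. x r = i + 1 \<and> y r = q \<sigma>" by auto
    show "\<And>c. \<lbrakk>c \<in> \<sigma>; x c = i + 1\<rbrakk> \<Longrightarrow> q \<sigma> \<le> y c" unfolding q_def using f by (intro Min_le) auto
  qed
  have v: "v \<sigma> \<in> G" "x (v \<sigma>) = i" "y (v \<sigma>) = q \<sigma>" if \<sigma>: "\<sigma> \<in> \<T>" "\<sigma> \<notin> \<S>\<^sub>0" for \<sigma>
  proof -
    obtain r where r: "r \<in> \<sigma>" "y r = q \<sigma>" using q(1)[OF \<sigma>] by blast
    obtain c where c: "c \<in> G" "x c = i" using i by blast
    have "\<exists>e. e \<in> G \<and> x e = i \<and> y e = q \<sigma>"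
      using box[OF c(1) subsetD[OF TG[OF \<sigma>(1)] r(1)]] c(2) r(2) by auto
    from someI_ex[OF this] show "v \<sigma> \<in> G" "x (v \<sigma>) = i" "y (v \<sigma>) = q \<sigma>" unfolding v_def by auto
  qed
  have col: "q \<sigma> = q \<rho>" "v \<sigma> = v \<rho>" if "{c \<in> \<sigma>. x c = i + 1} = {c \<in> \<rho>. x c = i + 1}" for \<sigma> \<rho>
    using that unfolding q_def v_def by auto
  have ins: "insert (v \<sigma>) \<sigma> \<in> \<T>" "q (insert (v \<sigma>) \<sigma>) = q \<sigma>" "v (insert (v \<sigma>) \<sigma>) = v \<sigma>"
    if \<sigma>: "\<sigma> \<in> \<T>" "\<sigma> \<notin> \<S>\<^sub>0" for \<sigma>
  proof -
    obtain r where r: "r \<in> \<sigma>" "x r = i + 1" "y r = q \<sigma>" using q(1)[OF \<sigma>] by blast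
    have ch: "\<And>c d. \<lbrakk>c \<in> \<sigma>; d \<in> \<sigma>\<rbrakk> \<Longrightarrow> x c \<le> x d \<and> y c \<le> y d \<or> x d \<le> x c \<and> y d \<le> y c"
      using \<sigma>(1) unfolding \<T>_def chain_family_def by blast
    \<comment> \<open>Compare \<open>d\<close> with the lowest point \<open>r\<close> of column
      \<open>i + 1\<close>. If \<open>d\<close> is above \<open>r\<close>, it is above
      \<open>v \<sigma>\<close>. If it is below \<open>r\<close> and in a column up to
      \<open>i\<close>, it is below \<open>v \<sigma>\<close>. If it is below \<open>r\<close> and
      in column \<open>i + 1\<close>, minimality puts it at height \<open>q \<sigma>\<close>, hence
      above \<open>v \<sigma>\<close>.\<close>
    have cv: "x (v \<sigma>) \<le> x d \<and> y (v \<sigma>) \<le> y d \<or> x d \<le> x (v \<sigma>) \<and> y d \<le> y (v \<sigma>)" if d: "d \<in> \<sigma>" for d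
      using ch[OF r(1) d] q(2)[OF \<sigma> d] r v[OF \<sigma>] by fastforce
    show "insert (v \<sigma>) \<sigma> \<in> \<T>" unfolding \<T>_def chain_family_def
    proof (intro CollectI conjI ballI)
      show "insert (v \<sigma>) \<sigma> \<subseteq> G" using TG[OF \<sigma>(1)] v(1)[OF \<sigma>] by simp
      fix c d assume "c \<in> insert (v \<sigma>) \<sigma>" "d \<in> insert (v \<sigma>) \<sigma>"
      then consider "c = v \<sigma>" "d = v \<sigma>" | "c = v \<sigma>" "d \<in> \<sigma>" | "c \<in> \<sigma>" "d = v \<sigma>" | "c \<in> \<sigma>" "d \<in> \<sigma>"
        by blast
      then show "x c \<le> x d \<and> y c \<le> y d \<or> x d \<le> x c \<and> y d \<le> y c"
      proof cases
        case 2 then show ?thesis using cv[of d] by simp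
      next
        case 3 then show ?thesis using cv[of c] by (simp add: disj_commute)
      next
        case 4 then show ?thesis by (rule ch)
      qed simp
    qed simp
    have e: "{c \<in> insert (v \<sigma>) \<sigma>. x c = i + 1} = {c \<in> \<sigma>. x c = i + 1}" using v(2)[OF \<sigma>] by auto
    show "q (insert (v \<sigma>) \<sigma>) = q \<sigma>" by (rule col(1)[OF e])
    show "v (insert (v \<sigma>) \<sigma>) = v \<sigma>" by (rule col(2)[OF e])
  qed
  have rem: "\<sigma> - {v \<sigma>} \<in> \<T>" "\<sigma> - {v \<sigma>} \<notin> \<S>\<^sub>0" "v (\<sigma> - {v \<sigma>}) = v \<sigma>" "\<sigma> - {v \<sigma>} \<noteq> {}"
    if \<sigma>: "\<sigma> \<in> \<T>" "\<sigma> \<notin> \<S>\<^sub>0" for \<sigma>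
  proof -
    obtain r where r: "r \<in> \<sigma>" "x r = i + 1" "y r = q \<sigma>" using q(1)[OF \<sigma>] by blast
    then have r': "r \<in> \<sigma> - {v \<sigma>}" using v(2)[OF \<sigma>] by auto
    then show ne: "\<sigma> - {v \<sigma>} \<noteq> {}" by blast
    show T': "\<sigma> - {v \<sigma>} \<in> \<T>" by (rule down_closedD[OF T \<sigma>(1) Diff_subset ne])
    have x1: "x ` \<sigma> - {i} \<subseteq> x ` (\<sigma> - {v \<sigma>})" using v(2)[OF \<sigma>] by auto
    \<comment> \<open>Removing \<open>v \<sigma>\<close> loses no row, since \<open>r\<close> lies
      in the same row; the only column that can be lost is \<open>i\<close>, which is
      exempt.\<close>
    have y1: "y ` \<sigma> \<subseteq> y ` (\<sigma> - {v \<sigma>})"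
    proof
      fix b assume "b \<in> y ` \<sigma>"
      then obtain c where c: "c \<in> \<sigma>" "b = y c" by blast
      show "b \<in> y ` (\<sigma> - {v \<sigma>})"
      proof (cases "c = v \<sigma>")
        case True
        then have "b = y r" using c v(3)[OF \<sigma>] r(3) by simp
        then show ?thesis using r' by (rule image_eqI)
      qed (use c in blast)
    qed
    have xy: "x ` G - {i} \<subseteq> x ` \<sigma>" "y ` G \<subseteq> y ` \<sigma>" using \<sigma> by (simp_all add: \<S>\<^sub>0_def)
    have "A \<subseteq> D" if "A - {i} \<subseteq> B" "B - {i} \<subseteq> D" "A = A - {i}" for A B D :: "int set"
      using that by blast
    from this[OF _ x1, of "x ` G - {i}"] xy(1) have "x ` G - {i} \<subseteq> x ` (\<sigma> - {v \<sigma>})" by simp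
    moreover have "y ` G \<subseteq> y ` (\<sigma> - {v \<sigma>})" by (rule subset_trans[OF xy(2) y1])
    ultimately show "\<sigma> - {v \<sigma>} \<notin> \<S>\<^sub>0" by (simp add: \<S>\<^sub>0_def)
    have "{c \<in> \<sigma> - {v \<sigma>}. x c = i + 1} = {c \<in> \<sigma>. x c = i + 1}" using v(2)[OF \<sigma>] by auto
    then show "v (\<sigma> - {v \<sigma>}) = v \<sigma>" by (rule col(2))
  qed
  \<comment> \<open>The last condition is the invariant of the induction: together with downward
    closure it says that each matched pair is entirely present or entirely missing.\<close>
  have "built adm_horn \<T> \<S>"
    if "down_closed \<S>" "\<S>\<^sub>0 \<subseteq> \<S>" "\<S> \<subseteq> \<T>" "\<And>\<sigma>. \<lbrakk>\<sigma> \<in> \<S>; \<sigma> \<notin> \<S>\<^sub>0\<rbrakk> \<Longrightarrow> insert (v \<sigma>) \<sigma> \<in> \<S>" for \<S>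
    using that
  proof (induction "card (\<T> - \<S>)" arbitrary: \<S> rule: less_induct)
    case less
    note S = less.prems
    show ?case
    proof (cases "\<T> - \<S> = {}")
      case True
      with S(3) have "\<S> = \<T>" by (intro equalityI) auto
      then show ?thesis using built.refl[of adm_horn \<T>] by simp
    next
      case False
      \<comment> \<open>These are the upper members of the missing pairs. By the next fact every
        missing simplex leads to one, so attaching them with their partners exhausts
        \<open>\<T>\<close>.\<close>
      define U where "U = {\<tau> \<in> \<T> - \<S>. v \<tau> \<in> \<tau>}"
      have up: "insert (v \<sigma>) \<sigma> \<in> U" if "\<sigma> \<in> \<T>" "\<sigma> \<notin> \<S>" for \<sigma>
      proof -
        have \<sigma>: "\<sigma> \<in> \<T>" "\<sigma> \<notin> \<S>\<^sub>0" using that S(2) by auto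
        have "\<sigma> \<noteq> {}" using \<sigma>(1) T unfolding down_closed_def by blast
        then have "insert (v \<sigma>) \<sigma> \<notin> \<S>" using down_closedD[OF S(1) _ subset_insertI, of "v \<sigma>" \<sigma>] that(2) by blast
        then show ?thesis unfolding U_def using ins[OF \<sigma>] by simp
      qed
      with False have "U \<noteq> {}" by blast
      then obtain \<tau>\<^sub>0 where \<tau>\<^sub>0: "\<tau>\<^sub>0 \<in> U" "\<And>\<sigma>. \<sigma> \<in> U \<Longrightarrow> card \<tau>\<^sub>0 \<le> card \<sigma>"
        using ex_has_least_nat[of "\<lambda>\<sigma>. \<sigma> \<in> U" _ card] by blast
      define U' where "U' = {\<tau> \<in> U. card \<tau> = card \<tau>\<^sub>0}"
      have "finite U'" "U' \<noteq> {}" using finT \<tau>\<^sub>0(1) unfolding U'_def U_def by auto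
      then have "finite (q ` U')" "q ` U' \<noteq> {}" by auto
      note qU = this
      obtain \<tau> where \<tau>: "\<tau> \<in> U'" "Max (q ` U') = q \<tau>" using Max_in[OF qU] by (elim imageE)
      then have \<tau>q: "q \<sigma> \<le> q \<tau>" if "\<sigma> \<in> U'" for \<sigma> using Max_ge[OF qU(1) imageI[OF that]] by simp
      have \<tau>T: "\<tau> \<in> \<T>" "\<tau> \<notin> \<S>" "v \<tau> \<in> \<tau>" "card \<tau> = card \<tau>\<^sub>0" using \<tau>(1) unfolding U'_def U_def by auto
      then have \<tau>S0: "\<tau> \<notin> \<S>\<^sub>0" using S(2) by blast
      define F where "F = \<tau> - {v \<tau>}"
      note F = rem[OF \<tau>T(1) \<tau>S0, folded F_def]
      have insF: "insert (v F) F = \<tau>" using F(3) \<tau>T(3) by (auto simp: F_def)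
      have FS: "F \<notin> \<S>" using S(4)[OF _ F(2)] insF \<tau>T(2) by metis
      \<comment> \<open>A missing face containing its own point \<open>v\<close> would be a smaller
        member of \<open>U\<close>. One not containing it has a partner as large as \<tau>, so the
        maximal choice of \<open>q\<close> gives \<open>q\<close> of the face at most
        \<open>q \<tau>\<close>; passing to a subset cannot lower \<open>q\<close>, so both are
        equal. Then its point is \<open>v \<tau>\<close>, which it does contain.\<close>
      have faces: "\<tau> - {w} \<in> \<S>" if w: "w \<in> \<tau>" "w \<noteq> v \<tau>" for w
      proof (rule ccontr)
        assume n: "\<tau> - {w} \<notin> \<S>"
        let ?\<rho> = "\<tau> - {w}"
        have "v \<tau> \<in> ?\<rho>" using w \<tau>T by blast
        then have "?\<rho> \<noteq> {}" by blast
        then have \<rho>T: "?\<rho> \<in> \<T>" by (rule down_closedD[OF T \<tau>T(1) Diff_subset])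
        have \<rho>S0: "?\<rho> \<notin> \<S>\<^sub>0" using n S(2) by blast
        have cd: "card ?\<rho> = card \<tau> - 1" "card \<tau> > 0"
          using w(1) fins[OF \<tau>T(1)] card_gt_0_iff by (auto simp: card_Diff_singleton)
        show False
        proof (cases "v ?\<rho> \<in> ?\<rho>")
          case True
          then have "?\<rho> \<in> U" using \<rho>T n unfolding U_def by blast
          then show False using \<tau>\<^sub>0(2) cd \<tau>T(4) by fastforce
        next
          case False
          then have "card (insert (v ?\<rho>) ?\<rho>) = card \<tau>" using cd fins[OF \<rho>T] by simp
          then have "insert (v ?\<rho>) ?\<rho> \<in> U'" using up[OF \<rho>T n] \<tau>T(4) unfolding U'_def by simp
          then have le: "q ?\<rho> \<le> q \<tau>" using \<tau>q ins(2)[OF \<rho>T \<rho>S0] by metis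
          obtain r where "r \<in> ?\<rho>" "x r = i + 1" "y r = q ?\<rho>" using q(1)[OF \<rho>T \<rho>S0] by blast
          then have "q ?\<rho> = q \<tau>" using q(2)[OF \<tau>T(1) \<tau>S0, of r] le by auto
          then have "v ?\<rho> = v \<tau>" unfolding v_def by simp
          then show False using False \<open>v \<tau> \<in> ?\<rho>\<close> by simp
        qed
      qed
      have eq: "{\<rho> \<in> \<S>. \<rho> \<subseteq> \<tau>} = {\<rho>. \<rho> \<subseteq> \<tau> \<and> \<rho> \<noteq> {} \<and> \<not> F \<subseteq> \<rho>}"
      proof (intro equalityI subsetI CollectI; elim CollectE conjE)
        fix \<rho> assume \<rho>: "\<rho> \<in> \<S>" "\<rho> \<subseteq> \<tau>"
        have "\<rho> \<noteq> {}" using \<rho>(1) S(1) unfolding down_closed_def by blast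
        moreover have "\<not> F \<subseteq> \<rho>" using down_closedD[OF S(1) \<rho>(1) _ F(4)] FS by blast
        ultimately show "\<rho> \<subseteq> \<tau> \<and> \<rho> \<noteq> {} \<and> \<not> F \<subseteq> \<rho>" using \<rho> by blast
      next
        fix \<rho> assume \<rho>: "\<rho> \<subseteq> \<tau>" "\<rho> \<noteq> {}" "\<not> F \<subseteq> \<rho>"
        then obtain w where "w \<in> \<tau>" "w \<noteq> v \<tau>" "w \<notin> \<rho>" unfolding F_def by blast
        then show "\<rho> \<in> \<S> \<and> \<rho> \<subseteq> \<tau>" using down_closedD[OF S(1) faces, of w \<rho>] \<rho> by blast
      qed
      let ?S = "\<S> \<union> {\<rho>. \<rho> \<subseteq> \<tau> \<and> \<rho> \<noteq> {}}"
      \<comment> \<open>Exactly one matched pair is added, so the invariant survives.\<close>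
      have S': "?S = \<S> \<union> {\<tau>, F}"
      proof -
        have "\<rho> = \<tau> \<or> \<rho> = F" if "\<rho> \<subseteq> \<tau>" "F \<subseteq> \<rho>" for \<rho> using that unfolding F_def by blast
        moreover have "\<tau> \<noteq> {}" "F \<noteq> {}" "F \<subseteq> \<tau>" using \<tau>T(3) F(4) unfolding F_def by blast+
        ultimately show ?thesis using eq by blast
      qed
      have b: "built adm_horn \<T> ?S"
      proof (rule less.hyps)
        show "card (\<T> - ?S) < card (\<T> - \<S>)"
          by (rule psubset_card_mono) (use finT \<tau>T S' in auto)
        show "down_closed ?S" by (rule down_closed_attach[OF S(1)])
        show "\<S>\<^sub>0 \<subseteq> ?S" "?S \<subseteq> \<T>" using S(2,3) \<tau>T(1) F(1) unfolding S' by auto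
        fix \<sigma> assume "\<sigma> \<in> ?S" "\<sigma> \<notin> \<S>\<^sub>0"
        then show "insert (v \<sigma>) \<sigma> \<in> ?S"
          using S(4) insF insert_absorb[OF \<tau>T(3)] unfolding S' by blast
      qed
      have "adm_horn \<tau> F" unfolding adm_horn_def using F(4) \<tau>T(3) F_def by blast
      moreover have "F \<subseteq> \<tau>" by (auto simp: F_def)
      ultimately show ?thesis by (intro built.attach[OF \<tau>T(1) _ _ eq b])
    qed
  qed
  then show ?thesis using Sd by (auto simp: \<S>\<^sub>0_def)
qed

section \<open>Subcomplexes of a product of two simplices\<close>

text \<open>Boundaries and horns are encoded alike by the set of vertices that a simplex must not
  hit completely. The pushout product then depends on two vertex sets only, and the cases of the
  theorem become instances of one statement.\<close>

definition miss :: "nat \<Rightarrow> nat set \<Rightarrow> (nat \<Rightarrow> nat) sset" where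
  "miss n F = ((\<lambda>k. {\<theta> \<in> Dop k n. \<not> F \<subseteq> \<theta> ` {..k}}), snd (Delta n))"

lemma bdry_eq_miss: "bdry n = miss n {..n}"
  by (auto simp: bdry_def miss_def Delta_def)

lemma horn_eq_miss: "horn n i = miss n ({..n} - {i})"
  by (auto simp: horn_def miss_def Delta_def)

lemma image_cmp_subset: "\<phi> \<in> Dop k m \<Longrightarrow> cmp \<theta> \<phi> k ` {..k} \<subseteq> \<theta> ` {..m}"
  unfolding cmp_def Dop_def by auto

lemma closed_miss: "closed_sset (miss n F)"
  unfolding closed_sset_def miss_def Delta_def
  using Dop_cmp image_cmp_subset by (simp; meson subset_trans)

lemma miss_subset: "fst (miss n F) k \<subseteq> Dop k n" "snd (miss n F) = snd (Delta n)"
  by (auto simp: miss_def)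

abbreviation Delta2 :: "nat \<Rightarrow> nat \<Rightarrow> ((nat \<Rightarrow> nat) \<times> (nat \<Rightarrow> nat)) sset" where
  "Delta2 n m \<equiv> sset_prod (Delta n) (Delta m)"

text \<open>Subcomplexes of \<open>\<Delta>\<^sup>n \<times> \<Delta>\<^sup>m\<close> are given by the vertex sets of their simplices.\<close>

definition grid_chains :: "nat \<Rightarrow> nat \<Rightarrow> (nat \<times> nat) set set" where
  "grid_chains n m = chain_family (\<lambda>p. int (fst p)) (\<lambda>p. int (snd p)) ({..n} \<times> {..m})"

definition vertices :: "nat \<Rightarrow> (nat \<Rightarrow> nat) \<times> (nat \<Rightarrow> nat) \<Rightarrow> (nat \<times> nat) set" where
  "vertices k t = (\<lambda>i. (fst t i, snd t i)) ` {..k}"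

text \<open>A degenerate simplex has the same vertex set as the nondegenerate one underlying it, so
  a finite family of chains describes a subcomplex in all degrees.\<close>

definition subcx :: "nat \<Rightarrow> nat \<Rightarrow> (nat \<times> nat) set set \<Rightarrow> ((nat \<Rightarrow> nat) \<times> (nat \<Rightarrow> nat)) sset" where
  "subcx n m \<S> = ((\<lambda>k. {t \<in> fst (Delta2 n m) k. vertices k t \<in> \<S>}), snd (Delta2 n m))"

abbreviation faces :: "(nat \<times> nat) set \<Rightarrow> (nat \<times> nat) set set" where
  "faces \<tau> \<equiv> {\<rho>. \<rho> \<subseteq> \<tau> \<and> \<rho> \<noteq> {}}"

lemma chainsD:
  assumes "\<sigma> \<in> grid_chains n m"
  shows "\<sigma> \<subseteq> {..n} \<times> {..m}" "\<sigma> \<noteq> {}"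
    "\<lbrakk>c \<in> \<sigma>; d \<in> \<sigma>\<rbrakk> \<Longrightarrow> fst c \<le> fst d \<and> snd c \<le> snd d \<or> fst d \<le> fst c \<and> snd d \<le> snd c"
proof -
  have A: "\<sigma> \<subseteq> {..n} \<times> {..m} \<and> \<sigma> \<noteq> {} \<and>
    (\<forall>c\<in>\<sigma>. \<forall>d\<in>\<sigma>. fst c \<le> fst d \<and> snd c \<le> snd d \<or> fst d \<le> fst c \<and> snd d \<le> snd c)"
    using assms unfolding grid_chains_def chain_family_def by simp
  then show "\<sigma> \<subseteq> {..n} \<times> {..m}" "\<sigma> \<noteq> {}" by simp_all
  show "\<lbrakk>c \<in> \<sigma>; d \<in> \<sigma>\<rbrakk> \<Longrightarrow> fst c \<le> fst d \<and> snd c \<le> snd d \<or> fst d \<le> fst c \<and> snd d \<le> snd c"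
    by (rule bspec[OF bspec[OF A[THEN conjunct2, THEN conjunct2]]])
qed

lemma chainsI:
  assumes "\<sigma> \<subseteq> {..n} \<times> {..m}" "\<sigma> \<noteq> {}"
    "\<And>c d. \<lbrakk>c \<in> \<sigma>; d \<in> \<sigma>\<rbrakk> \<Longrightarrow> fst c \<le> fst d \<and> snd c \<le> snd d \<or> fst d \<le> fst c \<and> snd d \<le> snd c"
  shows "\<sigma> \<in> grid_chains n m"
  using assms unfolding grid_chains_def chain_family_def by simp

lemma down_closed_chains: "down_closed (grid_chains n m)"
  unfolding grid_chains_def by (rule down_closed_chain_family)

lemma finite_chain: "\<sigma> \<in> grid_chains n m \<Longrightarrow> finite \<sigma>"
  by (rule finite_subset[OF chainsD(1)]) simp_all

lemma finite_chains: "finite (grid_chains n m)"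
  by (rule finite_subset[of _ "Pow ({..n} \<times> {..m})"]) (use chainsD(1) in auto)

lemma snd_Delta2: "snd (Delta2 n m) j k \<theta> t = (cmp (fst t) \<theta> j, cmp (snd t) \<theta> j)"
  by (simp add: sset_prod_def Delta_def)

lemma fst_Delta2: "t \<in> fst (Delta2 n m) k \<longleftrightarrow> fst t \<in> Dop k n \<and> snd t \<in> Dop k m"
  by (cases t) (simp add: sset_prod_def Delta_def)

lemma vertices_nonempty: "vertices k t \<noteq> {}"
  by (simp add: vertices_def)

lemma vertices_face: "\<theta> \<in> Dop j k \<Longrightarrow> vertices j (snd (Delta2 n m) j k \<theta> t) \<subseteq> vertices k t"
  unfolding vertices_def snd_Delta2 Dop_def cmp_def by auto

lemma vertices_in_chains:
  assumes "t \<in> fst (Delta2 n m) k"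
  shows "vertices k t \<in> grid_chains n m"
proof (rule chainsI)
  show "vertices k t \<subseteq> {..n} \<times> {..m}"
    using assms unfolding vertices_def fst_Delta2 Dop_def by auto
  fix c d assume "c \<in> vertices k t" "d \<in> vertices k t"
  then obtain i j where "i \<le> k" "j \<le> k" "c = (fst t i, snd t i)" "d = (fst t j, snd t j)"
    unfolding vertices_def by auto
  then show "fst c \<le> fst d \<and> snd c \<le> snd d \<or> fst d \<le> fst c \<and> snd d \<le> snd c"
    using assms linear[of i j] unfolding fst_Delta2 Dop_def by auto
qed (rule vertices_nonempty)

lemma closed_subcx: "down_closed \<S> \<Longrightarrow> closed_sset (subcx n m \<S>)"
  unfolding closed_sset_def
proof (intro allI impI)
  fix j k \<theta> t assume S: "down_closed \<S>" and \<theta>: "\<theta> \<in> Dop j k" and t: "t \<in> fst (subcx n m \<S>) k"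
  have "snd (Delta2 n m) j k \<theta> t \<in> fst (Delta2 n m) j"
    using closed_ssetD[OF closed_sset_prod[OF closed_Delta closed_Delta] \<theta>] t by (simp add: subcx_def)
  moreover have "vertices j (snd (Delta2 n m) j k \<theta> t) \<in> \<S>"
    using down_closedD[OF S _ vertices_face[OF \<theta>] vertices_nonempty] t by (simp add: subcx_def)
  ultimately show "snd (subcx n m \<S>) j k \<theta> t \<in> fst (subcx n m \<S>) j" by (simp add: subcx_def)
qed

lemma subcx_chains: "subcx n m (grid_chains n m) = Delta2 n m"
  using vertices_in_chains by (intro prod_eqI ext) (auto simp: subcx_def)

lemma subcx_union: "sset_union (subcx n m \<S>) (subcx n m \<S>') = subcx n m (\<S> \<union> \<S>')"
  by (auto simp: subcx_def sset_union_def)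

lemma subcx_inter: "sset_inter (subcx n m \<S>) (subcx n m \<S>') = subcx n m (\<S> \<inter> \<S>')"
  by (auto simp: subcx_def sset_inter_def)

lemma subcx_subset: "fst (subcx n m \<S>) k \<subseteq> fst (Delta2 n m) k" "snd (subcx n m \<S>) = snd (Delta2 n m)"
  by (auto simp: subcx_def)

lemma down_closed_faces: "down_closed (faces \<tau>)"
  unfolding down_closed_def by auto

lemma down_closed_inter: "\<lbrakk>down_closed \<S>; down_closed \<S>'\<rbrakk> \<Longrightarrow> down_closed (\<S> \<inter> \<S>')"
  unfolding down_closed_def by blast

lemma snd_subcx: "snd (subcx n m \<S>) j k \<theta> t = (cmp (fst t) \<theta> j, cmp (snd t) \<theta> j)"
  by (simp add: subcx_def snd_Delta2)

lemma snd_Delta: "snd (Delta n) j k \<theta> t = cmp t \<theta> j"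
  by (simp add: Delta_def)

text \<open>On a chain the sum of the coordinates is injective and reflects the order.\<close>

lemma chain_enumeration:
  assumes \<tau>: "\<tau> \<in> grid_chains n m"
  obtains k :: nat and e where "bij_betw e {..k} \<tau>"
    "\<And>i j. \<lbrakk>i \<le> j; j \<le> k\<rbrakk> \<Longrightarrow> fst (e i) \<le> fst (e j) \<and> snd (e i) \<le> snd (e j)"
proof -
  define s where "s c = fst c + snd c" for c :: "nat \<times> nat"
  have inj: "inj_on s \<tau>"
  proof (rule inj_onI)
    fix c d assume A: "c \<in> \<tau>" "d \<in> \<tau>" "s c = s d"
    show "c = d" using chainsD(3)[OF \<tau> A(1,2)] A(3) unfolding s_def by (intro prod_eqI) auto
  qed
  define l where "l = sorted_list_of_set (s ` \<tau>)"
  have fin: "finite (s ` \<tau>)" using finite_chain[OF \<tau>] by simp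
  have l: "set l = s ` \<tau>" "sorted l" "distinct l" using fin by (simp_all add: l_def)
  then have "l \<noteq> []" using chainsD(2)[OF \<tau>] by auto
  then obtain k where k: "length l = Suc k" by (cases l) auto
  define e where "e i = inv_into \<tau> s (l ! i)" for i
  have se: "e i \<in> \<tau>" "s (e i) = l ! i" if "i \<le> k" for i
  proof -
    have "l ! i \<in> s ` \<tau>" using that k l(1) by (metis le_imp_less_Suc nth_mem)
    then show "e i \<in> \<tau>" "s (e i) = l ! i" unfolding e_def by (auto intro: inv_into_into f_inv_into_f)
  qed
  have bij: "bij_betw e {..k} \<tau>"
  proof (rule bij_betwI')
    fix i j assume ij: "i \<in> {..k}" "j \<in> {..k}"
    show "e i = e j \<longleftrightarrow> i = j"
      using ij se(2)[of i] se(2)[of j] nth_eq_iff_index_eq[OF l(3), of i j] k by auto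
  next
    fix c assume c: "c \<in> \<tau>"
    then obtain i where i: "i < length l" "l ! i = s c" using l(1) by (metis image_eqI in_set_conv_nth)
    then have "e i = c" using inj c by (simp add: e_def)
    then show "\<exists>i \<in> {..k}. c = e i" using i k by auto
  qed (use se in auto)
  have mono: "fst (e i) \<le> fst (e j) \<and> snd (e i) \<le> snd (e j)" if "i \<le> j" "j \<le> k" for i j
  proof -
    have "s (e i) \<le> s (e j)" using that se k sorted_nth_mono[OF l(2)] by simp
    then show ?thesis using chainsD(3)[OF \<tau> se(1)[of i] se(1)[of j]] that unfolding s_def by auto
  qed
  show ?thesis by (rule that, rule bij, rule mono)
qed

text \<open>A simplex with vertices in the chain is a monotone sequence in it, hence an operator
  into its enumeration \<open>e\<close>. The last conclusion lets subcomplexes of the cell be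
  recognised by their vertex indices.\<close>

lemma cell_iso:
  assumes \<tau>: "\<tau> \<in> grid_chains n m"
  obtains k e \<phi> \<psi> where "bij_betw e {..k} \<tau>"
    "sset_map \<phi> (subcx n m (faces \<tau>)) (Delta k)" "sset_map \<psi> (Delta k) (subcx n m (faces \<tau>))"
    "\<And>j t. t \<in> fst (subcx n m (faces \<tau>)) j \<Longrightarrow> \<psi> j (\<phi> j t) = t"
    "\<And>j \<theta>. \<theta> \<in> fst (Delta k) j \<Longrightarrow> \<phi> j (\<psi> j \<theta>) = \<theta>"
    "\<And>j \<theta>. \<theta> \<in> fst (Delta k) j \<Longrightarrow> vertices j (\<psi> j \<theta>) = e ` \<theta> ` {..j}"
proof -
  obtain k :: nat and e where e: "bij_betw e {..k} \<tau>"
    "\<And>i j. \<lbrakk>i \<le> j; j \<le> k\<rbrakk> \<Longrightarrow> fst (e i) \<le> fst (e j) \<and> snd (e i) \<le> snd (e j)"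
    by (rule chain_enumeration[OF \<tau>]) (rule that)
  \<comment> \<open>The value 0 beyond \<open>j\<close> matches the normal form required by
    \<open>Dop\<close>.\<close>
  define \<psi> where "\<psi> j \<theta> = ((\<lambda>i. if i \<le> j then fst (e (\<theta> i)) else 0), (\<lambda>i. if i \<le> j then snd (e (\<theta> i)) else 0))"
    for j :: nat and \<theta> :: "nat \<Rightarrow> nat"
  define \<phi> where "\<phi> j t = (\<lambda>i. if i \<le> j then inv_into {..k} e (fst t i, snd t i) else 0)"
    for j :: nat and t :: "(nat \<Rightarrow> nat) \<times> (nat \<Rightarrow> nat)"
  have einj: "inj_on e {..k}" and eim: "e ` {..k} = \<tau>" using e(1) by (auto simp: bij_betw_def)
  have \<theta>k: "\<theta> i \<le> k" if "\<theta> \<in> Dop j k" "i \<le> j" for \<theta> i j using that by (simp add: Dop_def)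
  have v\<psi>: "vertices j (\<psi> j \<theta>) = e ` \<theta> ` {..j}" if "\<theta> \<in> Dop j k" for j \<theta>
    unfolding vertices_def \<psi>_def by force
  have \<psi>1: "\<psi> j \<theta> \<in> fst (subcx n m (faces \<tau>)) j" if \<theta>: "\<theta> \<in> Dop j k" for j \<theta>
  proof -
    have en: "e r \<in> {..n} \<times> {..m}" if "r \<le> k" for r using eim that chainsD(1)[OF \<tau>] by blast
    have mon: "\<theta> i \<le> \<theta> i'" if "i \<le> i'" "i' \<le> j" for i i' using that \<theta> by (simp add: Dop_def)
    have "fst (\<psi> j \<theta>) \<in> Dop j n" "snd (\<psi> j \<theta>) \<in> Dop j m"
      using e(2)[OF mon \<theta>k[OF \<theta>]] en[OF \<theta>k[OF \<theta>]] unfolding \<psi>_def by (auto simp: Dop_def mem_Times_iff)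
    moreover have "vertices j (\<psi> j \<theta>) \<subseteq> \<tau>" unfolding v\<psi>[OF \<theta>] using eim \<theta>k[OF \<theta>] by auto
    ultimately show ?thesis using vertices_nonempty by (simp add: subcx_def fst_Delta2)
  qed
  have \<phi>1: "(fst t i, snd t i) \<in> \<tau>" "inv_into {..k} e (fst t i, snd t i) \<le> k"
    "e (inv_into {..k} e (fst t i, snd t i)) = (fst t i, snd t i)"
    if t: "t \<in> fst (subcx n m (faces \<tau>)) j" "i \<le> j" for t i j
  proof -
    show *: "(fst t i, snd t i) \<in> \<tau>" using t unfolding subcx_def vertices_def by auto
    then show "inv_into {..k} e (fst t i, snd t i) \<le> k" using inv_into_into[of _ e "{..k}"] eim by blast
    show "e (inv_into {..k} e (fst t i, snd t i)) = (fst t i, snd t i)"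
      using * eim by (intro f_inv_into_f) simp
  qed
  have \<phi>2: "\<phi> j t \<in> Dop j k" if t: "t \<in> fst (subcx n m (faces \<tau>)) j" for t j
  proof -
    let ?r = "\<lambda>i. inv_into {..k} e (fst t i, snd t i)"
    \<comment> \<open>If the indices were in the wrong order, monotonicity of \<open>e\<close> and
      of \<open>t\<close> would force the two vertices to coincide, hence also their
      indices.\<close>
    have "?r i \<le> ?r i'" if i: "i \<le> i'" "i' \<le> j" for i i'
    proof (rule ccontr)
      assume "\<not> ?r i \<le> ?r i'"
      moreover from this have "fst (e (?r i')) \<le> fst (e (?r i)) \<and> snd (e (?r i')) \<le> snd (e (?r i))"
        using \<phi>1(2)[OF t, of i] i by (intro e(2)) auto
      moreover have "fst t i \<le> fst t i'" "snd t i \<le> snd t i'"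
        using t i by (auto simp: subcx_def fst_Delta2 Dop_def)
      ultimately show False using \<phi>1(3)[OF t, of i] \<phi>1(3)[OF t, of i'] i by auto
    qed
    then show ?thesis using \<phi>1(2)[OF t] by (auto simp: \<phi>_def Dop_def)
  qed
  have s1: "sset_map \<phi> (subcx n m (faces \<tau>)) (Delta k)"
    unfolding sset_map_def
  proof (intro conjI allI ballI impI)
    fix j t assume "t \<in> fst (subcx n m (faces \<tau>)) j"
    then show "\<phi> j t \<in> fst (Delta k) j" using \<phi>2 by (simp add: Delta_def)
  next
    fix j l \<theta> t assume "\<theta> \<in> Dop j l"
    then have "i \<le> j \<Longrightarrow> \<theta> i \<le> l" for i by (simp add: Dop_def)
    then show "\<phi> j (snd (subcx n m (faces \<tau>)) j l \<theta> t) = snd (Delta k) j l \<theta> (\<phi> l t)"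
      by (auto simp: \<phi>_def snd_subcx snd_Delta cmp_def)
  qed
  have s2: "sset_map \<psi> (Delta k) (subcx n m (faces \<tau>))"
    unfolding sset_map_def
  proof (intro conjI allI ballI impI)
    fix j \<theta> assume "\<theta> \<in> fst (Delta k) j"
    then show "\<psi> j \<theta> \<in> fst (subcx n m (faces \<tau>)) j" using \<psi>1 by (simp add: Delta_def)
  next
    fix j l \<theta> \<chi> assume "\<theta> \<in> Dop j l"
    then have "i \<le> j \<Longrightarrow> \<theta> i \<le> l" for i by (simp add: Dop_def)
    then show "\<psi> j (snd (Delta k) j l \<theta> \<chi>) = snd (subcx n m (faces \<tau>)) j l \<theta> (\<psi> l \<chi>)"
      by (auto simp: \<psi>_def snd_subcx snd_Delta cmp_def)
  qed
  have i1: "\<psi> j (\<phi> j t) = t" if t: "t \<in> fst (subcx n m (faces \<tau>)) j" for j t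
  proof (intro prod_eqI ext)
    fix i
    have 0: "j < i \<Longrightarrow> fst t i = 0 \<and> snd t i = 0" using t by (auto simp: subcx_def fst_Delta2 Dop_def)
    show "fst (\<psi> j (\<phi> j t)) i = fst t i" "snd (\<psi> j (\<phi> j t)) i = snd t i"
      using \<phi>1(3)[OF t] 0 by (auto simp: \<psi>_def \<phi>_def)
  qed
  have i2: "\<phi> j (\<psi> j \<theta>) = \<theta>" if "\<theta> \<in> fst (Delta k) j" for j \<theta>
  proof
    fix i
    have \<theta>: "\<theta> \<in> Dop j k" using that by (simp add: Delta_def)
    then have "j < i \<Longrightarrow> \<theta> i = 0" by (simp add: Dop_def)
    then show "\<phi> j (\<psi> j \<theta>) i = \<theta> i"
      using inv_into_f_f[OF einj, of "\<theta> i"] \<theta>k[OF \<theta>, of i] by (auto simp: \<psi>_def \<phi>_def)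
  qed
  show ?thesis by (rule that[OF e(1) s1 s2 i1 i2]) (use v\<psi> in \<open>auto simp: Delta_def\<close>)
qed

section \<open>Mapping objects of subcomplexes, and covers from filtrations\<close>

context descent
begin

text \<open>Removing a simplex of largest cardinality leaves a subcomplex; the whole is its union
  with a standard simplex, and the intersection is again smaller. Gluing therefore works by
  induction, starting from the terminal object.\<close>

lemma is_Map_subcx_exists:
  assumes X: "is_sspace C X" and S: "down_closed \<S>" "\<S> \<subseteq> grid_chains n m"
  shows "\<exists>M u. is_Map C (subcx n m \<S>) X M u"
  using S
proof (induction "card \<S>" arbitrary: \<S> rule: less_induct)
  case less
  have fin: "finite \<S>" using finite_subset[OF less.prems(2) finite_chains] .
  show ?case
  proof (cases "\<S> = {}")
    case True
    obtain L where L: "L \<in> Obj C" "\<forall>z \<in> Obj C. \<exists>!h. h \<in> hom C z L" using terminal_exists by blast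
    have e: "fst (subcx n m \<S>) k = {}" for k using True by (simp add: subcx_def)
    have "is_Map C (subcx n m \<S>) X L u" for u
      unfolding is_Map_def spoint_def e using L by simp
    then show ?thesis by blast
  next
    case False
    then have "finite (card ` \<S>)" "card ` \<S> \<noteq> {}" using fin by auto
    note cS = this
    obtain \<tau> where \<tau>: "\<tau> \<in> \<S>" "Max (card ` \<S>) = card \<tau>" using Max_in[OF cS] by (elim imageE)
    have mx: "card \<sigma> \<le> card \<tau>" if "\<sigma> \<in> \<S>" for \<sigma>
      using Max_ge[OF cS(1) imageI[OF that]] \<tau>(2) by simp
    have \<tau>c: "\<tau> \<in> grid_chains n m" using \<tau> less.prems by blast
    let ?S = "\<S> - {\<tau>}"
    have nsub: "\<not> \<tau> \<subset> \<sigma>" if "\<sigma> \<in> \<S>" for \<sigma>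
    proof
      assume "\<tau> \<subset> \<sigma>"
      then have "card \<tau> < card \<sigma>"
        using finite_chain less.prems(2) that by (intro psubset_card_mono) auto
      then show False using mx[OF that] by simp
    qed
    have dS: "down_closed ?S" unfolding down_closed_def
    proof (intro conjI ballI allI impI)
      show "{} \<notin> ?S" using less.prems(1) by (simp add: down_closed_def)
      fix \<sigma> \<rho> assume A: "\<sigma> \<in> ?S" "\<rho> \<subseteq> \<sigma>" "\<rho> \<noteq> {}"
      then have "\<rho> \<in> \<S>" using down_closedD[OF less.prems(1)] by blast
      moreover have "\<rho> \<noteq> \<tau>" using A nsub[of \<sigma>] by auto
      ultimately show "\<rho> \<in> ?S" by simp
    qed
    have fS: "faces \<tau> \<subseteq> \<S>" using down_closedD[OF less.prems(1) \<tau>(1)] by blast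
    have dI: "down_closed (?S \<inter> faces \<tau>)" by (rule down_closed_inter[OF dS down_closed_faces])
    have c1: "card ?S < card \<S>" by (rule psubset_card_mono) (use fin \<tau> in auto)
    have c2: "card (?S \<inter> faces \<tau>) < card \<S>" by (rule psubset_card_mono) (use fin \<tau> in auto)
    obtain M1 u1 where M1: "is_Map C (subcx n m ?S) X M1 u1"
      using less.hyps[OF c1 dS] less.prems(2) by blast
    obtain M2 u2 where M2: "is_Map C (subcx n m (?S \<inter> faces \<tau>)) X M2 u2"
      using less.hyps[OF c2 dI] less.prems(2) by blast
    obtain k e \<phi> \<psi> where "bij_betw e {..k} \<tau>" and iso: "sset_map \<phi> (subcx n m (faces \<tau>)) (Delta k)"
      "sset_map \<psi> (Delta k) (subcx n m (faces \<tau>))"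
      "\<And>j t. t \<in> fst (subcx n m (faces \<tau>)) j \<Longrightarrow> \<psi> j (\<phi> j t) = t"
      "\<And>j \<theta>. \<theta> \<in> fst (Delta k) j \<Longrightarrow> \<phi> j (\<psi> j \<theta>) = \<theta>"
      and "\<And>j \<theta>. \<theta> \<in> fst (Delta k) j \<Longrightarrow> vertices j (\<psi> j \<theta>) = e ` \<theta> ` {..j}"
      by (rule cell_iso[OF \<tau>c]) (rule that)
    note M3 = is_Map_transfer[where \<phi>=\<phi> and \<psi>=\<psi>, OF is_Map_Delta[OF X] iso X closed_Delta]
    have "\<exists>M u. is_Map C (sset_union (subcx n m ?S) (subcx n m (faces \<tau>))) X M u"
      by (rule is_Map_union[OF X closed_subcx[OF dS] closed_subcx[OF down_closed_faces] _ M1 M3])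
        (use M2 in \<open>simp_all add: subcx_inter subcx_subset\<close>)
    moreover have "?S \<union> faces \<tau> = \<S>" using fS \<tau>(1) less.prems(1) unfolding down_closed_def by auto
    ultimately show ?thesis by (simp add: subcx_union)
  qed
qed

lemma represents_rel_subcx_exists:
  assumes X: "is_sspace C X" and Y: "is_sspace C Y" and f: "is_smor C X Y f"
    and S: "down_closed \<S>" "\<S> \<subseteq> grid_chains n m"
  shows "\<exists>P A B. represents_rel C (subcx n m \<S>) (Delta2 n m) X Y f P A B"
proof -
  obtain MX uX where MX: "is_Map C (subcx n m \<S>) X MX uX" using is_Map_subcx_exists[OF X S] by blast
  obtain MY uY where MY: "is_Map C (subcx n m \<S>) Y MY uY" using is_Map_subcx_exists[OF Y S] by blast
  obtain MT uT where MT: "is_Map C (Delta2 n m) Y MT uT"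
    using is_Map_subcx_exists[OF Y down_closed_chains subset_refl, of n m] unfolding subcx_chains by blast
  obtain P A B where "is_RelMap C (subcx n m \<S>) (Delta2 n m) X Y f P A B"
    using is_RelMap_exists[OF X Y closed_subcx[OF S(1)] subcx_subset f MX MY MT] by blast
  then show ?thesis
    using is_RelMap_represents[OF X Y closed_subcx[OF S(1)] closed_sset_prod[OF closed_Delta closed_Delta]
        subcx_subset is_smorD(1)[OF f]] by blast
qed

text \<open>Along the filtration the arrow from Map(T, X) to the relative mapping object factors
  into one arrow per attached cell, each a pullback of a cover. The assumption \<open>cov\<close> is
  phrased with an enumeration \<open>e\<close> of the cell because \<open>F\<close> must be read as
  a set of vertices of the standard simplex.\<close>

lemma cov_built:
  assumes X: "is_sspace C X" and Y: "is_sspace C Y" and f: "is_smor C X Y f"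
    and M: "is_Map C (Delta2 n m) X M u"
    and cov: "\<And>\<tau> F k e. \<lbrakk>\<tau> \<in> grid_chains n m; F \<subseteq> \<tau>; Adm \<tau> F; bij_betw e {..k} \<tau>\<rbrakk>
      \<Longrightarrow> rel_cover C cov (miss k {r \<in> {..k}. e r \<in> F}) k X Y f"
    and S: "built Adm (grid_chains n m) \<S>" "down_closed \<S>" "\<S> \<subseteq> grid_chains n m"
    and P: "represents_rel C (subcx n m \<S>) (Delta2 n m) X Y f P A B"
    and h: "h \<in> hom C M P" "\<And>k t. t \<in> fst (subcx n m \<S>) k \<Longrightarrow> A k t \<cdot> h = u k t"
      "\<And>k t. t \<in> fst (Delta2 n m) k \<Longrightarrow> B k t \<cdot> h = f k \<cdot> u k t"
  shows "cov h"
proof -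
  note T = closed_sset_prod[OF closed_Delta closed_Delta, of n m] and fh = is_smorD(1)[OF f]
  show ?thesis using S P h
  proof (induction arbitrary: P A B h rule: built.induct)
    case refl
    note P = refl(3)[unfolded subcx_chains] and h = refl(4-6)[unfolded subcx_chains]
    note R = rel_pointD[OF represents_relD(2)[OF P]]
    \<comment> \<open>When nothing is missing, the \<open>Y\<close>-component is determined by the
      \<open>X\<close>-component; classifying the latter yields the inverse \<open>l\<close> of
      \<open>h\<close>.\<close>
    obtain l where l: "l \<in> hom C P M" "\<And>k t. t \<in> fst (Delta2 n m) k \<Longrightarrow> u k t \<cdot> l = A k t"
      using is_Map_lift[OF M represents_relD(1)[OF P] R(1)] by blast
    have "l \<cdot> h = Ident C M"
    proof (rule is_Map_eqI[OF X T M comp_hom[OF h(1) l(1)] ident_hom[OF is_MapD(1)[OF M]]])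
      fix k t assume t: "t \<in> fst (Delta2 n m) k"
      show "u k t \<cdot> l \<cdot> h = u k t \<cdot> Ident C M"
        using comp_extend1[OF l(2)[OF t] h(1) l(1) is_MapD(3)[OF M t]] h(2)[OF t]
          comp_ident(1)[OF is_MapD(3)[OF M t]] by simp
    qed
    moreover have "h \<cdot> l = Ident C P"
    proof (rule represents_rel_eqI[OF X Y T T fh P comp_hom[OF l(1) h(1)] ident_hom[OF represents_relD(1)[OF P]]])
      fix k t assume t: "t \<in> fst (Delta2 n m) k"
      show "A k t \<cdot> h \<cdot> l = A k t \<cdot> Ident C P"
        using comp_extend1[OF h(2)[OF t] l(1) h(1) R(4)[OF t]] l(2)[OF t] comp_ident(1)[OF R(4)[OF t]] by simp
      show "B k t \<cdot> h \<cdot> l = B k t \<cdot> Ident C P"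
        using comp_extend[OF h(3)[OF t] l(1) h(1) R(5)[OF t] is_MapD(3)[OF M t] fh] l(2)[OF t] R(3)[OF t]
          comp_ident(1)[OF R(5)[OF t]] by simp
    qed
    ultimately show ?case by (rule cov_iso[OF h(1) l(1)])
  next
    case (attach \<tau> F \<S>)
    note S = attach.prems(1,2) and P = attach.prems(3) and h = attach.prems(4-6)
    note R = rel_pointD[OF represents_relD(2)[OF P]]
    let ?S' = "\<S> \<union> faces \<tau>"
    have dS': "down_closed ?S'" by (rule down_closed_attach[OF S(1)])
    have fc: "faces \<tau> \<subseteq> grid_chains n m" using down_closedD[OF down_closed_chains attach(1)] by blast
    then have S'c: "?S' \<subseteq> grid_chains n m" using S(2) by blast
    obtain P' A' B' where P': "represents_rel C (subcx n m ?S') (Delta2 n m) X Y f P' A' B'"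
      using represents_rel_subcx_exists[OF X Y f dS' S'c] by blast
    note R' = rel_pointD[OF represents_relD(2)[OF P']]
    have sub: "fst (subcx n m \<S>) k \<subseteq> fst (subcx n m ?S') k" for k by (auto simp: subcx_def)
    have "rel_point C (subcx n m \<S>) (Delta2 n m) X Y f P' A' B'"
      unfolding rel_point_def
    proof (intro conjI allI ballI)
      show "spoint C (subcx n m \<S>) X P' A'"
        by (rule spoint_subset[OF R'(1) sub]) (simp add: subcx_subset)
    qed (use R'(2,3) sub in blast)+
    then obtain h1 where h1: "h1 \<in> hom C P' P" "\<And>k t. t \<in> fst (subcx n m \<S>) k \<Longrightarrow> A k t \<cdot> h1 = A' k t"
      "\<And>k t. t \<in> fst (Delta2 n m) k \<Longrightarrow> B k t \<cdot> h1 = B' k t"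
      using represents_rel_lift[OF P represents_relD(1)[OF P']] by blast
    have "rel_point C (subcx n m ?S') (Delta2 n m) X Y f M u (\<lambda>k t. f k \<cdot> u k t)"
      unfolding rel_point_def
      using spoint_subset[OF is_MapD(2)[OF M] subcx_subset] spoint_postcomp[OF X Y f is_MapD(2)[OF M]] by blast
    then obtain h2 where h2: "h2 \<in> hom C M P'" "\<And>k t. t \<in> fst (subcx n m ?S') k \<Longrightarrow> A' k t \<cdot> h2 = u k t"
      "\<And>k t. t \<in> fst (Delta2 n m) k \<Longrightarrow> B' k t \<cdot> h2 = f k \<cdot> u k t"
      using represents_rel_lift[OF P' is_MapD(1)[OF M]] by blast
    \<comment> \<open>The induction hypothesis handles the stage after the attachment. It remains to
      treat \<open>h1\<close>, which forgets the new cell.\<close>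
    have "cov h2" by (rule attach.IH[OF dS' S'c P' h2])
    moreover have "cov h1"
    proof -
      obtain k e \<phi> \<psi> where e: "bij_betw e {..k} \<tau>"
        and \<phi>: "sset_map \<phi> (subcx n m (faces \<tau>)) (Delta k)"
        and \<psi>: "sset_map \<psi> (Delta k) (subcx n m (faces \<tau>))"
        and inv: "\<And>j t. t \<in> fst (subcx n m (faces \<tau>)) j \<Longrightarrow> \<psi> j (\<phi> j t) = t"
          "\<And>j \<theta>. \<theta> \<in> fst (Delta k) j \<Longrightarrow> \<phi> j (\<psi> j \<theta>) = \<theta>"
        and vert: "\<And>j \<theta>. \<theta> \<in> fst (Delta k) j \<Longrightarrow> vertices j (\<psi> j \<theta>) = e ` \<theta> ` {..j}"
        by (rule cell_iso[OF attach(1)]) (rule that)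
      \<comment> \<open>The indices of the vertices in \<open>F\<close>: under the isomorphism of
        the cell with \<open>Delta k\<close>, the part already present becomes
        \<open>miss k G\<close>.\<close>
      define G where "G = {r \<in> {..k}. e r \<in> F}"
      have FG: "F \<subseteq> e ` R \<longleftrightarrow> G \<subseteq> R" if "R \<subseteq> {..k}" for R
      proof
        assume F: "F \<subseteq> e ` R"
        show "G \<subseteq> R"
        proof
          fix r assume "r \<in> G"
          then have r: "r \<in> {..k}" "e r \<in> F" by (auto simp: G_def)
          then obtain r' where "r' \<in> R" "e r = e r'" using F by blast
          then show "r \<in> R" using e r(1) that unfolding bij_betw_def inj_on_def by blast
        qed
      next
        assume "G \<subseteq> R"
        moreover have "F \<subseteq> e ` G"
        proof
          fix c assume c: "c \<in> F"
          then obtain r where "r \<in> {..k}" "c = e r" using e attach(2) unfolding bij_betw_def by blast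
          then show "c \<in> e ` G" using c by (simp add: G_def)
        qed
        ultimately show "F \<subseteq> e ` R" by blast
      qed
      have I: "\<S> \<inter> faces \<tau> = {\<rho> \<in> faces \<tau>. \<not> F \<subseteq> \<rho>}"
      proof (rule set_eqI)
        fix \<rho>
        have "\<rho> \<in> {\<rho> \<in> \<S>. \<rho> \<subseteq> \<tau>} \<longleftrightarrow> \<rho> \<in> {\<rho>. \<rho> \<subseteq> \<tau> \<and> \<rho> \<noteq> {} \<and> \<not> F \<subseteq> \<rho>}"
          by (simp only: attach(4))
        then show "\<rho> \<in> \<S> \<inter> faces \<tau> \<longleftrightarrow> \<rho> \<in> {\<rho> \<in> faces \<tau>. \<not> F \<subseteq> \<rho>}" by simp blast
      qed
      have dI: "down_closed (\<S> \<inter> faces \<tau>)" by (rule down_closed_inter[OF S(1) down_closed_faces])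
      have Ic: "\<S> \<inter> faces \<tau> \<subseteq> grid_chains n m" using fc by blast
      have mem: "\<psi> j \<theta> \<in> fst (subcx n m (\<S> \<inter> faces \<tau>)) j \<longleftrightarrow> \<theta> \<in> fst (miss k G) j"
        if \<theta>: "\<theta> \<in> fst (Delta k) j" for j \<theta>
      proof -
        have "\<psi> j \<theta> \<in> fst (subcx n m (faces \<tau>)) j" using \<psi> \<theta> unfolding sset_map_def by blast
        moreover have "\<theta> \<in> Dop j k" using \<theta> by (simp add: Delta_def)
        moreover from this have "\<theta> ` {..j} \<subseteq> {..k}" by (auto simp: Dop_def)
        ultimately show ?thesis
          using vert[OF \<theta>] FG[of "\<theta> ` {..j}"] unfolding I by (auto simp: subcx_def miss_def)
      qed
      have sI: "snd (subcx n m (\<S> \<inter> faces \<tau>)) = snd (subcx n m (faces \<tau>))" by (simp add: subcx_def)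
      have subI: "fst (subcx n m (\<S> \<inter> faces \<tau>)) j \<subseteq> fst (subcx n m (faces \<tau>)) j" for j by (auto simp: subcx_def)
      have \<phi>': "sset_map \<phi> (subcx n m (\<S> \<inter> faces \<tau>)) (miss k G)"
        unfolding sset_map_def
      proof (intro conjI allI ballI impI)
        fix j t assume t: "t \<in> fst (subcx n m (\<S> \<inter> faces \<tau>)) j"
        then have t': "t \<in> fst (subcx n m (faces \<tau>)) j" using subI by blast
        then have "\<phi> j t \<in> fst (Delta k) j" using \<phi> unfolding sset_map_def by blast
        then show "\<phi> j t \<in> fst (miss k G) j" using mem[of "\<phi> j t" j] inv(1)[OF t'] t by simp
        fix l \<theta> assume "\<theta> \<in> Dop l j"
        then show "\<phi> l (snd (subcx n m (\<S> \<inter> faces \<tau>)) l j \<theta> t) = snd (miss k G) l j \<theta> (\<phi> j t)"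
          using \<phi> t' unfolding sset_map_def sI miss_subset(2) by blast
      qed
      have missD: "fst (miss k G) j \<subseteq> fst (Delta k) j" for j using miss_subset(1) by (simp add: Delta_def)
      have \<psi>': "sset_map \<psi> (miss k G) (subcx n m (\<S> \<inter> faces \<tau>))"
        unfolding sset_map_def
      proof (intro conjI allI ballI impI)
        fix j \<chi> assume t: "\<chi> \<in> fst (miss k G) j"
        then have t': "\<chi> \<in> fst (Delta k) j" using missD by blast
        then show "\<psi> j \<chi> \<in> fst (subcx n m (\<S> \<inter> faces \<tau>)) j" using mem t by blast
        fix l \<theta> assume "\<theta> \<in> Dop l j"
        then show "\<psi> l (snd (miss k G) l j \<theta> \<chi>) = snd (subcx n m (\<S> \<inter> faces \<tau>)) l j \<theta> (\<psi> j \<chi>)"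
          using \<psi> t' unfolding sset_map_def sI miss_subset(2) by blast
      qed
      obtain MX uX where MX: "is_Map C (subcx n m (\<S> \<inter> faces \<tau>)) X MX uX"
        using is_Map_subcx_exists[OF X dI Ic] by blast
      obtain MY uY where MY: "is_Map C (subcx n m (\<S> \<inter> faces \<tau>)) Y MY uY"
        using is_Map_subcx_exists[OF Y dI Ic] by blast
      have rc: "rel_cover C cov (miss k G) k X Y f"
        unfolding G_def by (rule cov[OF attach(1-3) e])
      show ?thesis
        by (rule cov_attach_cell[where \<phi>=\<phi> and \<psi>=\<psi>, OF X Y f closed_subcx[OF S(1)]
              closed_subcx[OF down_closed_faces] T subcx_subset(2) subcx_subset(2) subcx_subset(1) subcx_subset(1)
              P P'[folded subcx_union] h1 closed_miss miss_subset(2) missD \<phi>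
              \<phi>'[folded subcx_inter] \<psi> \<psi>'[folded subcx_inter] inv
              MX[folded subcx_inter] MY[folded subcx_inter] rc])
    qed
    moreover have "h = h1 \<cdot> h2"
    proof (rule represents_rel_eqI[OF X Y closed_subcx[OF S(1)] T fh P h(1) comp_hom[OF h2(1) h1(1)]])
      fix k t assume t: "t \<in> fst (subcx n m \<S>) k"
      show "A k t \<cdot> h = A k t \<cdot> h1 \<cdot> h2"
        using comp_extend1[OF h1(2)[OF t] h2(1) h1(1) R(4)[OF t]] h2(2)[OF subsetD[OF sub t]] h(2)[OF t] by simp
    next
      fix k t assume t: "t \<in> fst (Delta2 n m) k"
      show "B k t \<cdot> h = B k t \<cdot> h1 \<cdot> h2"
        using comp_extend1[OF h1(3)[OF t] h2(1) h1(1) R(5)[OF t]] h2(3)[OF t] h(3)[OF t] by simp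
    qed
    ultimately show ?case using cov_comp h1(1) h2(1) by blast
  qed
qed

end

section \<open>Pushout products\<close>

definition miss2 :: "nat \<Rightarrow> nat \<Rightarrow> nat set \<Rightarrow> nat set \<Rightarrow> (nat \<times> nat) set set" where
  "miss2 n m F G = {\<sigma> \<in> grid_chains n m. \<not> (F \<subseteq> fst ` \<sigma> \<and> G \<subseteq> snd ` \<sigma>)}"

lemma down_closed_miss2: "down_closed (miss2 n m F G)"
  unfolding down_closed_def
proof (intro conjI ballI allI impI)
  show "{} \<notin> miss2 n m F G" using chainsD(2) by (auto simp: miss2_def)
  fix \<sigma> \<rho> assume A: "\<sigma> \<in> miss2 n m F G" "\<rho> \<subseteq> \<sigma>" "\<rho> \<noteq> {}"
  then have "\<sigma> \<in> grid_chains n m" by (simp add: miss2_def)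
  then have "\<rho> \<in> grid_chains n m" by (rule down_closedD[OF down_closed_chains _ A(2,3)])
  moreover have "fst ` \<rho> \<subseteq> fst ` \<sigma>" "snd ` \<rho> \<subseteq> snd ` \<sigma>" using A(2) by auto
  ultimately show "\<rho> \<in> miss2 n m F G" using A(1) by (auto simp: miss2_def)
qed

text \<open>Projecting the vertex set of a simplex of the product gives the vertex sets of its two
  components, so membership in the union can be read off from the chain.\<close>

lemma subcx_miss2:
  "sset_union (sset_prod (Delta n) (miss m G)) (sset_prod (miss n F) (Delta m)) = subcx n m (miss2 n m F G)"
proof (rule prod_eqI; rule ext)
  fix k
  have "t \<in> fst (sset_union (sset_prod (Delta n) (miss m G)) (sset_prod (miss n F) (Delta m))) k \<longleftrightarrow>
      t \<in> fst (subcx n m (miss2 n m F G)) k" for t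
  proof -
    have "fst ` vertices k t = fst t ` {..k}" "snd ` vertices k t = snd t ` {..k}"
      unfolding vertices_def by force+
    then show ?thesis
      using vertices_in_chains[of t n m k]
      by (cases t) (auto simp: sset_union_def sset_prod_def miss_def Delta_def subcx_def miss2_def)
  qed
  then show "fst (sset_union (sset_prod (Delta n) (miss m G)) (sset_prod (miss n F) (Delta m))) k =
      fst (subcx n m (miss2 n m F G)) k" by blast
qed (simp add: sset_union_def sset_prod_def subcx_def miss_def)

lemma built_bdry_miss2: "built adm_bdry (grid_chains n m) (miss2 n m F G)"
  by (rule built_bdry[OF finite_chains finite_chain down_closed_chains down_closed_miss2])
    (auto simp: miss2_def)

text \<open>Here \<open>p1\<close> is the projection that carries the horn, and \<open>s\<close>
  embeds vertices into the integers, possibly reversing them, so that \<open>j\<close> becomes the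
  column after \<open>i\<close>. Injectivity allows \<open>s\<close> to be cancelled from the
  covering conditions.\<close>

lemma built_horn_proj:
  fixes p1 p2 :: "nat \<times> nat \<Rightarrow> nat" and s :: "nat \<Rightarrow> int" and n m :: nat
  defines "G \<equiv> {..n} \<times> {..m}"
  assumes s: "inj s" and ch: "chain_family (\<lambda>c. s (p1 c)) (\<lambda>c. s (p2 c)) G = grid_chains n m"
    and box: "\<And>c d. \<lbrakk>c \<in> G; d \<in> G\<rbrakk> \<Longrightarrow> \<exists>e \<in> G. p1 e = p1 c \<and> p2 e = p2 d"
    and i: "i \<in> p1 ` G" and j: "j \<in> p1 ` G" "s j = s i + 1"
  shows "built adm_horn (grid_chains n m) {\<sigma> \<in> grid_chains n m. \<not> (p1 ` G - {i} \<subseteq> p1 ` \<sigma> \<and> p2 ` G \<subseteq> p2 ` \<sigma>)}"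
proof -
  have im: "(\<lambda>c. s (p c)) ` A = s ` p ` A" for p :: "nat \<times> nat \<Rightarrow> nat" and A by auto
  have "s i \<in> (\<lambda>c. s (p1 c)) ` G" "s i + 1 \<in> (\<lambda>c. s (p1 c)) ` G"
    using i j unfolding im by (auto simp flip: j(2))
  moreover have "finite G" by (simp add: G_def)
  moreover have "\<exists>e \<in> G. s (p1 e) = s (p1 c) \<and> s (p2 e) = s (p2 d)" if cd: "c \<in> G" "d \<in> G" for c d
  proof -
    obtain e where "e \<in> G" "p1 e = p1 c" "p2 e = p2 d" using box[OF cd] by blast
    then show ?thesis by (intro bexI[of _ e]) simp_all
  qed
  ultimately have "built adm_horn (grid_chains n m) {\<sigma> \<in> grid_chains n m.
      \<not> ((\<lambda>c. s (p1 c)) ` G - {s i} \<subseteq> (\<lambda>c. s (p1 c)) ` \<sigma> \<and> (\<lambda>c. s (p2 c)) ` G \<subseteq> (\<lambda>c. s (p2 c)) ` \<sigma>)}"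
    unfolding ch[symmetric] by (intro built_horn)
  moreover have "s ` A - {s i} \<subseteq> s ` B \<longleftrightarrow> A - {i} \<subseteq> B" "s ` A \<subseteq> s ` B \<longleftrightarrow> A \<subseteq> B" for A B
    using s by (auto simp: inj_image_subset_iff inj_eq image_iff subset_iff)
  ultimately show ?thesis unfolding im by simp
qed

text \<open>Comparability of two points survives reversing both coordinates at once and exchanging
  them, so all these families are the same chains.\<close>

lemma chain_family_signs:
  fixes s :: "nat \<Rightarrow> int"
  assumes "s = int \<or> s = (\<lambda>a. - int a)"
  shows "chain_family (\<lambda>c. s (fst c)) (\<lambda>c. s (snd c)) ({..n} \<times> {..m}) = grid_chains n m"
    "chain_family (\<lambda>c. s (snd c)) (\<lambda>c. s (fst c)) ({..n} \<times> {..m}) = grid_chains n m"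
proof -
  have "s a \<le> s b \<and> s a' \<le> s b' \<or> s b \<le> s a \<and> s b' \<le> s a' \<longleftrightarrow>
      int a \<le> int b \<and> int a' \<le> int b' \<or> int b \<le> int a \<and> int b' \<le> int a'" for a b a' b'
    using assms by auto
  then show "chain_family (\<lambda>c. s (fst c)) (\<lambda>c. s (snd c)) ({..n} \<times> {..m}) = grid_chains n m"
    "chain_family (\<lambda>c. s (snd c)) (\<lambda>c. s (fst c)) ({..n} \<times> {..m}) = grid_chains n m"
    unfolding grid_chains_def chain_family_def by (simp_all add: conj_commute)
qed

text \<open>The vertex after \<open>i\<close> serves unless \<open>i\<close> is the last one; then
  negation makes \<open>i - 1\<close> the successor, which exists because \<open>n\<close> is
  positive.\<close>

lemma horn_neighbour:
  assumes "0 < n" "i \<le> n"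
  obtains s :: "nat \<Rightarrow> int" and j where "s = int \<or> s = (\<lambda>a. - int a)" "inj s" "j \<le> n" "s j = s i + 1"
proof (cases "i < n")
  case True
  then show ?thesis by (intro that[of int "Suc i"]) auto
next
  case False
  with assms show ?thesis by (intro that[of "\<lambda>a. - int a" "i - 1"]) (auto simp: inj_on_def)
qed

lemma image_fst_snd_box: "fst ` ({..n} \<times> {..m}) = {..n}" "snd ` ({..n} \<times> {..m}) = {..m}" for n m :: nat
  by auto

lemma built_horn_miss2_fst:
  assumes "0 < n" "i \<le> n"
  shows "built adm_horn (grid_chains n m) (miss2 n m ({..n} - {i}) {..m})"
proof -
  obtain s :: "nat \<Rightarrow> int" and j where s: "s = int \<or> s = (\<lambda>a. - int a)" "inj s" "j \<le> n" "s j = s i + 1"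
    by (rule horn_neighbour[OF assms]) (rule that)
  show ?thesis
    using built_horn_proj[OF s(2) chain_family_signs(1)[OF s(1)] _ _ _ s(4)] assms s(3)
    unfolding image_fst_snd_box miss2_def by fastforce
qed

lemma built_horn_miss2_snd:
  assumes "0 < m" "i \<le> m"
  shows "built adm_horn (grid_chains n m) (miss2 n m {..n} ({..m} - {i}))"
proof -
  obtain s :: "nat \<Rightarrow> int" and j where s: "s = int \<or> s = (\<lambda>a. - int a)" "inj s" "j \<le> m" "s j = s i + 1"
    by (rule horn_neighbour[OF assms]) (rule that)
  have "built adm_horn (grid_chains n m) {\<sigma> \<in> grid_chains n m. \<not> ({..m} - {i} \<subseteq> snd ` \<sigma> \<and> {..n} \<subseteq> fst ` \<sigma>)}"
    using built_horn_proj[OF s(2) chain_family_signs(2)[OF s(1)] _ _ _ s(4)] assms s(3)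
    unfolding image_fst_snd_box by fastforce
  then show ?thesis by (simp add: miss2_def conj_commute)
qed

section \<open>Assembling adjunction, filtration and cover conditions\<close>

context descent
begin

text \<open>\<open>F\<close> selects the subcomplex used in the path spaces and \<open>G\<close> the
  one used to test \<open>g\<close>. They enter the filtration only through the pushout
  product.\<close>

lemma rel_cover_path:
  assumes X: "is_sspace C X" and Y: "is_sspace C Y" and f: "is_smor C X Y f"
    and cov: "\<And>\<tau> F' k e. \<lbrakk>\<tau> \<in> grid_chains n m; F' \<subseteq> \<tau>; Adm \<tau> F'; bij_betw e {..k} \<tau>\<rbrakk>
      \<Longrightarrow> rel_cover C cov (miss k {r \<in> {..k}. e r \<in> F'}) k X Y f"
    and S: "built Adm (grid_chains n m) (miss2 n m F G)"
    and path: "rel_path C (Delta n) (miss n F) X Y f PT Q g"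
  shows "rel_cover C cov (miss m G) m PT Q g"
  unfolding rel_cover_def
proof (intro allI impI; elim conjE)
  fix P a b h assume R: "is_RelMap C (miss m G) (Delta m) PT Q g P a b" and h: "h \<in> hom C (fst PT m) P"
    "\<forall>k. \<forall>\<theta> \<in> fst (miss m G) k. a k \<theta> \<cdot> h = snd PT k m \<theta>"
    "\<forall>k. \<forall>\<theta> \<in> Dop k m. b k \<theta> \<cdot> h = snd Q k m \<theta> \<cdot> g m"
  have sub: "\<And>k. fst (miss n F) k \<subseteq> fst (Delta n) k" using miss_subset(1) by (simp add: Delta_def)
  obtain A B u where
    "represents_rel C (sset_union (sset_prod (Delta n) (miss m G)) (sset_prod (miss n F) (Delta m)))
       (sset_prod (Delta n) (Delta m)) X Y f P A B"
    "is_Map C (sset_prod (Delta n) (Delta m)) X (fst PT m) u"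
    "\<And>k t. t \<in> fst (sset_union (sset_prod (Delta n) (miss m G)) (sset_prod (miss n F) (Delta m))) k
       \<Longrightarrow> A k t \<cdot> h = u k t"
    "\<And>k t. t \<in> fst (sset_prod (Delta n) (Delta m)) k \<Longrightarrow> B k t \<cdot> h = f k \<cdot> u k t"
    by (rule rel_path_represents[OF X Y f closed_Delta closed_miss miss_subset(2) sub closed_miss
          miss_subset(2) miss_subset(1) path R h(1) h(2)[rule_format] h(3)[rule_format]]) (assumption | rule that)+
  note U = this[unfolded subcx_miss2]
  show "cov h"
    by (rule cov_built[OF X Y f U(2) cov S down_closed_miss2 _ U(1) h(1) U(3,4)])
      (auto simp: miss2_def)
qed

lemma rel_cover_adm_horn:
  assumes "fibration C cov X Y f" "adm_horn \<tau> F" "bij_betw e {..k} \<tau>"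
  shows "rel_cover C cov (miss k {r \<in> {..k}. e r \<in> F}) k X Y f"
proof -
  obtain v where v: "v \<in> \<tau>" "F = \<tau> - {v}" "F \<noteq> {}" using assms(2) unfolding adm_horn_def by blast
  obtain i where i: "i \<le> k" "v = e i" using assms(3) v(1) unfolding bij_betw_def by blast
  have inj: "e r = e i \<longleftrightarrow> r = i" if "r \<le> k" for r
    using inj_on_eq_iff[OF bij_betw_imp_inj_on[OF assms(3)]] that i(1) by simp
  have "e r \<in> F \<longleftrightarrow> r \<noteq> i" if "r \<le> k" for r
    using bij_betwE[OF assms(3)] that inj[OF that] i(2) v(2) by auto
  then have "{r \<in> {..k}. e r \<in> F} = {..k} - {i}" by auto
  \<comment> \<open>A one-point chain would leave \<open>F\<close> empty, which
    \<open>adm_horn\<close> excludes; so the horn condition of the fibration applies.\<close>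
  moreover have "k \<noteq> 0"
  proof
    assume "k = 0"
    then have "\<tau> = {v}" using assms(3) i by (auto simp: bij_betw_def)
    then show False using v by blast
  qed
  ultimately show ?thesis
    using assms(1) i(1) unfolding fibration_def horn_eq_miss by simp
qed

lemma rel_cover_adm_bdry:
  assumes "hypercover C cov X Y f" "adm_bdry \<tau> F" "bij_betw e {..k} \<tau>"
  shows "rel_cover C cov (miss k {r \<in> {..k}. e r \<in> F}) k X Y f"
proof -
  have "{r \<in> {..k}. e r \<in> F} = {..k}"
    using bij_betwE[OF assms(3)] assms(2) by (auto simp: adm_bdry_def)
  then show ?thesis using assms(1) unfolding hypercover_def bdry_eq_miss by simp
qed

end

theorem theorem3p21:
  fixes C :: "('o, 'a) cat" and cov :: "'a \<Rightarrow> bool"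
    and X Y :: "('o, 'a) sspace" and f :: "nat \<Rightarrow> 'a"
  assumes "descent_cat C cov"
    and "is_sspace C X" and "is_sspace C Y" and "is_smor C X Y f"
  shows "(\<forall>n PnX Q g. rel_path C (Delta n) (bdry n) X Y f PnX Q g \<longrightarrow>
            (fibration C cov X Y f \<longrightarrow> fibration C cov PnX Q g) \<and>
            (hypercover C cov X Y f \<longrightarrow> hypercover C cov PnX Q g)) \<and>
         (\<forall>n i PnX Q g. 0 < n \<and> i \<le> n \<and> fibration C cov X Y f \<and>
            rel_path C (Delta n) (horn n i) X Y f PnX Q g \<longrightarrow>
            hypercover C cov PnX Q g)"
proof -
  interpret descent C cov
  proof unfold_locales
    show "is_cat C" using assms(1) unfolding descent_cat_def by (elim conjE)
  qed (rule assms(1))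
  note XYf = assms(2-4)
  \<comment> \<open>This serves both parts: for (a) \<open>F\<close> is the full vertex set and
    \<open>G\<close> omits one vertex, for (b) the roles are exchanged.\<close>
  have fib: "rel_cover C cov (miss m G) m PnX Q g"
    if "fibration C cov X Y f" "built adm_horn (grid_chains n m) (miss2 n m F G)"
      "rel_path C (Delta n) (miss n F) X Y f PnX Q g" for n m F G PnX Q g
    using rel_cover_path[OF XYf rel_cover_adm_horn[OF that(1)] that(2,3)] .
  have hyp: "rel_cover C cov (miss m G) m PnX Q g"
    if "hypercover C cov X Y f" "rel_path C (Delta n) (miss n F) X Y f PnX Q g" for n m F G PnX Q g
    using rel_cover_path[OF XYf rel_cover_adm_bdry[OF that(1)] built_bdry_miss2 that(2)] .
  show ?thesis
  proof (intro conjI allI impI; (elim conjE)?)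
    fix n PnX Q g assume path: "rel_path C (Delta n) (bdry n) X Y f PnX Q g"
    {
      assume "fibration C cov X Y f"
      then show "fibration C cov PnX Q g"
        using fib built_horn_miss2_snd path unfolding fibration_def[of C cov PnX] horn_eq_miss bdry_eq_miss
        by blast
    next
      assume "hypercover C cov X Y f"
      then show "hypercover C cov PnX Q g"
        using hyp path unfolding hypercover_def[of C cov PnX] bdry_eq_miss by blast
    }
  next
    fix n i PnX Q g assume "0 < n" "i \<le> n" "fibration C cov X Y f"
      "rel_path C (Delta n) (horn n i) X Y f PnX Q g"
    then show "hypercover C cov PnX Q g"
      using fib built_horn_miss2_fst unfolding hypercover_def bdry_eq_miss horn_eq_miss by blast
  qed
qed

end
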